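(* Let $\mathcal L$ be a uniform semimodular lattice of uniform-rank $n$, let $E$ be its set of ends, let $\mathcal B^\infty$ be the base family of its matroid at infinity, and let $x\in\mathcal L$. Define $\omega=\omega^{\mathcal L,x}:\mathcal B^\infty\to\mathbb Z$ by $\omega(B):=-r[x_B,x]$. Then $\omega$ is a complete valuated matroid of rank $n$ (on the matroid $(E,\mathcal B^\infty)$), and moreover: (1) $\mathcal T(\omega)\cap\mathbb Z^E$, ordered by the vector order, is isomorphic to $\mathcal L$; (2) $\mathcal T(\omega)$ is a geometric realization of the simplicial complex $\mathcal C(\mathcal L)$ consisting of all chains $x^0\prec x^1\prec\cdots\prec x^m$ in $\mathcal L$ with $x^m\preceq (x^0)^+$.
   Context: Lattices satisfy condition (F): no interval $[x,y]=\{z: x\preceq z\preceq y\}$ contains a chain of infinite length. $y$ covers $x$ ($x\prec_1 y$) if $x\prec y$ and $[x,y]=\{x,y\}$. A lattice is semimodular if $x\wedge a\prec_1 a$ implies $x\prec_1 x\vee a$; then all maximal chains in $[x,y]$ have a common finite length $r[x,y]$, and there is a height function $r:\mathcal L\to\mathbb Z$ with $r(y)=r(x)+1$ whenever $x\prec_1 y$. The ascending operator is $(x)^+:=\bigvee\{y: y \text{ covers } x\}$. A uniform semimodular lattice is a semimodular lattice (satisfying (F)) in which $(x)^+$ exists for all $x$ and $x\mapsto(x)^+$ is a lattice automorphism; $(\cdot)^-$ denotes its inverse and $(x)^{+k}$ its $k$-fold iterate ($k\in\mathbb Z$). The uniform-rank is the (common) rank $r[x,(x)^+]$. For $x\in\mathcal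 L$ put $r_x(y)=r(y)-r(x)$. A segment is a chain $e^0\prec e^1\prec\cdots\prec e^s$ with $e^{\ell-1}\prec_1 e^\ell$ for all $\ell$ and $e^{\ell+1}\notin[e^{\ell-1},(e^{\ell-1})^+]$ for $1\le \ell\le s-1$; a ray is an infinite chain $e^0\prec e^1\prec\cdots$ all of whose initial pieces $e^0\prec\cdots\prec e^\ell$ are segments; it is an $x$-ray if $e^0=x$. For an $x$-ray $(e^\ell)$ and $y\succeq x$ there is an index $\ell$ with $e^\ell\preceq y$, $e^{\ell+1}\not\preceq y$, and $(e^\ell)\vee y$ denotes the $y$-ray $y=e^\ell\vee y\prec e^{\ell+1}\vee y\prec\cdots$. An $x$-ray $(e^\ell)$ and a $y$-ray $(f^\ell)$ are parallel if $(e^\ell)\vee(x\vee y)=(f^\ell)\vee(x\vee y)$; this is an equivalence relation, whose classes are called ends; $E$ is the set of ends. For each end $e$ and $x\in\mathcal L$ there is a unique $x$-ray $e_x=(x=e_x^0\prec e_x^1\prec\cdots)$ in $e$. A set $I\subseteq E$ is independent at $x$ if $r_x(\bigvee_{e\in I}e_x^1)=|I|$; $\mathcal B^x$ is the family of sets independent at $x$ of cardinality $n$, $\mathcal B^\infty:=\bigcup_{x}\mathcal B^x$ (the bases of the matroid at infinity). For $B\in\mathcal B^{x'}$, let $\mathcal S^{x'}(B)$ be the sublattice generated by all elements of the $x'$-rays $e_{x'}$, $e\in B$, and $\mathcal S(B):=\bigcup_{k\in\mathbb Z}\{(y)^{+k}: y\in\mathcal S^{x'}(B)\}$ (independent of the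 choice of $x'$). For $x\in\mathcal L$ and $B\in\mathcal B^\infty$, $x_B:=\bigvee\{y\in\mathcal S(B): y\preceq x\}$ (this exists). Matroids may have infinite ground set but finite rank. A valuated matroid on a matroid $(E,\mathcal B)$ of rank $n$ is $\omega:\mathcal B\to\mathbb R$ such that for $B,B'\in\mathcal B$ and $e\in B\setminus B'$ there is $e'\in B'\setminus B$ with $\omega(B)+\omega(B')\le\omega(B+e'-e)+\omega(B'+e-e')$ (these sets being bases). It is simple if the matroid has no loops and no parallel pairs. For $x\in\mathbb R^E$, $(\omega+x)(B):=\omega(B)+\sum_{e\in B}x(e)$, $\mathcal B_{\omega+x}$ is the set of maximizers of $\omega+x$ over $\mathcal B$, and $\mathcal T(\omega):=\{x\in\mathbb R^E:$ the maximum is attained and every $e\in E$ lies in some member of $\mathcal B_{\omega+x}\}$ (tropical linear space). The tight span is $\mathcal{TS}(\omega):=\{p\in\mathbb R^E: p(e)=\max_{B\ni e}(\omega(B)-\sum_{f\in B\setminus\{e\}}p(f))\ \forall e\}$; for $p\in\mathcal{TS}(\omega)$ set $D_p(e,f)=\exp(\max\{\omega(B)-\sum_{g\in B}p(g): \{e,f\}\subseteq B\in\mathcal B\})$ for $e\ne f$ and $D_p(e,e)=0$. A simple valuated matroid is complete if $(E,D_p)$ is a complete metric space (this does not depend on $p$). *)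

theory Defs
  imports "HOL-Analysis.Analysis" "HOL-Library.Lub_Glb"
begin

section \<open>Uniform semimodular lattices\<close>

text \<open>The lattice is the whole type. Chains and maximal chains are those of theory Zorn:
  \<open>pred_on.chain A (<) C\<close> says that \<open>C\<close> is a totally ordered subset of \<open>A\<close>.\<close>

definition join :: "'a::lattice set \<Rightarrow> 'a" where
  "join A = (THE s. isLub UNIV A s)"

definition covers :: "'a::lattice \<Rightarrow> 'a \<Rightarrow> bool" (infix \<open>\<prec>\<^sub>1\<close> 50) where
  "x \<prec>\<^sub>1 y \<longleftrightarrow> x < y \<and> {x..y} = {x, y}"

definition condition_F :: "'a::lattice itself \<Rightarrow> bool" where
  "condition_F TYPE('a) \<longleftrightarrow>
     (\<forall>x y :: 'a. \<forall>C. pred_on.chain {x..y} (<) C \<longrightarrow> finite C)"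

definition semimodular :: "'a::lattice itself \<Rightarrow> bool" where
  "semimodular TYPE('a) \<longleftrightarrow> (\<forall>x a :: 'a. inf x a \<prec>\<^sub>1 a \<longrightarrow> x \<prec>\<^sub>1 sup x a)"

text \<open>The length of a chain with \<open>k + 1\<close> elements is \<open>k\<close>.\<close>

definition interval_rank :: "'a::lattice \<Rightarrow> 'a \<Rightarrow> nat" where
  "interval_rank x y =
     (THE k. \<forall>C. pred_on.maxchain {x..y} (<) C \<longrightarrow> finite C \<and> card C = k + 1)"

text \<open>A height function is unique up to an additive constant, so \<open>rel_height\<close> does not
  depend on the choice.\<close>

definition height :: "'a::lattice \<Rightarrow> int" where
  "height = (SOME r. \<forall>x y. x \<prec>\<^sub>1 y \<longrightarrow> r y = r x + 1)"

definition rel_height :: "'a::lattice \<Rightarrow> 'a \<Rightarrow> int" where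
  "rel_height x y = height y - height x"

definition asc :: "'a::lattice \<Rightarrow> 'a" where
  "asc x = join {y. x \<prec>\<^sub>1 y}"

definition asc_pow :: "int \<Rightarrow> 'a::lattice \<Rightarrow> 'a" where
  "asc_pow k = (if 0 \<le> k then asc ^^ nat k else inv asc ^^ nat (- k))"

definition lattice_automorphism :: "('a::lattice \<Rightarrow> 'a) \<Rightarrow> bool" where
  "lattice_automorphism f \<longleftrightarrow> bij f \<and>
     (\<forall>x y. f (inf x y) = inf (f x) (f y) \<and> f (sup x y) = sup (f x) (f y))"

definition uniform_semimodular_lattice :: "'a::lattice itself \<Rightarrow> bool" where
  "uniform_semimodular_lattice TYPE('a) \<longleftrightarrow>
     condition_F TYPE('a) \<and> semimodular TYPE('a) \<and>
     (\<forall>x :: 'a. \<exists>s. isLub UNIV {y. x \<prec>\<^sub>1 y} s) \<and>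
     lattice_automorphism (asc :: 'a \<Rightarrow> 'a)"

definition has_uniform_rank :: "'a::lattice itself \<Rightarrow> nat \<Rightarrow> bool" where
  "has_uniform_rank TYPE('a) n \<longleftrightarrow> (\<forall>x :: 'a. interval_rank x (asc x) = n)"


section \<open>Rays and ends\<close>

text \<open>A segment is given by the values of \<open>e\<close> on \<open>{0..s}\<close>.\<close>

definition is_segment :: "nat \<Rightarrow> (nat \<Rightarrow> 'a::lattice) \<Rightarrow> bool" where
  "is_segment s e \<longleftrightarrow> (\<forall>l\<in>{1..s}. e (l - 1) \<prec>\<^sub>1 e l) \<and>
     (\<forall>l\<in>{1..<s}. e (l + 1) \<notin> {e (l - 1)..asc (e (l - 1))})"

definition rays :: "(nat \<Rightarrow> 'a::lattice) set" where
  "rays = {e. \<forall>s. is_segment s e}"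

definition ray_join :: "(nat \<Rightarrow> 'a::lattice) \<Rightarrow> 'a \<Rightarrow> nat \<Rightarrow> 'a" where
  "ray_join e y = (let l = (THE l. e l \<le> y \<and> \<not> e (l + 1) \<le> y) in (\<lambda>k. sup (e (l + k)) y))"

definition parallel_rays :: "(nat \<Rightarrow> 'a::lattice) \<Rightarrow> (nat \<Rightarrow> 'a) \<Rightarrow> bool" where
  "parallel_rays e f \<longleftrightarrow> ray_join e (sup (e 0) (f 0)) = ray_join f (sup (e 0) (f 0))"

definition ends :: "(nat \<Rightarrow> 'a::lattice) set set" where
  "ends = rays // {(e, f). e \<in> rays \<and> f \<in> rays \<and> parallel_rays e f}"

definition end_ray :: "(nat \<Rightarrow> 'a::lattice) set \<Rightarrow> 'a \<Rightarrow> nat \<Rightarrow> 'a" where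
  "end_ray e x = (THE f. f \<in> e \<and> f 0 = x)"


section \<open>The matroid at infinity and its valuation\<close>

text \<open>The joins below are taken above \<open>x\<close>: inserting \<open>x\<close> changes nothing for nonempty \<open>I\<close>
  and makes the empty join equal to \<open>x\<close>.\<close>

definition independent_at :: "'a::lattice \<Rightarrow> (nat \<Rightarrow> 'a) set set \<Rightarrow> bool" where
  "independent_at x I \<longleftrightarrow> I \<subseteq> ends \<and> finite I \<and>
     rel_height x (join (insert x ((\<lambda>e. end_ray e x 1) ` I))) = int (card I)"

definition bases_at :: "nat \<Rightarrow> 'a::lattice \<Rightarrow> (nat \<Rightarrow> 'a) set set set" where
  "bases_at n x = {I. independent_at x I \<and> card I = n}"

definition bases_inf :: "nat \<Rightarrow> (nat \<Rightarrow> 'a::lattice) set set set" where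
  "bases_inf n = (\<Union>x. bases_at n x)"

definition is_sublattice :: "'a::lattice set \<Rightarrow> bool" where
  "is_sublattice S \<longleftrightarrow> (\<forall>a\<in>S. \<forall>b\<in>S. inf a b \<in> S \<and> sup a b \<in> S)"

definition span_at :: "'a::lattice \<Rightarrow> (nat \<Rightarrow> 'a) set set \<Rightarrow> 'a set" where
  "span_at x B = is_sublattice hull (\<Union>e\<in>B. range (end_ray e x))"

text \<open>The result does not depend on the base point chosen here.\<close>

definition span_inf :: "nat \<Rightarrow> (nat \<Rightarrow> 'a::lattice) set set \<Rightarrow> 'a set" where
  "span_inf n B = (\<Union>k. asc_pow k ` span_at (SOME x. B \<in> bases_at n x) B)"

definition proj :: "nat \<Rightarrow> 'a::lattice \<Rightarrow> (nat \<Rightarrow> 'a) set set \<Rightarrow> 'a" where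
  "proj n x B = join {y \<in> span_inf n B. y \<le> x}"

definition omega :: "nat \<Rightarrow> 'a::lattice \<Rightarrow> (nat \<Rightarrow> 'a) set set \<Rightarrow> int" where
  "omega n x B = - int (interval_rank (proj n x B) x)"


section \<open>Valuated matroids on possibly infinite ground sets\<close>

text \<open>\<open>\<real>\<^sup>E\<close> is \<open>E \<rightarrow>\<^sub>E UNIV\<close>, the functions that are \<open>undefined\<close> outside \<open>E\<close>. A valuated matroid
  is a function on all sets, of which only the values on bases matter.\<close>

definition matroid_bases :: "'e set \<Rightarrow> 'e set set \<Rightarrow> nat \<Rightarrow> bool" where
  "matroid_bases E \<B> n \<longleftrightarrow> \<B> \<noteq> {} \<and> (\<forall>B\<in>\<B>. B \<subseteq> E \<and> finite B \<and> card B = n) \<and>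
     (\<forall>B\<in>\<B>. \<forall>B'\<in>\<B>. \<forall>e\<in>B - B'. \<exists>e'\<in>B' - B. insert e' (B - {e}) \<in> \<B>)"

definition matroid_indep :: "'e set set \<Rightarrow> 'e set \<Rightarrow> bool" where
  "matroid_indep \<B> I \<longleftrightarrow> (\<exists>B\<in>\<B>. I \<subseteq> B)"

definition valuated_matroid :: "'e set \<Rightarrow> 'e set set \<Rightarrow> nat \<Rightarrow> ('e set \<Rightarrow> real) \<Rightarrow> bool" where
  "valuated_matroid E \<B> n \<omega> \<longleftrightarrow> matroid_bases E \<B> n \<and>
     (\<forall>B\<in>\<B>. \<forall>B'\<in>\<B>. \<forall>e\<in>B - B'. \<exists>e'\<in>B' - B.
        insert e' (B - {e}) \<in> \<B> \<and> insert e (B' - {e'}) \<in> \<B> \<and>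
        \<omega> B + \<omega> B' \<le> \<omega> (insert e' (B - {e})) + \<omega> (insert e (B' - {e'})))"

definition simple_matroid :: "'e set \<Rightarrow> 'e set set \<Rightarrow> bool" where
  "simple_matroid E \<B> \<longleftrightarrow> (\<forall>e\<in>E. matroid_indep \<B> {e}) \<and>
     (\<forall>e\<in>E. \<forall>f\<in>E. e \<noteq> f \<longrightarrow> matroid_indep \<B> {e, f})"

definition perturbed :: "('e set \<Rightarrow> real) \<Rightarrow> ('e \<Rightarrow> real) \<Rightarrow> 'e set \<Rightarrow> real" where
  "perturbed \<omega> x B = \<omega> B + (\<Sum>e\<in>B. x e)"

definition maximizers :: "'e set set \<Rightarrow> ('e set \<Rightarrow> real) \<Rightarrow> 'e set set" where
  "maximizers \<B> \<omega> = {B \<in> \<B>. \<forall>B'\<in>\<B>. \<omega> B' \<le> \<omega> B}"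

definition tropical_linear_space ::
  "'e set \<Rightarrow> 'e set set \<Rightarrow> ('e set \<Rightarrow> real) \<Rightarrow> ('e \<Rightarrow> real) set" where
  "tropical_linear_space E \<B> \<omega> = {x \<in> E \<rightarrow>\<^sub>E UNIV.
     maximizers \<B> (perturbed \<omega> x) \<noteq> {} \<and>
     (\<forall>e\<in>E. \<exists>B\<in>maximizers \<B> (perturbed \<omega> x). e \<in> B)}"

definition is_maximum :: "real set \<Rightarrow> real \<Rightarrow> bool" where
  "is_maximum A m \<longleftrightarrow> m \<in> A \<and> (\<forall>a\<in>A. a \<le> m)"

definition tight_span ::
  "'e set \<Rightarrow> 'e set set \<Rightarrow> ('e set \<Rightarrow> real) \<Rightarrow> ('e \<Rightarrow> real) set" where
  "tight_span E \<B> \<omega> = {p \<in> E \<rightarrow>\<^sub>E UNIV.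
     \<forall>e\<in>E. is_maximum {\<omega> B - (\<Sum>f\<in>B - {e}. p f) |B. B \<in> \<B> \<and> e \<in> B} (p e)}"

definition tight_dist ::
  "'e set set \<Rightarrow> ('e set \<Rightarrow> real) \<Rightarrow> ('e \<Rightarrow> real) \<Rightarrow> 'e \<Rightarrow> 'e \<Rightarrow> real" where
  "tight_dist \<B> \<omega> p e f = (if e = f then 0
     else exp (THE m. is_maximum {\<omega> B - (\<Sum>g\<in>B. p g) |B. B \<in> \<B> \<and> {e, f} \<subseteq> B} m))"

text \<open>Completeness does not depend on \<open>p\<close>; nonemptiness of the tight span is required so that
  the condition is not vacuous.\<close>

definition complete_valuated_matroid ::
  "'e set \<Rightarrow> 'e set set \<Rightarrow> nat \<Rightarrow> ('e set \<Rightarrow> real) \<Rightarrow> bool" where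
  "complete_valuated_matroid E \<B> n \<omega> \<longleftrightarrow>
     valuated_matroid E \<B> n \<omega> \<and> simple_matroid E \<B> \<and>
     tight_span E \<B> \<omega> \<noteq> {} \<and>
     (\<forall>p\<in>tight_span E \<B> \<omega>. Metric_space E (tight_dist \<B> \<omega> p) \<and>
        Metric_space.mcomplete E (tight_dist \<B> \<omega> p))"


section \<open>Geometric realizations in \<open>\<real>\<^sup>E\<close>\<close>

definition chain_complex :: "'a::lattice set set" where
  "chain_complex = {set xs |xs. xs \<noteq> [] \<and> sorted_wrt (<) xs \<and> last xs \<le> asc (hd xs)}"

definition simplex_hull :: "'e set \<Rightarrow> ('v \<Rightarrow> 'e \<Rightarrow> real) \<Rightarrow> 'v set \<Rightarrow> ('e \<Rightarrow> real) set" where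
  "simplex_hull E \<phi> \<sigma> =
     {(\<lambda>e\<in>E. \<Sum>v\<in>\<sigma>. w v * \<phi> v e) |w. (\<forall>v\<in>\<sigma>. 0 \<le> w v) \<and> (\<Sum>v\<in>\<sigma>. w v) = 1}"

definition affinely_independent :: "'e set \<Rightarrow> ('v \<Rightarrow> 'e \<Rightarrow> real) \<Rightarrow> 'v set \<Rightarrow> bool" where
  "affinely_independent E \<phi> \<sigma> \<longleftrightarrow>
     (\<forall>w. (\<Sum>v\<in>\<sigma>. w v) = 0 \<and> (\<forall>e\<in>E. (\<Sum>v\<in>\<sigma>. w v * \<phi> v e) = 0) \<longrightarrow> (\<forall>v\<in>\<sigma>. w v = 0))"

text \<open>\<open>X\<close> is the union of a geometric simplicial complex in \<open>\<real>\<^sup>E\<close> whose vertex scheme is the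
  abstract complex \<open>K\<close> of finite sets. The hull of the empty set is empty, so the condition on
  intersections makes \<open>\<phi>\<close> injective on vertices.\<close>

definition geometric_realization ::
  "'e set \<Rightarrow> 'v set set \<Rightarrow> ('e \<Rightarrow> real) set \<Rightarrow> bool" where
  "geometric_realization E K X \<longleftrightarrow> (\<exists>\<phi>.
     (\<forall>v\<in>\<Union>K. \<phi> v \<in> E \<rightarrow>\<^sub>E UNIV) \<and>
     (\<forall>\<sigma>\<in>K. affinely_independent E \<phi> \<sigma>) \<and>
     (\<forall>\<sigma>\<in>K. \<forall>\<tau>\<in>K. simplex_hull E \<phi> \<sigma> \<inter> simplex_hull E \<phi> \<tau> = simplex_hull E \<phi> (\<sigma> \<inter> \<tau>)) \<and>
     X = (\<Union>\<sigma>\<in>K. simplex_hull E \<phi> \<sigma>))"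

end

theory Submission
  imports Defs
begin

text \<open>For an end \<open>e\<close> let the \<open>e\<close>-coordinate \<open>b\<^sub>e(x, y)\<close> count, relative to a common lower bound of
  \<open>x\<close> and \<open>y\<close>, how many more steps of the ray of \<open>e\<close> lie below \<open>y\<close> than below \<open>x\<close>; it is an additive
  cocycle, so \<open>b\<^sub>e(x, \<cdot>)\<close> behaves like a Busemann function. The points at which a set \<open>B\<close> of ends is a
  basis form an apartment, on which the coordinates in \<open>B\<close> are an isomorphism to \<open>\<int>\<^sup>n\<close>; it equals
  \<open>\<S>(B)\<close>, and \<open>x\<^sub>B\<close> is its point with the same \<open>B\<close>-coordinates as \<open>x\<close>. Hence \<open>\<omega>\<close> at \<open>y\<close> and \<open>\<omega>\<close> at
  \<open>x\<close> differ by \<open>\<Sum>\<^sub>e\<^sub>\<in>\<^sub>B b\<^sub>e(x, y)\<close> and a constant, and \<open>\<omega>\<close> at \<open>y\<close> is maximal exactly on the bases at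
  \<open>y\<close>. Thus \<open>y \<mapsto> b(x, y)\<close> maps the lattice into the tropical linear space. A point of
  the latter is determined by its values on one optimal basis, which makes this map onto the
  integer points, and makes \<open>\<lfloor>q + t\<rfloor>\<close> a lattice point for every point \<open>q\<close> and real \<open>t\<close>. For completeness, the
  tight span contains \<open>0\<close>, and small distance there means that two rays share a long initial piece.\<close>

section \<open>Semimodular lattices with condition (F)\<close>

text \<open>The obstacle is infinity: a point may have infinitely many covers, there may be
  infinitely many ends, and arbitrary joins need not exist. The argument therefore forms explicit
  joins of atoms only over finite sets of ends, and a maximum over bases is shown to be attained in
  one of two ways. Either the values are bounded by 0 and a basis at the point in question has value
  0, or an optimal basis is fixed and the exchange property bounds every competitor by one of its
  finitely many one-element swaps. Equalities between lattice points are mostly obtained by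
  counting: minimality of a join gives an inequality, and equal heights turn it into an equality.
  Negative directions are handled by the inverse of \<open>asc\<close>. It moves any point below any
  other, carries rays to rays and does not change which sets are bases at the point, so comparisons
  can be made above a common lower bound and transported by the cocycle law.\<close>

lemma covers_iff: "x \<prec>\<^sub>1 y \<longleftrightarrow> x < y \<and> (\<forall>z. x \<le> z \<longrightarrow> z \<le> y \<longrightarrow> z = x \<or> z = y)"
  unfolding covers_def set_eq_iff atLeastAtMost_iff insert_iff empty_iff
  by (meson less_imp_le order.refl)

lemma covers_less: "x \<prec>\<^sub>1 y \<Longrightarrow> x < y"
  by (simp add: covers_iff)

lemma covers_le: "x \<prec>\<^sub>1 y \<Longrightarrow> x \<le> y"
  by (simp add: covers_iff less_imp_le)

lemma covers_between: "x \<prec>\<^sub>1 y \<Longrightarrow> x \<le> z \<Longrightarrow> z \<le> y \<Longrightarrow> z = x \<or> z = y"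
  by (simp add: covers_iff)

lemma covers_eq: "x \<prec>\<^sub>1 y \<Longrightarrow> x \<prec>\<^sub>1 z \<Longrightarrow> y \<le> z \<Longrightarrow> y = z"
  by (metis covers_iff less_imp_le order.irrefl)

lemma isLub_UNIV_iff: "isLub UNIV A s \<longleftrightarrow> (\<forall>a\<in>A. a \<le> s) \<and> (\<forall>u. (\<forall>a\<in>A. a \<le> u) \<longrightarrow> s \<le> u)"
  by (auto simp: isLub_def leastP_def isUb_def setle_def setge_def)

lemma join_eqI:
  fixes s :: "'a::lattice"
  assumes "isLub UNIV A s"
  shows "join A = s"
  unfolding join_def using assms by (intro the_equality) (auto simp: isLub_UNIV_iff intro: order.antisym)

locale semimodular_lattice =
  fixes ty :: "'a::lattice itself"
  assumes condition_F: "condition_F TYPE('a)" and semimodular: "semimodular TYPE('a)"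
begin

section \<open>Condition (F) as well-foundedness, and induction along covers\<close>

lemma no_infinite_chain:
  fixes f :: "nat \<Rightarrow> 'a"
  assumes "inj f" "\<And>i. x \<le> f i" "\<And>i. f i \<le> y" "\<And>i j. f i \<le> f j \<or> f j \<le> f i"
  shows False
proof -
  have "pred_on.chain {x..y} (<) (range f)"
    using assms by (auto simp: pred_on.chain_def order.order_iff_strict)
  then show False
    using condition_F range_inj_infinite[OF assms(1)] by (auto simp: condition_F_def)
qed

text \<open>A strictly decreasing sequence in an interval would be an infinite chain. This
  descending form of condition (F) supplies minimal elements, which are covers; the ascending form
  supplies the maximal elements at which \<open>cover_induct\<close> stops.\<close>

lemma wf_interval_less: "wf {(a, b). x \<le> a \<and> b \<le> y \<and> a < (b::'a)}"
  unfolding wf_iff_no_infinite_down_chain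
proof
  assume "\<exists>f. \<forall>i. (f (Suc i), f i) \<in> {(a, b). x \<le> a \<and> b \<le> y \<and> a < (b::'a)}"
  then obtain f where f: "\<forall>i. (f (Suc i), f i) \<in> {(a, b). x \<le> a \<and> b \<le> y \<and> a < (b::'a)}" by blast
  have lt: "f j < f i" if "i < j" for i j
    using that
  proof (induction j)
    case (Suc j)
    have "f (Suc j) < f j" using f by simp
    with Suc show ?case by (cases "i = j") (auto intro: order.strict_trans)
  qed simp
  show False
  proof (rule no_infinite_chain[of f x y])
    show "inj f"
    proof (rule injI)
      fix i j assume "f i = f j"
      then show "i = j" using lt[of i j] lt[of j i] by (cases i j rule: linorder_cases) auto
    qed
    show "f i \<le> y" for i using f by simp
    have "x \<le> f (Suc i)" "f (Suc i) < f i" for i using f by simp_all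
    then show "x \<le> f i" for i by (meson less_imp_le order.trans)
    show "f i \<le> f j \<or> f j \<le> f i" for i j
      using lt[of i j] lt[of j i] by (cases i j rule: linorder_cases) (auto simp: less_imp_le)
  qed
qed

lemma wf_interval_greater: "wf {(b, a). x \<le> a \<and> b \<le> y \<and> a < (b::'a)}"
  unfolding wf_iff_no_infinite_down_chain
proof
  assume "\<exists>f. \<forall>i. (f (Suc i), f i) \<in> {(b, a). x \<le> a \<and> b \<le> y \<and> a < (b::'a)}"
  then obtain f where f: "\<forall>i. (f (Suc i), f i) \<in> {(b, a). x \<le> a \<and> b \<le> y \<and> a < (b::'a)}" by blast
  have lt: "f i < f j" if "i < j" for i j
    using that
  proof (induction j)
    case (Suc j)
    have "f j < f (Suc j)" using f by simp
    with Suc show ?case by (cases "i = j") (auto intro: order.strict_trans)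
  qed simp
  show False
  proof (rule no_infinite_chain[of f x y])
    show "inj f"
    proof (rule injI)
      fix i j assume "f i = f j"
      then show "i = j" using lt[of i j] lt[of j i] by (cases i j rule: linorder_cases) auto
    qed
    show "x \<le> f i" for i using f by simp
    have "f (Suc i) \<le> y" "f i < f (Suc i)" for i using f by simp_all
    then show "f i \<le> y" for i by (meson less_imp_le order.trans)
    show "f i \<le> f j \<or> f j \<le> f i" for i j
      using lt[of i j] lt[of j i] by (cases i j rule: linorder_cases) (auto simp: less_imp_le)
  qed
qed

lemma exists_cover_below:
  assumes "x < (y::'a)"
  obtains z where "x \<prec>\<^sub>1 z" "z \<le> y"
proof -
  have "y \<in> {z. x < z \<and> z \<le> y}" using assms by simp
  then obtain z where z: "z \<in> {z. x < z \<and> z \<le> y}"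
    and min: "\<And>w. (w, z) \<in> {(a, b). x \<le> a \<and> b \<le> y \<and> a < b} \<Longrightarrow> w \<notin> {z. x < z \<and> z \<le> y}"
    by (rule wfE_min[OF wf_interval_less[of x y]]) (rule that)
  have "w = x \<or> w = z" if "x \<le> w" "w \<le> z" for w
  proof (rule ccontr)
    assume "\<not> (w = x \<or> w = z)"
    with that have "x < w" "w < z" by (auto simp: order.strict_iff_order)
    have "z \<le> y" using z by simp
    with \<open>w \<le> z\<close> have "w \<le> y" by (rule order.trans)
    with min[of w] \<open>x < w\<close> \<open>w < z\<close> that z show False by simp
  qed
  with z have "x \<prec>\<^sub>1 z" by (simp add: covers_iff)
  with z show thesis using that by simp
qed

lemma cover_induct [consumes 1, case_names base step]:
  assumes "x \<le> (y::'a)" "P x"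
    and "\<And>u v. x \<le> u \<Longrightarrow> u \<prec>\<^sub>1 v \<Longrightarrow> v \<le> y \<Longrightarrow> P u \<Longrightarrow> P v"
  shows "P y"
proof -
  let ?Q = "{z. x \<le> z \<and> z \<le> y \<and> P z}"
  have "x \<in> ?Q" using assms by simp
  then obtain z where Q: "z \<in> ?Q"
    and max: "\<And>w. (w, z) \<in> {(b, a). x \<le> a \<and> b \<le> y \<and> a < b} \<Longrightarrow> w \<notin> ?Q"
    by (rule wfE_min[OF wf_interval_greater[of x y]]) (rule that)
  then have z: "x \<le> z" "z \<le> y" "P z" by simp_all
  show "P y"
  proof (cases "z = y")
    case False
    with z have "z < y" by simp
    then obtain w where w: "z \<prec>\<^sub>1 w" "w \<le> y" by (rule exists_cover_below)
    have "P w" using assms(3)[OF z(1) w z(3)] .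
    moreover have "z < w" using covers_less[OF w(1)] .
    moreover have "x \<le> w" using z(1) covers_le[OF w(1)] by (rule order.trans)
    ultimately show ?thesis using max[of w] w z by simp
  qed (use z in simp)
qed

text \<open>If \<open>y\<close> is not below \<open>sup x z\<close>, then \<open>sup x z\<close>
  meets \<open>y\<close> in \<open>x\<close>, and semimodularity applies. Joining with a fixed
  element thus either keeps a cover or collapses it; semimodularity enters the development only
  through this dichotomy.\<close>

lemma covers_sup:
  assumes "x \<prec>\<^sub>1 (y::'a)"
  shows "sup x z = sup y z \<or> sup x z \<prec>\<^sub>1 sup y z"
proof (cases "y \<le> sup x z")
  case True
  then show ?thesis
    using covers_le[OF assms] by (intro disjI1 order.antisym) (auto intro: le_supI1)
next
  case False
  have "inf (sup x z) y = x"
    using covers_between[OF assms, of "inf (sup x z) y"] covers_le[OF assms] False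
    by (metis inf.cobounded1 inf.cobounded2 inf.boundedI sup.cobounded1)
  with assms have "sup x z \<prec>\<^sub>1 sup (sup x z) y"
    using semimodular by (simp add: semimodular_def)
  moreover have "sup (sup x z) y = sup y z"
    using covers_le[OF assms] by (metis sup.absorb2 sup.commute sup.left_commute)
  ultimately show ?thesis by simp
qed

lemma covers_sup_iff: "x \<prec>\<^sub>1 (y::'a) \<Longrightarrow> x \<le> z \<Longrightarrow> \<not> y \<le> z \<Longrightarrow> z \<prec>\<^sub>1 sup y z"
  using covers_sup[of x y z] by (metis sup.absorb2 sup.cobounded1)

section \<open>The Jordan-Dedekind property and the height function\<close>

lemma relpowp_covers_le: "(covers ^^ k) x (y::'a) \<Longrightarrow> x \<le> y"
proof (induction k arbitrary: y)
  case (Suc k)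
  from Suc.prems obtain z where "(covers ^^ k) x z" "z \<prec>\<^sub>1 y" by (rule relpowp_Suc_E)
  then show ?case by (intro order.trans[OF Suc.IH covers_le])
qed simp

text \<open>Diamond argument: distinct covers \<open>z\<close> and \<open>u\<close> of
  \<open>x\<close> are both covered by \<open>sup z u\<close>, so a saturated chain that starts with
  \<open>u\<close> can be rerouted through \<open>sup z u\<close> to start with \<open>z\<close>,
  without change of length.\<close>

lemma relpowp_covers_step:
  assumes "(covers ^^ Suc k) x (y::'a)" "x \<prec>\<^sub>1 z" "z \<le> y"
  shows "(covers ^^ k) z y"
  using assms
proof (induction k arbitrary: x z)
  case 0
  then show ?case using covers_eq by auto
next
  case (Suc k)
  from Suc.prems(1) obtain u where u: "x \<prec>\<^sub>1 u" "(covers ^^ Suc k) u y"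
    by (rule relpowp_Suc_E2)
  show ?case
  proof (cases "z = u")
    case False
    have "\<not> z \<le> u" using covers_eq[of x z u] False Suc.prems(2) u(1) by blast
    then have 1: "u \<prec>\<^sub>1 sup z u"
      using covers_sup_iff[OF Suc.prems(2) covers_le[OF u(1)]] by blast
    have "\<not> u \<le> z" using covers_eq[of x u z] False Suc.prems(2) u(1) by blast
    then have 2: "z \<prec>\<^sub>1 sup z u"
      using covers_sup_iff[OF u(1) covers_le[OF Suc.prems(2)]] by (simp add: sup.commute)
    have "(covers ^^ k) (sup z u) y"
      using Suc.IH[OF u(2) 1] Suc.prems(3) relpowp_covers_le[OF u(2)] by simp
    with 2 show ?thesis by (rule relpowp_Suc_I2)
  qed (use u in simp)
qed

lemma relpowp_covers_unique:
  "(covers ^^ k) x (y::'a) \<Longrightarrow> (covers ^^ l) x y \<Longrightarrow> k = l"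
proof (induction k arbitrary: x l)
  case 0
  show ?case
  proof (cases l)
    case (Suc m)
    have "x = y" "(covers ^^ Suc m) x y" using 0 Suc by simp_all
    then obtain z where "x \<prec>\<^sub>1 z" "(covers ^^ m) z x" by (metis relpowp_Suc_E2)
    from order.strict_trans2[OF covers_less[OF this(1)] relpowp_covers_le[OF this(2)]]
    show ?thesis by simp
  qed simp
next
  case (Suc k)
  from Suc.prems(1) obtain z where z: "x \<prec>\<^sub>1 z" "(covers ^^ k) z y" by (rule relpowp_Suc_E2)
  have "x < y" using covers_less[OF z(1)] relpowp_covers_le[OF z(2)] by (rule order.strict_trans2)
  with Suc.prems(2) obtain l' where l: "l = Suc l'" by (cases l) auto
  have "(covers ^^ l') z y"
    using relpowp_covers_step[of l' x y z] Suc.prems(2) z(1) relpowp_covers_le[OF z(2)] l by simp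
  with Suc.IH[OF z(2)] l show ?case by simp
qed

lemma exists_relpowp_covers: "x \<le> (y::'a) \<Longrightarrow> \<exists>k. (covers ^^ k) x y"
proof (induction rule: cover_induct)
  case base
  show ?case by (rule exI[of _ 0]) simp
next
  case (step u v)
  from step(4) obtain k where "(covers ^^ k) x u" ..
  from relpowp_Suc_I[OF this step(2)] show ?case by blast
qed

lemma exists_height: "\<exists>r :: 'a \<Rightarrow> int. \<forall>x y. x \<prec>\<^sub>1 y \<longrightarrow> r y = r x + 1"
proof -
  fix c :: 'a
  define len where "len x y = (THE k. (covers ^^ k) x y)" for x y :: 'a
  have len: "len x y = k" if "(covers ^^ k) x y" for x y k
    unfolding len_def using that by (rule the_equality) (rule relpowp_covers_unique[OF _ that])
  have add: "len x z = len x y + len y z" if xyz: "x \<le> y" "y \<le> z" for x y z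
  proof -
    obtain k l where "(covers ^^ k) x y" "(covers ^^ l) y z"
      using exists_relpowp_covers xyz by meson
    then show ?thesis using len relpowp_trans by metis
  qed
  \<comment> \<open>Points need not be comparable with the origin \<open>c\<close>, so both are
    compared with a common upper bound. By additivity every larger upper bound gives the same
    difference.\<close>
  define r where "r y = int (len c (sup c y)) - int (len y (sup c y))" for y
  have r: "r y = int (len c w) - int (len y w)" if "c \<le> w" "y \<le> w" for y w
    using add[of c "sup c y" w] add[of y "sup c y" w] that by (simp add: r_def)
  have "r y = r x + 1" if "x \<prec>\<^sub>1 y" for x y
  proof -
    have "len x y = 1" using that len[of 1 x y] unfolding relpowp_1 by blast
    then show ?thesis
      using r[of "sup c y" x] r[of "sup c y" y] covers_le[OF that] add[of x y "sup c y"]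
      by (simp add: le_supI2)
  qed
  then show ?thesis by blast
qed

lemma height_covers: "x \<prec>\<^sub>1 y \<Longrightarrow> height y = height (x::'a) + 1"
  unfolding height_def using someI_ex[OF exists_height] by blast

lemma height_mono: "x \<le> y \<Longrightarrow> height (x::'a) \<le> height y"
proof (induction rule: cover_induct)
  case (step u v)
  then show ?case using height_covers[of u v] by simp
qed simp

lemma height_strict_mono:
  assumes "x < y"
  shows "height (x::'a) < height y"
proof -
  obtain z where "x \<prec>\<^sub>1 z" "z \<le> y" using exists_cover_below[OF assms] .
  then show ?thesis using height_covers[of x z] height_mono[of z y] by simp
qed

lemma height_eq_imp_eq: "x \<le> y \<Longrightarrow> height y \<le> height (x::'a) \<Longrightarrow> x = y"
  using height_strict_mono[of x y] by (auto simp: order.order_iff_strict)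

lemma covers_iff_height: "x \<prec>\<^sub>1 y \<longleftrightarrow> x \<le> y \<and> height y = height (x::'a) + 1"
proof
  assume a: "x \<le> y \<and> height y = height x + 1"
  then have "x \<noteq> y" by auto
  with a obtain z where z: "x \<prec>\<^sub>1 z" "z \<le> y"
    using exists_cover_below[of x y] by (metis order.order_iff_strict)
  then have "z = y" using height_eq_imp_eq[of z y] height_covers[of x z] a by simp
  with z show "x \<prec>\<^sub>1 y" by simp
qed (simp add: height_covers covers_le)

text \<open>Each cover on the way from \<open>x\<close> to \<open>y\<close> raises the height by
  one, and its join with \<open>z\<close> by at most one. So what \<open>z\<close> adds to the
  height cannot grow; applied to \<open>inf x y\<close> and \<open>x\<close> this is
  submodularity.\<close>

lemma height_sup_le: "x \<le> y \<Longrightarrow> height (sup y z) - height (y::'a) \<le> height (sup x z) - height x"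
proof (induction rule: cover_induct)
  case (step u v)
  then show ?case
    using covers_sup[of u v z] height_covers[of u v] height_covers[of "sup u z" "sup v z"]
    by auto
qed simp

lemma height_submodular: "height (sup x y) + height (inf x y) \<le> height x + height (y::'a)"
proof -
  have "sup (inf x y) y = y" by (simp add: sup.absorb2)
  then show ?thesis using height_sup_le[of "inf x y" x y] by simp
qed

text \<open>The height maps a maximal chain bijectively onto all integers between the heights of the
  end points. If a value \<open>j\<close> were skipped between neighbours \<open>a\<close> and
  \<open>b\<close> of the chain, a cover of \<open>a\<close> below \<open>b\<close> would be
  comparable with the whole chain, and maximality would put it there.\<close>

lemma card_maxchain:
  assumes xy: "x \<le> (y::'a)" and C: "pred_on.maxchain {x..y} (<) C"
  shows "finite C \<and> int (card C) = height y - height x + 1"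
proof -
  have ch: "pred_on.chain {x..y} (<) C" using C by (simp add: pred_on.maxchain_def)
  then have fin: "finite C" using condition_F by (auto simp: condition_F_def)
  have sub: "C \<subseteq> {x..y}" and tot: "\<And>a b. a \<in> C \<Longrightarrow> b \<in> C \<Longrightarrow> a \<le> b \<or> b \<le> a"
    using ch by (auto simp: pred_on.chain_def order.order_iff_strict)
  have maxm: "z \<in> C" if "x \<le> z" "z \<le> y" "\<And>c. c \<in> C \<Longrightarrow> c \<le> z \<or> z \<le> c" for z
  proof (rule ccontr)
    assume "z \<notin> C"
    have "pred_on.chain {x..y} (<) (insert z C)"
      using that ch by (auto simp: pred_on.chain_def order.order_iff_strict)
    then show False
      using C \<open>z \<notin> C\<close> by (auto simp: pred_on.maxchain_def)
  qed
  have "x \<in> C" by (rule maxm) (use xy sub in auto)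
  have "y \<in> C" by (rule maxm) (use xy sub in auto)
  have inj: "inj_on height C"
    using tot height_eq_imp_eq by (metis inj_onI order.refl)
  have "height ` C = {height x..height y}"
  proof
    show "height ` C \<subseteq> {height x..height y}" using sub height_mono by auto
    show "{height x..height y} \<subseteq> height ` C"
    proof
      fix j assume j: "j \<in> {height x..height y}"
      let ?L = "{c\<in>C. height c \<le> j}" and ?U = "{c\<in>C. j < height c}"
      have "?L \<noteq> {}" "finite ?L" using \<open>x \<in> C\<close> j fin by auto
      then have "Max (height ` ?L) \<in> height ` ?L" by (intro Max_in) simp_all
      then obtain a where "a \<in> ?L" "height a = Max (height ` ?L)" by auto
      then have a: "a \<in> ?L" "\<And>c. c \<in> ?L \<Longrightarrow> height c \<le> height a"
        using \<open>finite ?L\<close> by simp_all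
      show "j \<in> height ` C"
      proof (cases "height a = j")
        case False
        then have aj: "height a < j" using a by auto
        have "height y \<noteq> j"
          using a(2)[of y] \<open>y \<in> C\<close> aj by auto
        then have "?U \<noteq> {}" "finite ?U" using \<open>y \<in> C\<close> j fin by auto
        then have "Min (height ` ?U) \<in> height ` ?U" by (intro Min_in) simp_all
        then obtain b where "b \<in> ?U" "height b = Min (height ` ?U)" by auto
        then have b: "b \<in> ?U" "\<And>c. c \<in> ?U \<Longrightarrow> height b \<le> height c"
          using \<open>finite ?U\<close> by simp_all
        have "a < b" using tot[of a b] a b height_mono[of b a] by (auto simp: order.order_iff_strict)
        then obtain z where z: "a \<prec>\<^sub>1 z" "z \<le> b" using exists_cover_below by blast
        have hz: "height z = height a + 1" using height_covers z by simp
        have "z \<in> C"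
        proof (rule maxm)
          have "x \<le> a" "b \<le> y" using a b sub by auto
          then show "x \<le> z" "z \<le> y"
            using order.trans[of x a z] order.trans[of z b y] covers_le[OF z(1)] z(2) by auto
          fix c assume "c \<in> C"
          show "c \<le> z \<or> z \<le> c"
          proof (cases "height c \<le> j")
            case True
            then have "height c \<le> height a" using \<open>c \<in> C\<close> a by auto
            then have "c \<le> a" using tot[of c a] \<open>c \<in> C\<close> a height_eq_imp_eq[of a c] by auto
            then show ?thesis using order.trans[of c a z] covers_le[OF z(1)] by simp
          next
            case False
            then have "height b \<le> height c" using \<open>c \<in> C\<close> b by auto
            then have "b \<le> c" using tot[of c b] \<open>c \<in> C\<close> b height_eq_imp_eq[of c b] by auto
            then show ?thesis using order.trans[of z b c] z(2) by simp
          qed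
        qed
        then have "height z \<le> height a" using a(2)[of z] hz aj by auto
        with hz show ?thesis by simp
      qed (use a in auto)
    qed
  qed
  then have "card C = card {height x..height y}" using card_image[OF inj] by simp
  with fin height_mono[OF xy] show ?thesis by simp
qed

lemma interval_rank: "x \<le> (y::'a) \<Longrightarrow> int (interval_rank x y) = height y - height x"
proof -
  assume xy: "x \<le> y"
  obtain C where C: "pred_on.maxchain {x..y} (<) C" using pred_on.Hausdorff by blast
  have "interval_rank x y = nat (height y - height x)"
    unfolding interval_rank_def
  proof (rule the_equality)
    show "\<forall>C. pred_on.maxchain {x..y} (<) C \<longrightarrow> finite C \<and> card C = nat (height y - height x) + 1"
    proof (intro allI impI)
      fix C assume "pred_on.maxchain {x..y} (<) C"
      from card_maxchain[OF xy this] have "finite C" "int (card C) = height y - height x + 1" by simp_all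
      moreover from this(2) have "card C = nat (height y - height x) + 1"
        using height_mono[OF xy] by linarith
      ultimately show "finite C \<and> card C = nat (height y - height x) + 1" by simp
    qed
    show "k = nat (height y - height x)"
      if "\<forall>C. pred_on.maxchain {x..y} (<) C \<longrightarrow> finite C \<and> card C = k + 1" for k
    proof -
      have "card C = k + 1" using that C by blast
      then show ?thesis using card_maxchain[OF xy C] by linarith
    qed
  qed
  then show ?thesis using height_mono[OF xy] by simp
qed

end

section \<open>Rays and ends\<close>

locale uniform_lattice =
  fixes ty :: "'a::lattice itself" and n :: nat
  assumes uniform: "uniform_semimodular_lattice TYPE('a)" and rank: "has_uniform_rank TYPE('a) n"

sublocale uniform_lattice \<subseteq> semimodular_lattice ty
  using uniform by unfold_locales (simp_all add: uniform_semimodular_lattice_def)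

definition ray_index :: "(nat \<Rightarrow> 'a::lattice) \<Rightarrow> 'a \<Rightarrow> nat" where
  "ray_index e y = (THE l. e l \<le> y \<and> \<not> e (l + 1) \<le> y)"

lemma ray_join_eq: "ray_join e y = (\<lambda>k. sup (e (ray_index e y + k)) y)"
  by (simp add: ray_join_def ray_index_def Let_def)

context uniform_lattice
begin

abbreviation dsc :: "'a \<Rightarrow> 'a" where "dsc \<equiv> inv asc"

section \<open>The ascending automorphism and its powers\<close>

lemma isLub_asc: "isLub UNIV {y. x \<prec>\<^sub>1 y} (asc (x::'a))"
proof -
  obtain s where "isLub UNIV {y. x \<prec>\<^sub>1 y} s"
    using uniform by (auto simp: uniform_semimodular_lattice_def)
  then show ?thesis using join_eqI by (metis asc_def)
qed

lemma covers_le_asc: "x \<prec>\<^sub>1 (y::'a) \<Longrightarrow> y \<le> asc x"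
  using isLub_asc[of x] by (simp add: isLub_UNIV_iff)

lemma asc_least: "(\<And>y. x \<prec>\<^sub>1 y \<Longrightarrow> y \<le> u) \<Longrightarrow> asc (x::'a) \<le> u"
  using isLub_asc[of x] by (simp add: isLub_UNIV_iff)

lemma asc_automorphism: "lattice_automorphism (asc :: 'a \<Rightarrow> 'a)"
  using uniform by (simp add: uniform_semimodular_lattice_def)

lemma bij_asc: "bij (asc :: 'a \<Rightarrow> 'a)"
  using asc_automorphism by (simp add: lattice_automorphism_def)

lemma asc_eq_iff [simp]: "asc (x::'a) = asc y \<longleftrightarrow> x = y"
  using bij_asc by (simp add: bij_is_inj inj_eq)

lemma asc_sup: "asc (sup x y) = sup (asc x) (asc (y::'a))"
  using asc_automorphism by (simp add: lattice_automorphism_def)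

lemma asc_le_iff [simp]: "asc (x::'a) \<le> asc y \<longleftrightarrow> x \<le> y"
  by (metis asc_eq_iff asc_sup le_iff_sup)

lemma asc_dsc [simp]: "asc (dsc x) = x"
  by (simp add: bij_asc bij_is_surj surj_f_inv_f)

lemma dsc_asc [simp]: "dsc (asc x) = x"
  by (simp add: bij_asc bij_is_inj)

lemma dsc_le_iff: "dsc x \<le> y \<longleftrightarrow> x \<le> asc y"
  by (metis asc_dsc asc_le_iff)

lemma le_asc: "x \<le> asc (x::'a)"
proof (cases "\<exists>y. x \<prec>\<^sub>1 y")
  case True
  then show ?thesis using covers_le_asc covers_le order.trans by blast
next
  case False
  \<comment> \<open>Without covers, \<open>x\<close> is the greatest element, while
    \<open>asc x\<close>, a join of the empty set, is the least. Monotonicity makes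
    \<open>asc x\<close> a fixed point of \<open>asc\<close>, and injectivity gives
    \<open>asc x = x\<close>.\<close>
  have top: "u \<le> x" for u
  proof (rule ccontr)
    assume "\<not> u \<le> x"
    then have "x < sup x u" by (metis le_iff_sup sup.cobounded1 sup.commute order.strict_iff_order)
    then show False using exists_cover_below False by blast
  qed
  have bot: "asc x \<le> u" for u using False by (intro asc_least) auto
  have "asc (asc x) \<le> asc x" using top by simp
  then have "asc (asc x) = asc x" using bot by (intro order.antisym)
  then show ?thesis by simp
qed

lemma height_asc: "height (asc x) = height (x::'a) + int n"
  using interval_rank[OF le_asc, of x] rank by (simp add: has_uniform_rank_def)

lemma le_funpow_asc: "x \<le> (asc ^^ m) (x::'a)"
  by (induction m) (auto intro: order.trans[OF _ le_asc])

lemma funpow_asc_le_iff [simp]: "(asc ^^ m) (x::'a) \<le> (asc ^^ m) y \<longleftrightarrow> x \<le> y"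
  by (induction m) auto

lemma funpow_asc_eq_iff [simp]: "(asc ^^ m) (x::'a) = (asc ^^ m) y \<longleftrightarrow> x = y"
  by (induction m) auto

lemma height_funpow_asc: "height ((asc ^^ m) x) = height (x::'a) + int n * int m"
  by (induction m) (auto simp: height_asc algebra_simps)

lemma funpow_dsc_le_iff: "(dsc ^^ m) x \<le> y \<longleftrightarrow> x \<le> (asc ^^ m) y"
  by (induction m arbitrary: x y) (simp_all add: dsc_le_iff funpow_swap1)

lemma funpow_asc_dsc [simp]: "(asc ^^ m) ((dsc ^^ m) x) = x"
  by (induction m arbitrary: x) (simp_all add: funpow_swap1[of asc])

lemma funpow_dsc_asc [simp]: "(dsc ^^ m) ((asc ^^ m) x) = x"
  by (induction m arbitrary: x) (simp_all add: funpow_swap1[of dsc])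

lemma exists_funpow_asc_ge: "x \<le> y \<Longrightarrow> \<exists>m. y \<le> (asc ^^ m) (x::'a)"
proof (induction rule: cover_induct)
  case base
  show ?case by (rule exI[of _ 0]) simp
next
  case (step u v)
  from step(4) obtain m where m: "u \<le> (asc ^^ m) x" ..
  have "v \<le> asc u" using covers_le_asc[OF step(2)] .
  also have "\<dots> \<le> (asc ^^ Suc m) x" using m by simp
  finally show ?case by blast
qed

text \<open>This replaces a least element: some power of the inverse of \<open>asc\<close> brings
  any base point below any prescribed point.\<close>

lemma exists_funpow_dsc_le: "\<exists>m. (dsc ^^ m) x \<le> y"
proof -
  obtain m where "sup x y \<le> (asc ^^ m) y" using exists_funpow_asc_ge[of y "sup x y"] by auto
  then show ?thesis by (auto simp: funpow_dsc_le_iff)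
qed

section \<open>Rays and their joins with points\<close>

lemma rays_iff:
  "e \<in> rays \<longleftrightarrow> (\<forall>l. e l \<prec>\<^sub>1 e (Suc l)) \<and> (\<forall>l. \<not> e (Suc (Suc l)) \<le> asc (e l :: 'a))"
proof
  assume e: "e \<in> rays"
  have 1: "e l \<prec>\<^sub>1 e (Suc l)" for l
  proof -
    have "is_segment (Suc l) e" using e by (simp add: rays_def)
    then have "\<forall>k\<in>{1..Suc l}. e (k - 1) \<prec>\<^sub>1 e k" by (simp add: is_segment_def)
    from bspec[OF this, of "Suc l"] show ?thesis by simp
  qed
  have "\<not> e (Suc (Suc l)) \<le> asc (e l)" for l
  proof -
    have "is_segment (Suc (Suc l)) e" using e by (simp add: rays_def)
    then have "\<forall>k\<in>{1..<Suc (Suc l)}. e (k + 1) \<notin> {e (k - 1)..asc (e (k - 1))}"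
      by (simp add: is_segment_def)
    from bspec[OF this, of "Suc l"] have "e (Suc (Suc l)) \<notin> {e l..asc (e l)}" by simp
    moreover have "e l \<le> e (Suc (Suc l))"
      using order.trans[OF covers_le[OF 1[of l]] covers_le[OF 1[of "Suc l"]]] .
    ultimately show ?thesis by simp
  qed
  with 1 show "(\<forall>l. e l \<prec>\<^sub>1 e (Suc l)) \<and> (\<forall>l. \<not> e (Suc (Suc l)) \<le> asc (e l))" by blast
next
  assume e: "(\<forall>l. e l \<prec>\<^sub>1 e (Suc l)) \<and> (\<forall>l. \<not> e (Suc (Suc l)) \<le> asc (e l))"
  have "e (l - 1) \<prec>\<^sub>1 e l" if "1 \<le> l" for l using e that by (cases l) auto
  moreover have "e (l + 1) \<notin> {e (l - 1)..asc (e (l - 1))}" if "1 \<le> l" for l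
    using e that by (cases l) auto
  ultimately show "e \<in> rays" by (simp add: rays_def is_segment_def)
qed

lemma ray_covers: "e \<in> rays \<Longrightarrow> e l \<prec>\<^sub>1 (e (Suc l) :: 'a)"
  by (simp add: rays_iff)

lemma ray_not_le_asc: "e \<in> rays \<Longrightarrow> \<not> e (Suc (Suc l)) \<le> asc (e l :: 'a)"
  by (simp add: rays_iff)

lemma ray_height: "e \<in> rays \<Longrightarrow> height (e k :: 'a) = height (e 0) + int k"
  by (induction k) (simp_all add: height_covers[OF ray_covers])

lemma ray_mono:
  assumes "e \<in> rays" "k \<le> l"
  shows "e k \<le> (e l :: 'a)"
  by (rule lift_Suc_mono_le[of e, OF covers_le[OF ray_covers[OF assms(1)]] assms(2)])

lemma ray_le_iff: "e \<in> rays \<Longrightarrow> e k \<le> (e l :: 'a) \<longleftrightarrow> k \<le> l"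
  using ray_mono[of e k l] height_mono[of "e k" "e l"] ray_height[of e k] ray_height[of e l] by auto

lemma ray_tail: "e \<in> rays \<Longrightarrow> (\<lambda>k. e (l + k) :: 'a) \<in> rays"
  by (simp add: rays_iff)

lemma ray_index_unique:
  assumes "e \<in> rays" "e l \<le> y" "\<not> e (Suc l) \<le> (y::'a)"
  shows "ray_index e y = l"
  unfolding ray_index_def
proof (rule the_equality)
  show "e l \<le> y \<and> \<not> e (l + 1) \<le> y" using assms by simp
  show "k = l" if k: "e k \<le> y \<and> \<not> e (k + 1) \<le> y" for k
  proof (rule ccontr)
    assume "k \<noteq> l"
    then consider "Suc k \<le> l" | "Suc l \<le> k" by linarith
    then show False
    proof cases
      case 1
      from order.trans[OF ray_mono[OF assms(1) 1] assms(2)] k show False by simp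
    next
      case 2
      from order.trans[OF ray_mono[OF assms(1) 2]] k assms(3) show False by blast
    qed
  qed
qed

lemma le_ray_index_iff:
  assumes "e \<in> rays" "e 0 \<le> (y::'a)"
  shows "e k \<le> y \<longleftrightarrow> k \<le> ray_index e y"
proof -
  have "\<exists>l. \<not> e l \<le> y"
  proof (rule ccontr)
    assume "\<not> ?thesis"
    \<comment> \<open>Heights along a ray grow by one per step, so the point with this index is one
      higher than \<open>y\<close>.\<close>
    then have "e (Suc (nat (height y - height (e 0)))) \<le> y" by simp
    from height_mono[OF this] height_mono[OF assms(2)] show False
      by (simp add: ray_height[OF assms(1), of "Suc _"])
  qed
  define l where "l = (LEAST l. \<not> e l \<le> y)"
  have l: "\<not> e l \<le> y" "\<And>k. k < l \<Longrightarrow> e k \<le> y"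
    unfolding l_def by (rule LeastI_ex[OF \<open>\<exists>l. \<not> e l \<le> y\<close>]) (drule not_less_Least, simp)
  then obtain l' where l': "l = Suc l'" using assms(2) by (cases l) auto
  have "ray_index e y = l'" using ray_index_unique[OF assms(1)] l l' by simp
  moreover have "\<not> e k \<le> y" if "l \<le> k" for k
    using order.trans[OF ray_mono[OF assms(1) that]] l(1) by blast
  ultimately show ?thesis using l(2)[of k] l' by (cases "l \<le> k") auto
qed

text \<open>The ray condition says that the lowered point two steps ahead is not below
  \<open>f l\<close>, while it is below \<open>f (Suc l)\<close>; as \<open>f l\<close> is covered
  by \<open>f (Suc l)\<close>, only one value is left for the join. The negative condition becomes
  an equation that survives joins.\<close>

lemma ray_dsc_sup: "f \<in> rays \<Longrightarrow> sup (dsc (f (Suc (Suc l)))) (f l) = f (Suc l)"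
proof -
  assume f: "f \<in> rays"
  let ?s = "sup (dsc (f (Suc (Suc l)))) (f l)"
  have "?s \<le> f (Suc l)"
    using covers_le_asc[OF ray_covers[OF f], of "Suc l"] covers_le[OF ray_covers[OF f], of l]
    by (simp add: dsc_le_iff)
  then have "?s = f l \<or> ?s = f (Suc l)"
    using covers_between[OF ray_covers[OF f], of l ?s] by simp
  moreover have "?s \<noteq> f l" using ray_not_le_asc[OF f, of l] by (metis dsc_le_iff sup_ge1)
  ultimately show ?thesis by simp
qed

text \<open>A cover \<open>v\<close> off the ray never catches up with it:
  \<open>sup (f (Suc l)) v\<close> stays below \<open>asc (f l)\<close>, and
  \<open>f (Suc (Suc l))\<close> does not. Hence all covers of the ray survive the join with
  \<open>v\<close>, and the ray condition is carried over by \<open>ray_dsc_sup\<close>.\<close>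

lemma ray_sup_cover:
  assumes f: "f \<in> rays" and v: "f 0 \<prec>\<^sub>1 (v::'a)" "v \<noteq> f 1"
  shows "(\<lambda>k. sup (f k) v) \<in> rays"
proof -
  have step: "f l \<prec>\<^sub>1 sup (f l) v \<and> \<not> f (Suc l) \<le> sup (f l) v" for l
  proof (induction l)
    case 0
    have "sup (f 0) v = v" using covers_le[OF v(1)] by (simp add: sup.absorb2)
    moreover have "\<not> f 1 \<le> v" using covers_eq[OF ray_covers[OF f, of 0] v(1)] v(2) by auto
    ultimately show ?case using v by simp
  next
    case (Suc l)
    have "\<not> sup (f l) v \<le> f (Suc l)"
      using covers_eq[of "f l" "sup (f l) v" "f (Suc l)"] Suc ray_covers[OF f, of l] by auto
    then have "f (Suc l) \<prec>\<^sub>1 sup (sup (f l) v) (f (Suc l))"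
      using covers_sup_iff[of "f l" "sup (f l) v" "f (Suc l)"] Suc covers_le[OF ray_covers[OF f]] by simp
    also have "sup (sup (f l) v) (f (Suc l)) = sup (f (Suc l)) v"
      using covers_le[OF ray_covers[OF f, of l]] by (metis sup.absorb2 sup.assoc sup.commute)
    finally have 1: "f (Suc l) \<prec>\<^sub>1 sup (f (Suc l)) v" .
    have "v \<le> asc (f 0)" using covers_le_asc[OF v(1)] .
    also have "\<dots> \<le> asc (f l)" using ray_mono[OF f, of 0 l] by simp
    finally have "sup (f (Suc l)) v \<le> asc (f l)" using covers_le_asc[OF ray_covers[OF f]] by simp
    then have "\<not> f (Suc (Suc l)) \<le> sup (f (Suc l)) v"
      using ray_not_le_asc[OF f, of l] order.trans by blast
    with 1 show ?case by simp
  qed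
  show ?thesis
    unfolding rays_iff
  proof (intro conjI allI)
    fix l
    have "sup (f l) v \<prec>\<^sub>1 sup (f (Suc l)) (sup (f l) v)"
      using covers_sup_iff[OF ray_covers[OF f, of l], of "sup (f l) v"] step[of l] by simp
    also have "\<dots> = sup (f (Suc l)) v"
      using covers_le[OF ray_covers[OF f, of l]] by (metis sup.absorb1 sup.assoc)
    finally show "sup (f l) v \<prec>\<^sub>1 sup (f (Suc l)) v" .
    show "\<not> sup (f (Suc (Suc l))) v \<le> asc (sup (f l) v)"
    proof
      assume "sup (f (Suc (Suc l))) v \<le> asc (sup (f l) v)"
      then have "dsc (f (Suc (Suc l))) \<le> sup (f l) v" by (simp add: dsc_le_iff)
      then have "sup (dsc (f (Suc (Suc l)))) (f l) \<le> sup (f l) v" by simp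
      with ray_dsc_sup[OF f, of l] step[of l] show False by simp
    qed
  qed
qed

lemma ray_sup:
  assumes e: "e \<in> rays" and y: "e 0 \<le> y" "\<not> e 1 \<le> (y::'a)"
  shows "(\<lambda>k. sup (e k) y) \<in> rays"
proof -
  have "\<not> e 1 \<le> y \<longrightarrow> (\<lambda>k. sup (e k) y) \<in> rays"
    using y(1)
  proof (induction rule: cover_induct)
    case base
    have "sup (e k) (e 0) = e k" for k using ray_mono[OF e, of 0 k] by (simp add: sup.absorb1)
    with e show ?case by simp
  next
    case (step u v)
    show ?case
    proof
      assume v: "\<not> e 1 \<le> v"
      have uv: "u \<le> v" using covers_le[OF step(2)] .
      with v have "\<not> e 1 \<le> u" using order.trans by blast
      with step have f: "(\<lambda>k. sup (e k) u) \<in> rays" by simp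
      have "sup (e 0) u = u" using step(1) by (simp add: sup.absorb2)
      with ray_sup_cover[OF f, of v] step(2) v have "(\<lambda>k. sup (sup (e k) u) v) \<in> rays"
        by (metis sup_ge1)
      then show "(\<lambda>k. sup (e k) v) \<in> rays" using uv by (simp add: sup.assoc sup.absorb2)
    qed
  qed
  with y show ?thesis by simp
qed

lemma ray_join_rays:
  assumes "e \<in> rays" "e 0 \<le> (y::'a)"
  shows "ray_join e y \<in> rays"
  unfolding ray_join_eq
  using ray_sup[OF ray_tail[OF assms(1), of "ray_index e y"], of y] le_ray_index_iff[OF assms] by simp

lemma ray_join_0: "e \<in> rays \<Longrightarrow> e 0 \<le> (y::'a) \<Longrightarrow> ray_join e y 0 = y"
  unfolding ray_join_eq using le_ray_index_iff[of e y "ray_index e y"] by (simp add: sup.absorb2)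

lemma ray_join_self: "e \<in> rays \<Longrightarrow> ray_join e (e k) = (\<lambda>j. e (k + j) :: 'a)"
  unfolding ray_join_eq
  by (subst ray_index_unique[of e k]) (auto simp: ray_le_iff sup.absorb1)

lemma ray_join_join:
  assumes e: "e \<in> rays" and y: "e 0 \<le> y" and z: "y \<le> (z::'a)"
  shows "ray_join (ray_join e y) z = ray_join e z"
proof -
  let ?f = "ray_join e y"
  have f: "?f \<in> rays" "?f 0 \<le> z" using ray_join_rays[OF e y] ray_join_0[OF e y] z by simp_all
  let ?l = "ray_index ?f z"
  have "?f ?l \<le> z" "\<not> ?f (Suc ?l) \<le> z" using le_ray_index_iff[OF f] by simp_all
  then have "ray_index e z = ray_index e y + ?l"
    using z by (intro ray_index_unique[OF e]) (simp_all add: ray_join_eq)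
  then show ?thesis
    using z by (simp add: ray_join_eq add.assoc sup.assoc sup.absorb2)
qed

lemma ray_sup_asc: "f \<in> rays \<Longrightarrow> sup (f (Suc k)) (asc (f 0)) = asc (f k :: 'a)"
proof (induction k)
  case 0
  then show ?case using covers_le_asc[OF ray_covers] by (simp add: sup.absorb2)
next
  case (Suc k)
  have "sup (f (Suc (Suc k))) (asc (f 0)) = sup (f (Suc (Suc k))) (sup (f (Suc k)) (asc (f 0)))"
    using ray_mono[OF Suc.prems, of "Suc k" "Suc (Suc k)"] by (simp add: sup.absorb1 flip: sup.assoc)
  also have "\<dots> = asc (sup (dsc (f (Suc (Suc k)))) (f k))"
    using Suc by (simp add: asc_sup)
  also have "\<dots> = asc (f (Suc k))" using ray_dsc_sup[OF Suc.prems] by simp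
  finally show ?case .
qed

text \<open>The point \<open>asc (f 0)\<close> swallows exactly one step of the ray, and the rest
  becomes the image of the ray under \<open>asc\<close>. So transport of rays by joins contains the
  action of the automorphism, which is what makes it injective.\<close>

lemma ray_join_asc:
  assumes "f \<in> rays"
  shows "ray_join f (asc (f 0)) = (\<lambda>k. asc (f k :: 'a))"
proof -
  have "ray_index f (asc (f 0)) = 1"
    using assms ray_not_le_asc[of f 0] covers_le_asc[OF ray_covers, of f 0]
    by (intro ray_index_unique) simp_all
  then show ?thesis using ray_sup_asc[OF assms] by (simp add: ray_join_eq fun_eq_iff)
qed

lemma dsc_ray: "(f :: nat \<Rightarrow> 'a) \<in> rays \<Longrightarrow> (\<lambda>k. dsc (f k)) \<in> rays"
proof -
  assume f: "f \<in> rays"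
  have h: "height (dsc x) = height x - int n" for x using height_asc[of "dsc x"] by simp
  show ?thesis using f by (simp add: rays_iff covers_iff_height h dsc_le_iff)
qed

lemma ray_join_funpow_asc:
  "f \<in> rays \<Longrightarrow> ray_join f ((asc ^^ m) (f 0)) = (\<lambda>k. (asc ^^ m) (f k :: 'a))"
proof (induction m)
  case 0
  then show ?case using ray_join_self[of f 0] by simp
next
  case (Suc m)
  let ?g = "\<lambda>k. (asc ^^ m) (f k)"
  have g: "?g \<in> rays" "?g 0 = (asc ^^ m) (f 0)"
    using Suc.IH[OF Suc.prems] ray_join_rays[OF Suc.prems le_funpow_asc[of "f 0" m]] by simp_all
  have "ray_join f ((asc ^^ Suc m) (f 0)) = ray_join ?g (asc (?g 0))"
    using ray_join_join[OF Suc.prems, of "(asc ^^ m) (f 0)" "asc (?g 0)"] Suc le_funpow_asc le_asc by simp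
  also have "\<dots> = (\<lambda>k. (asc ^^ Suc m) (f k))" using ray_join_asc[OF g(1)] by simp
  finally show ?case .
qed

text \<open>Some power of \<open>asc\<close> carries \<open>x\<close> above \<open>z\<close>.
  Joining on up to that point is applying this power to the whole ray, and the power is
  injective.\<close>

lemma ray_join_cancel:
  assumes e: "e \<in> rays" "e 0 = x" and f: "f \<in> rays" "f 0 = x" and z: "x \<le> (z::'a)"
    and eq: "ray_join e z = ray_join f z"
  shows "e = f"
proof -
  obtain m where m: "z \<le> (asc ^^ m) x" using exists_funpow_asc_ge[OF z] ..
  have "(\<lambda>k. (asc ^^ m) (e k)) = (\<lambda>k. (asc ^^ m) (f k))"
    using ray_join_join[OF e(1) _ m] ray_join_join[OF f(1) _ m] eq z e f
      ray_join_funpow_asc[OF e(1), of m] ray_join_funpow_asc[OF f(1), of m] by simp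
  then show ?thesis by (simp add: fun_eq_iff)
qed

text \<open>Parallelism may be tested above any common upper bound: \<open>ray_join_join\<close>
  goes up from the join of the origins, and \<open>ray_join_cancel\<close> comes back. Transitivity
  is then seen above a common upper bound of three origins.\<close>

lemma parallel_iff:
  assumes e: "e \<in> rays" "e 0 \<le> z" and f: "f \<in> rays" "f 0 \<le> (z::'a)"
  shows "parallel_rays e f \<longleftrightarrow> ray_join e z = ray_join f z"
proof -
  let ?s = "sup (e 0) (f 0)"
  have s: "?s \<le> z" using e f by simp
  have 1: "ray_join (ray_join e ?s) z = ray_join e z" "ray_join (ray_join f ?s) z = ray_join f z"
    using ray_join_join[OF e(1) _ s] ray_join_join[OF f(1) _ s] by simp_all
  show ?thesis
    unfolding parallel_rays_def
    using 1 ray_join_cancel[of "ray_join e ?s" ?s "ray_join f ?s" z] s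
      ray_join_rays[OF e(1), of ?s] ray_join_rays[OF f(1), of ?s]
      ray_join_0[OF e(1), of ?s] ray_join_0[OF f(1), of ?s] by auto
qed

section \<open>Ends, and the unique ray of an end at each point\<close>

lemma equiv_parallel: "equiv rays {(e, f). e \<in> rays \<and> f \<in> (rays :: (nat \<Rightarrow> 'a) set) \<and> parallel_rays e f}"
proof (rule equivI)
  show "refl_on rays {(e, f). e \<in> rays \<and> f \<in> (rays :: (nat \<Rightarrow> 'a) set) \<and> parallel_rays e f}"
    by (auto simp: refl_on_def parallel_rays_def)
  show "sym {(e, f). e \<in> rays \<and> f \<in> (rays :: (nat \<Rightarrow> 'a) set) \<and> parallel_rays e f}"
    by (auto simp: sym_def parallel_rays_def sup.commute)
  show "trans {(e, f). e \<in> rays \<and> f \<in> (rays :: (nat \<Rightarrow> 'a) set) \<and> parallel_rays e f}"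
  proof (rule transI; clarsimp)
    fix e f g :: "nat \<Rightarrow> 'a"
    assume r: "e \<in> rays" "f \<in> rays" "g \<in> rays" and p: "parallel_rays e f" "parallel_rays f g"
    let ?z = "sup (e 0) (sup (f 0) (g 0))"
    have z: "e 0 \<le> ?z" "f 0 \<le> ?z" "g 0 \<le> ?z" by (simp_all add: le_supI2)
    show "parallel_rays e g" using p r z by (simp add: parallel_iff[of _ ?z])
  qed
qed auto

lemma end_subset_rays: "e \<in> ends \<Longrightarrow> e \<subseteq> (rays :: (nat \<Rightarrow> 'a) set)"
  unfolding ends_def using equiv_parallel by (simp add: in_quotient_imp_subset)

lemma end_parallel: "e \<in> ends \<Longrightarrow> f \<in> e \<Longrightarrow> g \<in> (e :: (nat \<Rightarrow> 'a) set) \<Longrightarrow> parallel_rays f g"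
  unfolding ends_def using quotient_eq_iff[OF equiv_parallel] by fastforce

lemma end_closed:
  "e \<in> ends \<Longrightarrow> f \<in> e \<Longrightarrow> g \<in> rays \<Longrightarrow> parallel_rays f (g :: nat \<Rightarrow> 'a) \<Longrightarrow> g \<in> e"
  unfolding ends_def using in_quotient_imp_closed[OF equiv_parallel, of e f g]
    in_quotient_imp_subset[OF equiv_parallel, of e] by blast

lemma end_nonempty: "e \<in> ends \<Longrightarrow> e \<noteq> ({} :: (nat \<Rightarrow> 'a) set)"
  unfolding ends_def using in_quotient_imp_non_empty[OF equiv_parallel] by blast

lemma end_of_ray: "f \<in> rays \<Longrightarrow> \<exists>e\<in>ends. (f :: nat \<Rightarrow> 'a) \<in> e"
  unfolding ends_def using Union_quotient[OF equiv_parallel] by blast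

lemma funpow_dsc_ray: "(f :: nat \<Rightarrow> 'a) \<in> rays \<Longrightarrow> (\<lambda>k. (dsc ^^ m) (f k)) \<in> rays"
proof (induction m)
  case (Suc m)
  then show ?case using dsc_ray[of "\<lambda>k. (dsc ^^ m) (f k)"] by simp
qed simp

text \<open>Lower a ray of the end until its origin is below \<open>x\<close>, then join it with
  \<open>x\<close>. The lowered ray is parallel to the original one because joining it with the old
  origin gives the original back.\<close>

lemma end_has_ray: "e \<in> ends \<Longrightarrow> \<exists>f\<in>e. f 0 = (x::'a)"
proof -
  assume e: "e \<in> ends"
  then obtain g where g: "g \<in> e" "g \<in> rays" using end_nonempty end_subset_rays by blast
  obtain m where m: "(dsc ^^ m) (g 0) \<le> x" using exists_funpow_dsc_le by blast
  let ?h = "\<lambda>k. (dsc ^^ m) (g k)" and ?z = "sup x (g 0)"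
  have h: "?h \<in> rays" "?h 0 \<le> x" using funpow_dsc_ray[OF g(2)] m by simp_all
  let ?f = "ray_join ?h x"
  note f = ray_join_rays[OF h] ray_join_0[OF h]
  have "ray_join ?h (g 0) = g" using ray_join_funpow_asc[OF h(1), of m] by (simp add: fun_eq_iff)
  moreover have "?h 0 \<le> g 0" by (simp add: funpow_dsc_le_iff le_funpow_asc)
  ultimately have "ray_join g ?z = ray_join ?f ?z"
    using ray_join_join[OF h(1), of "g 0" ?z] ray_join_join[OF h, of ?z] by simp
  then have "parallel_rays g ?f" using f g by (simp add: parallel_iff[of _ ?z])
  with end_closed[OF e g(1) f(1)] f(2) show ?thesis by blast
qed

lemma end_ray_eqI:
  assumes e: "e \<in> ends" and f: "f \<in> e" "f 0 = (x::'a)"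
  shows "end_ray e x = f"
  unfolding end_ray_def
proof (rule the_equality)
  fix g assume g: "g \<in> e \<and> g 0 = x"
  have r: "f \<in> rays" "g \<in> rays" using e f g end_subset_rays by auto
  have "parallel_rays g f" using end_parallel[OF e] f g by simp
  then show "g = f"
    using r f g ray_join_self[of g 0] ray_join_self[of f 0] by (simp add: parallel_iff[of g x f])
qed (use f in simp)

lemma end_ray_in: "e \<in> ends \<Longrightarrow> end_ray e (x::'a) \<in> e"
  using end_has_ray end_ray_eqI by metis

lemma end_ray_0 [simp]: "e \<in> ends \<Longrightarrow> end_ray e (x::'a) 0 = x"
  using end_has_ray end_ray_eqI by metis

lemma end_ray_rays: "e \<in> ends \<Longrightarrow> end_ray e (x::'a) \<in> rays"
  using end_ray_in end_subset_rays by blast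

lemma end_ray_join:
  assumes e: "e \<in> ends" and xy: "x \<le> (y::'a)"
  shows "end_ray e y = ray_join (end_ray e x) y"
proof (rule end_ray_eqI[OF e])
  let ?r = "end_ray e x"
  have r: "?r \<in> rays" "?r 0 \<le> y" using end_ray_rays[OF e] e xy by simp_all
  note j = ray_join_rays[OF r] ray_join_0[OF r]
  have "parallel_rays ?r (ray_join ?r y)"
    using r j ray_join_join[OF r, of y] by (simp add: parallel_iff[of _ y])
  then show "ray_join ?r y \<in> e" using end_closed[OF e end_ray_in[OF e] j(1)] by simp
  show "ray_join ?r y 0 = y" using j(2) .
qed

lemma end_ray_asc: "e \<in> ends \<Longrightarrow> end_ray e (asc x) = (\<lambda>k. asc (end_ray e (x::'a) k))"
  using end_ray_join[OF _ le_asc, of e x] ray_join_asc[OF end_ray_rays, of e x] by simp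

lemma end_ray_tail: "e \<in> ends \<Longrightarrow> end_ray e (end_ray e x k) = (\<lambda>j. end_ray e (x::'a) (k + j))"
  using end_ray_join[of e x "end_ray e x k"] ray_join_self[OF end_ray_rays, of e x k]
    ray_mono[OF end_ray_rays, of e 0 k x] by simp

lemma end_ray_inj:
  assumes "e \<in> ends" "f \<in> ends" "end_ray e (x::'a) = end_ray f x"
  shows "e = f"
  using quotient_disj[OF equiv_parallel, of e f] assms end_ray_in[of e x] end_ray_in[of f x]
  unfolding ends_def by auto

text \<open>A ray can always be continued: if every cover of \<open>b\<close> were below
  \<open>asc a\<close> for some cover \<open>b\<close> of \<open>a\<close>, then
  \<open>asc b\<close> would be below \<open>asc a\<close>.\<close>

lemma exists_ray_through:
  assumes "x \<prec>\<^sub>1 (y::'a)"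
  shows "\<exists>e\<in>ends. end_ray e x 1 = y"
proof -
  have step: "\<exists>c. b \<prec>\<^sub>1 c \<and> \<not> c \<le> asc a" if "a \<prec>\<^sub>1 b" for a b :: 'a
  proof (rule ccontr)
    assume "\<not> ?thesis"
    then have "asc b \<le> asc a" by (intro asc_least) blast
    with covers_less[OF that] show False by simp
  qed
  \<comment> \<open>The ray condition looks two steps back, so the states of the recursive choice
    are pairs of consecutive points; the clause for \<open>k = 0\<close> pins the first
    pair.\<close>
  have "\<exists>f. \<forall>k. (fst (f k) \<prec>\<^sub>1 snd (f k) \<and> (k = 0 \<longrightarrow> f k = (x, y))) \<and>
      (fst (f (Suc k)) = snd (f k) \<and> \<not> snd (f (Suc k)) \<le> asc (fst (f k)))"
  proof (rule dependent_nat_choice)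
    show "\<exists>p. fst p \<prec>\<^sub>1 snd p \<and> (0 = (0::nat) \<longrightarrow> p = (x, y))" using assms by auto
    fix p and k :: nat assume "fst p \<prec>\<^sub>1 snd p \<and> (k = 0 \<longrightarrow> p = (x, y))"
    then obtain c where "snd p \<prec>\<^sub>1 c" "\<not> c \<le> asc (fst p)" using step by blast
    then show "\<exists>q. (fst q \<prec>\<^sub>1 snd q \<and> (Suc k = 0 \<longrightarrow> q = (x, y))) \<and> fst q = snd p \<and> \<not> snd q \<le> asc (fst p)"
      by (intro exI[of _ "(snd p, c)"]) simp
  qed
  then obtain f where f: "\<And>k. fst (f k) \<prec>\<^sub>1 snd (f k)" "f 0 = (x, y)"
    "\<And>k. fst (f (Suc k)) = snd (f k)" "\<And>k. \<not> snd (f (Suc k)) \<le> asc (fst (f k))" by auto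
  let ?r = "\<lambda>k. fst (f k)"
  have r: "?r \<in> rays" using f by (simp add: rays_iff)
  then obtain e where e: "e \<in> ends" "?r \<in> e" using end_of_ray by blast
  have "end_ray e x = ?r" using end_ray_eqI[OF e] f(2) by simp
  then show ?thesis using f(2) f(3)[of 0] e(1) by (intro bexI[of _ e]) simp_all
qed

end

section \<open>Busemann functions\<close>

definition ray_steps :: "(nat \<Rightarrow> 'a::lattice) set \<Rightarrow> 'a \<Rightarrow> 'a \<Rightarrow> nat" where
  "ray_steps e x y = ray_index (end_ray e x) y"

text \<open>For comparable points this counts the steps of the \<open>x\<close>-ray of \<open>e\<close> that stay below \<open>y\<close>; in
  general it is the \<open>e\<close>-coordinate of \<open>y\<close> when \<open>x\<close> is the origin.\<close>

definition busemann :: "(nat \<Rightarrow> 'a::lattice) set \<Rightarrow> 'a \<Rightarrow> 'a \<Rightarrow> int" where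
  "busemann e x y = int (ray_steps e (inf x y) y) - int (ray_steps e (inf x y) x)"

context uniform_lattice
begin

lemma le_ray_steps_iff:
  "e \<in> ends \<Longrightarrow> x \<le> y \<Longrightarrow> end_ray e x k \<le> y \<longleftrightarrow> k \<le> ray_steps e x (y::'a)"
  unfolding ray_steps_def using le_ray_index_iff[OF end_ray_rays, of e x y k] by simp

lemma end_ray_sup:
  "e \<in> ends \<Longrightarrow> x \<le> y \<Longrightarrow> end_ray e y k = sup (end_ray e x (ray_steps e x y + k)) (y::'a)"
  unfolding ray_steps_def by (simp add: end_ray_join[of e x y] ray_join_eq)

lemma ray_steps_add:
  assumes e: "e \<in> ends" and xy: "x \<le> y" and yz: "y \<le> (z::'a)"
  shows "ray_steps e x z = ray_steps e x y + ray_steps e y z"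
proof -
  have xz: "x \<le> z" using xy yz by (rule order.trans)
  have iff: "k \<le> ray_steps e y z \<longleftrightarrow> ray_steps e x y + k \<le> ray_steps e x z" for k
    using le_ray_steps_iff[OF e yz, of k] le_ray_steps_iff[OF e xz, of "ray_steps e x y + k"]
      end_ray_sup[OF e xy, of k] yz by simp
  from iff[of 0] iff[of "ray_steps e y z"] iff[of "ray_steps e x z - ray_steps e x y"]
  show ?thesis by simp
qed

lemma ray_steps_self: "e \<in> ends \<Longrightarrow> ray_steps e x (x::'a) = 0"
  using ray_steps_add[of e x x x] by simp

lemma busemann_lower:
  assumes "e \<in> ends" "w \<le> x" "w \<le> (y::'a)"
  shows "busemann e x y = int (ray_steps e w y) - int (ray_steps e w x)"
proof -
  have "w \<le> inf x y" using assms by simp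
  then show ?thesis
    using ray_steps_add[OF assms(1), of w "inf x y" x] ray_steps_add[OF assms(1), of w "inf x y" y]
    by (simp add: busemann_def)
qed

lemma busemann_of_le: "e \<in> ends \<Longrightarrow> x \<le> y \<Longrightarrow> busemann e x y = int (ray_steps e x (y::'a))"
  using busemann_lower[of e x x y] by (simp add: ray_steps_self)

lemma busemann_add:
  assumes e: "e \<in> ends"
  shows "busemann e x y + busemann e y z = busemann e x (z::'a)"
proof -
  let ?w = "inf x (inf y z)"
  have w: "?w \<le> x" "?w \<le> y" "?w \<le> z" by (simp_all add: le_infI2)
  show ?thesis
    using busemann_lower[OF e w(1,2)] busemann_lower[OF e w(2,3)] busemann_lower[OF e w(1,3)] by simp
qed

lemma busemann_self [simp]: "e \<in> ends \<Longrightarrow> busemann e x (x::'a) = 0"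
  using busemann_add[of e x x x] by simp

lemma busemann_nonneg: "e \<in> ends \<Longrightarrow> x \<le> y \<Longrightarrow> 0 \<le> busemann e x (y::'a)"
  by (simp add: busemann_of_le)

lemma busemann_mono: "e \<in> ends \<Longrightarrow> y \<le> z \<Longrightarrow> busemann e x y \<le> busemann e x (z::'a)"
  using busemann_add[of e x y z] busemann_nonneg[of e y z] by simp

lemma end_ray_le_iff:
  "e \<in> ends \<Longrightarrow> x \<le> y \<Longrightarrow> end_ray e x k \<le> y \<longleftrightarrow> int k \<le> busemann e x (y::'a)"
  by (simp add: le_ray_steps_iff busemann_of_le)

lemma le_end_ray: "e \<in> ends \<Longrightarrow> x \<le> end_ray e (x::'a) k"
  using ray_mono[OF end_ray_rays, of e 0 k x] by simp

lemma busemann_end_ray: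
  assumes "e \<in> ends"
  shows "busemann e x (end_ray e (x::'a) k) = int k"
proof -
  have "int j \<le> busemann e x (end_ray e x k) \<longleftrightarrow> j \<le> k" for j
    using end_ray_le_iff[OF assms le_end_ray[OF assms], of x j k] ray_le_iff[OF end_ray_rays[OF assms]]
    by simp
  from this[of k] this[of "Suc k"] show ?thesis by simp
qed

lemma busemann_asc:
  assumes "e \<in> ends"
  shows "busemann e x (asc (x::'a)) = 1"
proof -
  note r = end_ray_rays[OF assms, of x]
  have "end_ray e x 1 \<le> asc x" "\<not> end_ray e x 2 \<le> asc x"
    using covers_le_asc[OF ray_covers[OF r, of 0]] ray_not_le_asc[OF r, of 0] assms
    by (simp_all add: numeral_2_eq_2)
  then show ?thesis
    using end_ray_le_iff[OF assms le_asc, of x 1] end_ray_le_iff[OF assms le_asc, of x 2] by simp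
qed

lemma busemann_funpow_asc: "e \<in> ends \<Longrightarrow> busemann e x ((asc ^^ m) (x::'a)) = int m"
proof (induction m)
  case (Suc m)
  then show ?case
    using busemann_add[of e x "(asc ^^ m) x" "(asc ^^ Suc m) x"] busemann_asc[of e "(asc ^^ m) x"] by simp
qed simp

lemma height_end_ray: "e \<in> ends \<Longrightarrow> height (end_ray e x k) = height (x::'a) + int k"
  using ray_height[OF end_ray_rays, of e x k] by simp

lemma covers_end_ray: "e \<in> ends \<Longrightarrow> x \<prec>\<^sub>1 end_ray e (x::'a) 1"
  using ray_covers[OF end_ray_rays, of e x 0] by simp

section \<open>Independent sets of ends and bases at a point\<close>

definition atom_join :: "'a \<Rightarrow> (nat \<Rightarrow> 'a) set set \<Rightarrow> 'a" where
  "atom_join x I = join (insert x ((\<lambda>e. end_ray e x 1) ` I))"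

text \<open>A finite nonempty set has a supremum, so the definite description in \<open>join\<close>
  denotes it. Later arguments about joins of atoms rest on this universal property.\<close>

lemma atom_join_le_iff:
  assumes "finite I"
  shows "atom_join x I \<le> u \<longleftrightarrow> x \<le> u \<and> (\<forall>e\<in>I. end_ray e x 1 \<le> u)"
proof -
  let ?A = "insert x ((\<lambda>e. end_ray e x 1) ` I)"
  have A: "finite ?A" "?A \<noteq> {}" using assms by simp_all
  have "isLub UNIV ?A (Sup_fin ?A)"
    unfolding isLub_UNIV_iff using Sup_fin.coboundedI[OF A(1)] Sup_fin.boundedI[OF A] by blast
  then have "atom_join x I = Sup_fin ?A" unfolding atom_join_def by (rule join_eqI)
  then show ?thesis using Sup_fin.bounded_iff[OF A] by simp
qed

lemma atom_join_upper: "finite I \<Longrightarrow> e \<in> I \<Longrightarrow> end_ray e x 1 \<le> atom_join x I"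
  using atom_join_le_iff[of I x "atom_join x I"] by simp

lemma le_atom_join: "finite I \<Longrightarrow> x \<le> atom_join x I"
  using atom_join_le_iff[of I x "atom_join x I"] by simp

lemma atom_join_mono:
  assumes "finite J" "I \<subseteq> J"
  shows "atom_join x I \<le> atom_join x J"
  using atom_join_le_iff[OF finite_subset[OF assms(2,1)], of x "atom_join x J"]
    atom_join_upper[OF assms(1)] le_atom_join[OF assms(1)] assms(2) by blast

lemma atom_join_insert:
  "finite I \<Longrightarrow> atom_join x (insert e I) = sup (end_ray e x 1) (atom_join x I)"
proof (rule order.antisym)
  assume I: "finite I"
  then have "end_ray f x 1 \<le> sup (end_ray e x 1) (atom_join x I)" if "f \<in> insert e I" for f
    using that atom_join_upper[OF I, of f x] by (auto intro: le_supI2)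
  then show "atom_join x (insert e I) \<le> sup (end_ray e x 1) (atom_join x I)"
    using I le_atom_join[OF I, of x] by (simp add: atom_join_le_iff le_supI2)
  show "sup (end_ray e x 1) (atom_join x I) \<le> atom_join x (insert e I)"
    using atom_join_upper[of "insert e I" e x] atom_join_mono[of "insert e I" I x] I by auto
qed

lemma atom_join_empty [simp]: "atom_join x {} = x"
  using atom_join_le_iff[of "{}" x x] le_atom_join[of "{}" x] by (simp add: order.antisym)

lemma covers_atom_join_insert:
  "finite I \<Longrightarrow> e \<in> ends \<Longrightarrow> \<not> end_ray e x 1 \<le> atom_join x I \<Longrightarrow>
    atom_join x I \<prec>\<^sub>1 atom_join x (insert e I)"
  using covers_sup_iff[OF covers_end_ray, of e x "atom_join x I"] le_atom_join[of I x]
  by (simp add: atom_join_insert)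

text \<open>Each further end raises the join by at most one cover. This subadditivity of rank makes
  subsets of independent sets independent.\<close>

lemma height_atom_join_union_le:
  assumes "finite I" "finite J" "J \<subseteq> ends"
  shows "height (atom_join x (I \<union> J)) \<le> height (atom_join x I) + int (card J)"
  using assms(2,3)
proof (induction J)
  case (insert e J)
  have fin: "finite (I \<union> J)" using assms insert by simp
  have "height (atom_join x (insert e (I \<union> J))) \<le> height (atom_join x (I \<union> J)) + 1"
  proof (cases "end_ray e x 1 \<le> atom_join x (I \<union> J)")
    case True
    then show ?thesis by (simp add: atom_join_insert[OF fin] sup.absorb2)
  next
    case False
    then show ?thesis using height_covers[OF covers_atom_join_insert[OF fin _ False]] insert by simp
  qed
  with insert show ?case by simp
qed simp

lemma height_atom_join_le:
  "finite I \<Longrightarrow> I \<subseteq> ends \<Longrightarrow> height (atom_join x I) \<le> height x + int (card I)"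
  using height_atom_join_union_le[of "{}" I x] by simp

lemma independent_at_iff:
  "independent_at (x::'a) I \<longleftrightarrow> I \<subseteq> ends \<and> finite I \<and> height (atom_join x I) = height x + int (card I)"
  by (auto simp: independent_at_def rel_height_def atom_join_def)

lemma independent_at_empty: "independent_at (x::'a) {}"
  by (simp add: independent_at_iff)

lemma independent_at_insert:
  assumes I: "independent_at (x::'a) I" and e: "e \<in> ends" "\<not> end_ray e x 1 \<le> atom_join x I"
  shows "independent_at x (insert e I)"
proof -
  have fin: "finite I" using I by (simp add: independent_at_iff)
  then have "e \<notin> I" using e atom_join_upper by blast
  then show ?thesis
    using I e height_covers[OF covers_atom_join_insert[OF fin e]] fin by (simp add: independent_at_iff)
qed

lemma independent_at_subset:
  assumes J: "independent_at (x::'a) J" and "I \<subseteq> J"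
  shows "independent_at x I"
proof -
  have fin: "finite I" "finite (J - I)" "I \<subseteq> ends" "J - I \<subseteq> ends" "I \<union> (J - I) = J"
    using assms finite_subset[of I J] by (auto simp: independent_at_iff)
  have "card J = card I + card (J - I)"
    using fin card_Un_disjoint[of I "J - I"] by simp
  then have "height x + int (card I) \<le> height (atom_join x I)"
    using height_atom_join_union_le[OF fin(1,2,4), of x] fin J by (simp add: independent_at_iff)
  then show ?thesis using height_atom_join_le[OF fin(1,3), of x] fin by (simp add: independent_at_iff)
qed

lemma atom_join_le_asc: "finite I \<Longrightarrow> I \<subseteq> ends \<Longrightarrow> atom_join x I \<le> asc x"
  using covers_le_asc[OF covers_end_ray] by (auto simp: atom_join_le_iff le_asc)

text \<open>All atoms at \<open>x\<close> lie below \<open>asc x\<close>, which is \<open>n\<close>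
  higher than \<open>x\<close>; reaching this height is the same as reaching
  \<open>asc x\<close>.\<close>

lemma bases_at_iff:
  "B \<in> bases_at n (x::'a) \<longleftrightarrow> B \<subseteq> ends \<and> finite B \<and> card B = n \<and> atom_join x B = asc x"
proof -
  have "B \<subseteq> ends \<Longrightarrow> finite B \<Longrightarrow> card B = n \<Longrightarrow>
      height (atom_join x B) = height x + int n \<Longrightarrow> atom_join x B = asc x"
    using height_eq_imp_eq[OF atom_join_le_asc, of B x] height_asc[of x] by simp
  then show ?thesis by (auto simp: bases_at_def independent_at_iff height_asc)
qed

lemma bases_at_subset_ends: "B \<in> bases_at n (x::'a) \<Longrightarrow> e \<in> B \<Longrightarrow> e \<in> ends"
  by (auto simp: bases_at_iff)

lemma bases_at_finite: "B \<in> bases_at n (x::'a) \<Longrightarrow> finite B"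
  by (simp add: bases_at_iff)

lemma bases_at_independent: "B \<in> bases_at n (x::'a) \<Longrightarrow> I \<subseteq> B \<Longrightarrow> independent_at x I"
  using independent_at_subset by (auto simp: bases_at_def)

text \<open>Intervals \<open>[x, asc x]\<close> are atomistic: a ray through the cover \<open>z \<prec>\<^sub>1 y\<close> cannot have left \<open>x\<close>
  before reaching \<open>z\<close>, since it advances only once within \<open>[x, asc x]\<close>.\<close>

lemma exists_atom:
  assumes "x \<le> z" "z \<prec>\<^sub>1 (y::'a)" "y \<le> asc x"
  obtains e where "e \<in> ends" "\<not> end_ray e x 1 \<le> z" "sup (end_ray e x 1) z = y"
proof -
  obtain e where e: "e \<in> ends" "end_ray e z 1 = y" using exists_ray_through[OF assms(2)] by blast
  have 1: "busemann e z y = 1" using busemann_end_ray[of e z 1] e by simp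
  have "busemann e x y \<le> 1" using busemann_mono[OF e(1) assms(3), of x] busemann_asc[OF e(1)] by simp
  then have 0: "busemann e x z = 0"
    using busemann_add[OF e(1), of x z y] busemann_nonneg[OF e(1) assms(1)] 1 by simp
  have "\<not> end_ray e x 1 \<le> z" using end_ray_le_iff[OF e(1) assms(1), of 1] 0 by simp
  moreover have "sup (end_ray e x 1) z = y"
    using end_ray_sup[OF e(1) assms(1), of 1] e(2) 0 busemann_of_le[OF e(1) assms(1)] by simp
  ultimately show thesis using that e(1) by blast
qed

text \<open>Climb from the join of \<open>I\<close> to \<open>z\<close> along covers; atomisticity
  supplies one new end for every cover.\<close>

lemma independent_at_extend:
  assumes "independent_at (x::'a) I" "atom_join x I \<le> z" "z \<le> asc x"
  obtains J where "I \<subseteq> J" "independent_at x J" "atom_join x J = z"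
proof -
  have fin: "finite I" using assms(1) by (simp add: independent_at_iff)
  have "\<exists>J. I \<subseteq> J \<and> independent_at x J \<and> atom_join x J = z"
    using assms(2)
  proof (induction rule: cover_induct)
    case base
    show ?case using assms(1) by blast
  next
    case (step u v)
    then obtain J where J: "I \<subseteq> J" "independent_at x J" "atom_join x J = u" by blast
    have "x \<le> u" using order.trans[OF le_atom_join[OF fin] step(1)] .
    moreover have "v \<le> asc x" using order.trans[OF step(3) assms(3)] .
    ultimately obtain e where e: "e \<in> ends" "\<not> end_ray e x 1 \<le> u" "sup (end_ray e x 1) u = v"
      using exists_atom step(2) by blast
    have "independent_at x (insert e J)" using independent_at_insert J e by simp
    moreover have "atom_join x (insert e J) = v"
      using J e atom_join_insert by (simp add: independent_at_iff)
    ultimately show ?case using J(1) by blast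
  qed
  with that show thesis by blast
qed

lemma basis_extend:
  assumes "independent_at (x::'a) I"
  obtains B where "I \<subseteq> B" "B \<in> bases_at n x"
proof -
  have "atom_join x I \<le> asc x" using assms atom_join_le_asc by (simp add: independent_at_iff)
  from independent_at_extend[OF assms this order.refl]
  obtain J where J: "I \<subseteq> J" "independent_at x J" "atom_join x J = asc x" by blast
  then have "card J = n" by (simp add: independent_at_iff height_asc)
  with J that show thesis by (simp add: bases_at_iff independent_at_iff)
qed

section \<open>Persistence of a basis under the automorphism and along its own rays\<close>

lemma atom_join_asc:
  assumes "finite I" "I \<subseteq> ends"
  shows "atom_join (asc x) I = asc (atom_join x I)"
proof -
  have "atom_join (asc x) I \<le> asc u \<longleftrightarrow> atom_join x I \<le> u" for u
    using assms(2) by (auto simp: atom_join_le_iff[OF assms(1)] end_ray_asc subset_iff)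
  from this[of "atom_join x I"] this[of "dsc (atom_join (asc x) I)"]
  show ?thesis by (metis asc_dsc asc_le_iff order.antisym order.refl)
qed

lemma bases_at_asc: "B \<in> bases_at n (asc (x::'a)) \<longleftrightarrow> B \<in> bases_at n x"
  by (auto simp: bases_at_iff atom_join_asc)

lemma bases_at_funpow_asc: "B \<in> bases_at n ((asc ^^ m) (x::'a)) \<longleftrightarrow> B \<in> bases_at n x"
  by (induction m) (simp_all add: bases_at_asc)

lemma bases_at_funpow_dsc: "B \<in> bases_at n ((dsc ^^ m) x) \<longleftrightarrow> B \<in> bases_at n x"
  using bases_at_funpow_asc[of B m "(dsc ^^ m) x"] by simp

lemma end_ray_1_le:
  assumes "e \<in> ends" "x \<le> y"
  shows "end_ray e x 1 \<le> end_ray e (y::'a) 1"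
  using end_ray_sup[OF assms, of 1] ray_mono[OF end_ray_rays[OF assms(1)], of 1 "ray_steps e x y + 1" x]
  by (metis le_add2 le_supI1)

text \<open>Atoms only move up, so the join of the atoms at the new point is above
  \<open>asc x\<close>. It also contains the second point of the ray of \<open>e\<close>, which is
  not below \<open>asc x\<close>. Being strictly higher than \<open>asc x\<close>, it already has
  the height of \<open>asc\<close> of the new point.\<close>

lemma bases_at_step:
  assumes B: "B \<in> bases_at n (x::'a)" and e: "e \<in> B"
  shows "B \<in> bases_at n (end_ray e x 1)"
proof -
  let ?y = "end_ray e x 1"
  have b: "B \<subseteq> ends" "finite B" "card B = n" "atom_join x B = asc x" "e \<in> ends"
    using B e by (auto simp: bases_at_iff)
  have xy: "x \<le> ?y" using le_end_ray[OF b(5)] .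
  have "end_ray f x 1 \<le> atom_join ?y B" if "f \<in> B" for f
    using order.trans[OF end_ray_1_le[OF _ xy] atom_join_upper[OF b(2) that]] b(1) that by blast
  moreover have "x \<le> atom_join ?y B" using order.trans[OF xy le_atom_join[OF b(2)]] .
  ultimately have 1: "asc x \<le> atom_join ?y B" unfolding b(4)[symmetric] by (simp add: atom_join_le_iff b(2))
  have "end_ray e x 2 \<le> atom_join ?y B"
    using atom_join_upper[OF b(2) e, of ?y] end_ray_tail[OF b(5), of x 1] by (simp add: numeral_2_eq_2)
  moreover have "\<not> end_ray e x 2 \<le> asc x"
    using end_ray_le_iff[OF b(5) le_asc, of x 2] busemann_asc[OF b(5)] by simp
  ultimately have "asc x \<noteq> atom_join ?y B" by auto
  with 1 have "asc x < atom_join ?y B" by simp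
  from height_strict_mono[OF this] have "height (asc ?y) \<le> height (atom_join ?y B)"
    using height_asc[of x] height_asc[of ?y] height_end_ray[OF b(5), of x 1] by simp
  then have "atom_join ?y B = asc ?y" using height_eq_imp_eq[OF atom_join_le_asc[OF b(2,1)]] by simp
  with b show ?thesis by (simp add: bases_at_iff)
qed

lemma basis_atoms_distinct:
  assumes B: "B \<in> bases_at n (x::'a)" and "e \<in> B" "f \<in> B" "e \<noteq> f"
  shows "\<not> end_ray f x 1 \<le> end_ray e x 1"
proof
  assume le: "end_ray f x 1 \<le> end_ray e x 1"
  have "independent_at x {e, f}" using bases_at_independent[OF B, of "{e, f}"] assms by simp
  then have "height (atom_join x {f, e}) = height x + 2"
    using assms(4) by (simp add: independent_at_iff insert_commute)
  moreover have "atom_join x {f, e} = end_ray e x 1"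
    using atom_join_insert[of "{e}" x f] atom_join_insert[of "{}" x e] le
      le_end_ray[OF bases_at_subset_ends[OF B assms(2)], of x 1] by (simp add: sup.absorb1 sup.absorb2)
  ultimately show False using height_end_ray[OF bases_at_subset_ends[OF B assms(2)], of x 1] by simp
qed

lemma busemann_basis_step:
  assumes B: "B \<in> bases_at n (x::'a)" and "e \<in> B" "f \<in> B" "e \<noteq> f"
  shows "busemann f x (end_ray e x 1) = 0"
proof -
  have fe: "e \<in> ends" "f \<in> ends" using assms bases_at_subset_ends by blast+
  show ?thesis
    using end_ray_le_iff[OF fe(2) le_end_ray[OF fe(1)], of x 1 1] basis_atoms_distinct[OF assms]
      busemann_nonneg[OF fe(2) le_end_ray[OF fe(1)], of x 1] by simp
qed

text \<open>Walk \<open>k e\<close> steps along each ray in turn: the basis persists, and a step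
  along \<open>e\<close> leaves the other coordinates in \<open>B\<close> unchanged. The last clause
  says that the point reached is no higher than any upper bound of \<open>x\<close> and the points
  \<open>end_ray e x (k e)\<close>, so it is their join.\<close>

lemma bases_at_move:
  fixes k :: "(nat \<Rightarrow> 'a) set \<Rightarrow> nat"
  assumes B: "B \<in> bases_at n (x::'a)"
  shows "\<exists>w. B \<in> bases_at n w \<and> x \<le> w \<and> (\<forall>e\<in>B. busemann e x w = int (k e)) \<and>
    height w = height x + (\<Sum>e\<in>B. int (k e)) \<and>
    (\<forall>y. x \<le> y \<longrightarrow> (\<forall>e\<in>B. end_ray e x (k e) \<le> y) \<longrightarrow> w \<le> y)"
proof (induction "\<Sum>e\<in>B. k e" arbitrary: k)
  case 0
  then have "\<forall>e\<in>B. k e = 0" using bases_at_finite[OF B] by simp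
  then show ?case using B bases_at_subset_ends[OF B] by (intro exI[of _ x]) simp
next
  case (Suc N)
  have fin: "finite B" using bases_at_finite[OF B] .
  obtain e where e: "e \<in> B" "k e \<noteq> 0" using Suc.hyps(2) by (metis sum.neutral Zero_not_Suc)
  have eE: "e \<in> ends" using bases_at_subset_ends[OF B e(1)] .
  let ?k = "k(e := k e - 1)"
  have rest: "(\<Sum>f\<in>B - {e}. ?k f) = (\<Sum>f\<in>B - {e}. k f)" by (rule sum.cong) auto
  have s: "(\<Sum>f\<in>B. k f) = Suc (\<Sum>f\<in>B. ?k f)"
    using e sum.remove[OF fin e(1), of k] sum.remove[OF fin e(1), of ?k] rest by simp
  then have "N = (\<Sum>f\<in>B. ?k f)" using Suc.hyps(2) by simp
  from Suc.hyps(1)[OF this] obtain w where w: "B \<in> bases_at n w" "x \<le> w" "\<forall>f\<in>B. busemann f x w = int (?k f)"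
    "height w = height x + (\<Sum>f\<in>B. int (?k f))"
    "\<forall>y. x \<le> y \<longrightarrow> (\<forall>f\<in>B. end_ray f x (?k f) \<le> y) \<longrightarrow> w \<le> y"
    by blast
  let ?v = "end_ray e w 1"
  have wv: "w \<le> ?v" using le_end_ray[OF eE] .
  show ?case
  proof (intro exI[of _ ?v] conjI ballI allI impI)
    show "B \<in> bases_at n ?v" using bases_at_step[OF w(1) e(1)] .
    show "x \<le> ?v" using order.trans[OF w(2) wv] .
    show "busemann f x ?v = int (k f)" if "f \<in> B" for f
      using busemann_add[OF bases_at_subset_ends[OF B that], of x w ?v] w(3) that e
        busemann_basis_step[OF w(1) e(1) that] busemann_end_ray[OF eE, of w 1]
      by (cases "f = e") auto
    show "height ?v = height x + (\<Sum>f\<in>B. int (k f))"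
      using height_end_ray[OF eE, of w 1] w(4) s by (simp flip: of_nat_sum)
    fix y assume y: "x \<le> y" "\<forall>f\<in>B. end_ray f x (k f) \<le> y"
    have "end_ray f x (?k f) \<le> y" if "f \<in> B" for f
    proof -
      have "end_ray f x (?k f) \<le> end_ray f x (k f)"
        using ray_mono[OF end_ray_rays[OF bases_at_subset_ends[OF B that]]] by simp
      also have "\<dots> \<le> y" using y that by simp
      finally show ?thesis .
    qed
    with w(5) y have "w \<le> y" by blast
    \<comment> \<open>The point \<open>w\<close> stops one step short in the direction of
      \<open>e\<close>, so its atom there is the join of \<open>w\<close> with
      \<open>end_ray e x (k e)\<close>.\<close>
    moreover have "ray_steps e x w + 1 = k e"
      using w(3) e busemann_of_le[OF eE w(2)] by simp
    ultimately show "?v \<le> y" using end_ray_sup[OF eE w(2), of 1] y e by simp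
  qed
qed

section \<open>Apartments and projections\<close>

text \<open>The \<open>m\<close>-fold ascent of \<open>x\<close> is the apartment point with all
  coordinates \<open>m\<close>: the least such point is below it and has the same height
  \<open>n * m\<close> above \<open>x\<close>.\<close>

lemma funpow_asc_le:
  assumes B: "B \<in> bases_at n x" and "x \<le> u" "\<forall>e\<in>B. int m \<le> busemann e x (u::'a)"
  shows "(asc ^^ m) x \<le> u"
proof -
  obtain w where w: "x \<le> w" "height w = height x + (\<Sum>e\<in>B. int m)"
    "\<forall>y. x \<le> y \<longrightarrow> (\<forall>e\<in>B. end_ray e x m \<le> y) \<longrightarrow> w \<le> y"
    using bases_at_move[OF B, of "\<lambda>_. m"] by blast
  have "\<forall>e\<in>B. end_ray e x m \<le> (asc ^^ m) x"
    using end_ray_le_iff[OF _ le_funpow_asc] busemann_funpow_asc bases_at_subset_ends[OF B] by simp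
  then have "w \<le> (asc ^^ m) x" using w(3) le_funpow_asc by blast
  moreover have "height w = height ((asc ^^ m) x)"
    using w(2) B by (simp add: height_funpow_asc bases_at_iff)
  ultimately have "w = (asc ^^ m) x" using height_eq_imp_eq by simp
  moreover have "\<forall>e\<in>B. end_ray e x m \<le> u"
    using assms end_ray_le_iff bases_at_subset_ends[OF B] by simp
  ultimately show ?thesis using w(3) assms(2) by blast
qed

text \<open>Seen from \<open>y\<close>, the point \<open>(asc ^^ m) x\<close> has all coordinates
  \<open>m\<close>, as it has from \<open>x\<close>. Since \<open>B\<close> is also a basis at
  \<open>y\<close>, this puts \<open>(asc ^^ m) y\<close> below \<open>(asc ^^ m) x\<close>, and the
  power cancels.\<close>

lemma bases_at_eqI:
  assumes B: "B \<in> bases_at n x" "B \<in> bases_at n (y::'a)" and xy: "x \<le> y"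
    and 0: "\<forall>e\<in>B. busemann e x y = 0"
  shows "x = y"
proof -
  obtain m where m: "y \<le> (asc ^^ m) x" using exists_funpow_asc_ge[OF xy] ..
  have "busemann e y ((asc ^^ m) x) = int m" if "e \<in> B" for e
    using busemann_add[of e x y "(asc ^^ m) x"] busemann_funpow_asc[of e x m] 0 that
      bases_at_subset_ends[OF B(1) that] by simp
  then have "(asc ^^ m) y \<le> (asc ^^ m) x" using funpow_asc_le[OF B(2) m, of m] by auto
  with xy show ?thesis by (simp add: order.antisym)
qed

lemma bases_at_lower:
  assumes B: "B \<in> bases_at n x"
  obtains u where "B \<in> bases_at n u" "u \<le> (y::'a)"
  using exists_funpow_dsc_le[of x y] B bases_at_funpow_dsc by blast

text \<open>The point \<open>w\<close> will turn out to be the projection of \<open>y\<close> to the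
  apartment of \<open>B\<close>. It is built upwards from an apartment point \<open>u\<close> below
  \<open>y\<close>, and the final clause records its minimality among the points above
  \<open>u\<close> with at least these coordinates.\<close>

lemma bases_at_coordinates:
  assumes B: "B \<in> bases_at n u" and uy: "u \<le> (y::'a)"
  shows "\<exists>w. B \<in> bases_at n w \<and> u \<le> w \<and> w \<le> y \<and> (\<forall>e\<in>B. busemann e w y = 0) \<and>
    height w = height u + (\<Sum>e\<in>B. busemann e u y) \<and>
    (\<forall>v. u \<le> v \<longrightarrow> (\<forall>e\<in>B. busemann e u y \<le> busemann e u v) \<longrightarrow> w \<le> v)"
proof -
  have E: "e \<in> ends" if "e \<in> B" for e using bases_at_subset_ends[OF B that] .
  have k: "int (ray_steps e u y) = busemann e u y" if "e \<in> B" for e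
    using busemann_of_le[OF E[OF that] uy] by simp
  obtain w where w: "B \<in> bases_at n w" "u \<le> w" "\<forall>e\<in>B. busemann e u w = int (ray_steps e u y)"
    "height w = height u + (\<Sum>e\<in>B. int (ray_steps e u y))"
    "\<forall>v. u \<le> v \<longrightarrow> (\<forall>e\<in>B. end_ray e u (ray_steps e u y) \<le> v) \<longrightarrow> w \<le> v"
    using bases_at_move[OF B, of "\<lambda>e. ray_steps e u y"] by blast
  have "w \<le> y" using w(5) uy le_ray_steps_iff[OF E uy] by blast
  moreover have "busemann e w y = 0" if "e \<in> B" for e
    using busemann_add[OF E[OF that], of u w y] w(3) k that by simp
  moreover have "height w = height u + (\<Sum>e\<in>B. busemann e u y)"
    using w(4) k by simp
  moreover have "w \<le> v" if "u \<le> v" "\<forall>e\<in>B. busemann e u y \<le> busemann e u v" for v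
    using w(5) that end_ray_le_iff[OF E that(1)] k by simp
  ultimately show ?thesis using w(1,2) by blast
qed

lemma bases_at_le:
  assumes B: "B \<in> bases_at n z" "B \<in> bases_at n (w::'a)" and ge: "\<forall>e\<in>B. 0 \<le> busemann e z w"
  shows "z \<le> w"
proof -
  obtain u where u: "B \<in> bases_at n u" "u \<le> inf z w" using bases_at_lower[OF B(1)] by blast
  then have uz: "u \<le> z" and uw: "u \<le> w" by simp_all
  obtain z' where z': "B \<in> bases_at n z'" "z' \<le> z" "\<forall>e\<in>B. busemann e z' z = 0"
    "\<forall>v. u \<le> v \<longrightarrow> (\<forall>e\<in>B. busemann e u z \<le> busemann e u v) \<longrightarrow> z' \<le> v"
    using bases_at_coordinates[OF u(1) uz] by blast
  have "z' = z" using bases_at_eqI[OF z'(1) B(1) z'(2,3)] .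
  moreover have "busemann e u z \<le> busemann e u w" if "e \<in> B" for e
  proof -
    have "0 \<le> busemann e z w" using ge that by blast
    with busemann_add[OF bases_at_subset_ends[OF B(1) that], of u z w] show ?thesis by simp
  qed
  ultimately show ?thesis using z'(4) uw by blast
qed

lemma bases_at_height:
  assumes B: "B \<in> bases_at n z" "B \<in> bases_at n (w::'a)"
  shows "height w - height z = (\<Sum>e\<in>B. busemann e z w)"
proof -
  have h: "height v = height u + (\<Sum>e\<in>B. busemann e u v)"
    if uv: "B \<in> bases_at n u" "B \<in> bases_at n v" "u \<le> v" for u v
  proof -
    obtain v' where "B \<in> bases_at n v'" "v' \<le> v" "\<forall>e\<in>B. busemann e v' v = 0"
      "height v' = height u + (\<Sum>e\<in>B. busemann e u v)"
      using bases_at_coordinates[OF uv(1,3)] by blast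
    with bases_at_eqI[of B v' v] uv show ?thesis by simp
  qed
  obtain u where u: "B \<in> bases_at n u" "u \<le> inf z w" using bases_at_lower[OF B(1)] by blast
  then have "u \<le> z" "u \<le> w" by simp_all
  with h[OF u(1) B(1)] h[OF u(1) B(2)]
  have "height w - height z = (\<Sum>e\<in>B. busemann e u w - busemann e u z)"
    by (simp add: sum_subtractf)
  also have "\<dots> = (\<Sum>e\<in>B. busemann e z w)"
  proof (rule sum.cong[OF refl])
    fix e assume "e \<in> B"
    then show "busemann e u w - busemann e u z = busemann e z w"
      using busemann_add[OF bases_at_subset_ends[OF B(1)], of e u z w] by simp
  qed
  finally show ?thesis .
qed

text \<open>The point with the larger coordinates is the join, by minimality. The point with the
  smaller coordinates is at first only a lower bound of both. As maximum and minimum add up to the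
  sum, submodularity of the height leaves no room between it and the meet.\<close>

lemma bases_at_sup_inf:
  assumes B: "B \<in> bases_at n z" "B \<in> bases_at n (w::'a)"
  shows "B \<in> bases_at n (sup z w)" "B \<in> bases_at n (inf z w)"
proof -
  have E: "e \<in> ends" if "e \<in> B" for e using bases_at_subset_ends[OF B(1) that] .
  obtain u where u: "B \<in> bases_at n u" "u \<le> inf z w" using bases_at_lower[OF B(1)] by blast
  then have uz: "u \<le> z" and uw: "u \<le> w" by simp_all
  let ?k = "\<lambda>e. ray_steps e u z" and ?l = "\<lambda>e. ray_steps e u w"
  obtain v where v: "B \<in> bases_at n v" "\<forall>e\<in>B. busemann e u v = int (max (?k e) (?l e))"
    "height v = height u + (\<Sum>e\<in>B. int (max (?k e) (?l e)))"
    "\<forall>y. u \<le> y \<longrightarrow> (\<forall>e\<in>B. end_ray e u (max (?k e) (?l e)) \<le> y) \<longrightarrow> v \<le> y"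
    using bases_at_move[OF u(1), of "\<lambda>e. max (?k e) (?l e)"] by blast
  obtain v' where v': "B \<in> bases_at n v'" "\<forall>e\<in>B. busemann e u v' = int (min (?k e) (?l e))"
    "height v' = height u + (\<Sum>e\<in>B. int (min (?k e) (?l e)))"
    using bases_at_move[OF u(1), of "\<lambda>e. min (?k e) (?l e)"] by blast
  have "end_ray e u (max (?k e) (?l e)) \<le> sup z w" if "e \<in> B" for e
    using le_ray_steps_iff[OF E[OF that] uz, of "?k e"] le_ray_steps_iff[OF E[OF that] uw, of "?l e"]
    by (auto simp: max_def intro: le_supI1 le_supI2)
  then have "v \<le> sup z w" using v(4) uz by (simp add: le_supI1)
  moreover have "sup z w \<le> v"
  proof (rule le_supI; rule bases_at_le; (fact B v(1))?; rule ballI)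
    fix e assume "e \<in> B"
    then show "0 \<le> busemann e z v" "0 \<le> busemann e w v"
      using busemann_add[OF E, of e u z v] busemann_add[OF E, of e u w v] v(2)
        busemann_of_le[OF E uz, of e] busemann_of_le[OF E uw, of e] by fastforce+
  qed
  ultimately have sup: "v = sup z w" by (rule order.antisym)
  have "v' \<le> inf z w"
  proof (rule le_infI; rule bases_at_le; (fact B v'(1))?; rule ballI)
    fix e assume "e \<in> B"
    then show "0 \<le> busemann e v' z" "0 \<le> busemann e v' w"
      using busemann_add[OF E, of e u v' z] busemann_add[OF E, of e u v' w] v'(2)
        busemann_of_le[OF E uz, of e] busemann_of_le[OF E uw, of e] by fastforce+
  qed
  moreover have "height (inf z w) \<le> height v'"
  proof -
    have "height v + height v' = 2 * height u + (\<Sum>e\<in>B. int (?k e) + int (?l e))"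
    proof -
      have "int (max i j) + int (min i j) = int i + int j" for i j by (simp add: max_def)
      then show ?thesis unfolding v(3) v'(3) by (simp flip: sum.distrib)
    qed
    also have "\<dots> = height z + height w"
      using bases_at_height[OF u(1) B(1)] bases_at_height[OF u(1) B(2)]
        busemann_of_le[OF E uz] busemann_of_le[OF E uw] by (simp add: sum.distrib)
    finally show ?thesis using height_submodular[of z w] sup by simp
  qed
  ultimately have "v' = inf z w" by (rule height_eq_imp_eq)
  with sup v(1) v'(1) show "B \<in> bases_at n (sup z w)" "B \<in> bases_at n (inf z w)" by simp_all
qed

lemma bases_at_end_ray: "B \<in> bases_at n (x::'a) \<Longrightarrow> e \<in> B \<Longrightarrow> B \<in> bases_at n (end_ray e x k)"
proof (induction k)
  case (Suc k)
  have "e \<in> ends" using bases_at_subset_ends[OF Suc.prems] .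
  from end_ray_tail[OF this, of x k] Suc show ?case
    using bases_at_step[of B "end_ray e x k" e] by simp
qed (simp add: bases_at_subset_ends)

section \<open>The generated sublattice as an apartment, and the projection to it\<close>

lemma asc_pow_neg: "asc_pow (- int m) = (dsc ^^ m :: 'a \<Rightarrow> 'a)"
  by (cases "m = 0") (simp_all add: asc_pow_def)

lemma bases_at_asc_pow: "B \<in> bases_at n (asc_pow k (x::'a)) \<longleftrightarrow> B \<in> bases_at n x"
  by (simp add: asc_pow_def bases_at_funpow_asc bases_at_funpow_dsc)

lemma is_sublattice_hull: "is_sublattice (is_sublattice hull (S :: 'a set))"
  by (rule hull_in) (auto simp: is_sublattice_def)

text \<open>An apartment point above the base point is the join of one point on each ray of the
  basis. For \<open>n = 0\<close> there would be no rays to generate from.\<close>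

lemma span_at_ge:
  assumes B: "B \<in> bases_at n x" "B \<in> bases_at n z" and xz: "x \<le> (z::'a)" and n: "n \<noteq> 0"
  shows "z \<in> span_at x B"
proof -
  have E: "e \<in> ends" if "e \<in> B" for e using bases_at_subset_ends[OF B(1) that] .
  let ?S = "span_at x B" and ?r = "\<lambda>e. end_ray e x (ray_steps e x z)"
  have r: "?r e \<in> ?S" if "e \<in> B" for e
    unfolding span_at_def by (rule hull_inc) (use that in blast)
  have sub: "sup a b \<in> ?S" if "a \<in> ?S" "b \<in> ?S" for a b
    using is_sublattice_hull that unfolding span_at_def is_sublattice_def by blast
  have ex: "\<exists>s\<in>?S. \<forall>v. s \<le> v \<longleftrightarrow> (\<forall>e\<in>I. ?r e \<le> v)" if "finite I" "I \<noteq> {}" "I \<subseteq> B" for I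
    using that
  proof (induction rule: finite_ne_induct)
    case (singleton e)
    then show ?case using r[of e] by (intro bexI[of _ "?r e"]) simp_all
  next
    case (insert e I)
    from insert.IH insert.prems obtain s where s: "s \<in> ?S" "\<forall>v. s \<le> v \<longleftrightarrow> (\<forall>e\<in>I. ?r e \<le> v)" by auto
    have "sup (?r e) s \<in> ?S" using r[of e] insert.prems s(1) sub by simp
    moreover have "\<forall>v. sup (?r e) s \<le> v \<longleftrightarrow> (\<forall>f\<in>insert e I. ?r f \<le> v)" using s(2) by simp
    ultimately show ?case by blast
  qed
  have "B \<noteq> {}" "finite B" using B n by (auto simp: bases_at_iff)
  with ex[of B] obtain s where s: "s \<in> ?S" "\<forall>v. s \<le> v \<longleftrightarrow> (\<forall>e\<in>B. ?r e \<le> v)" by blast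
  have "s \<le> z" using s(2) le_ray_steps_iff[OF E xz] by simp
  moreover have "z \<le> s"
  proof -
    obtain w where w: "B \<in> bases_at n w" "w \<le> z" "\<forall>e\<in>B. busemann e w z = 0"
      "\<forall>v. x \<le> v \<longrightarrow> (\<forall>e\<in>B. busemann e x z \<le> busemann e x v) \<longrightarrow> w \<le> v"
      using bases_at_coordinates[OF B(1) xz] by blast
    have rs: "?r e \<le> s" if "e \<in> B" for e using s(2) that by blast
    obtain e where "e \<in> B" using \<open>B \<noteq> {}\<close> by blast
    then have xs: "x \<le> s" using order.trans[OF le_end_ray[OF E] rs] by blast
    have "busemann e x z \<le> busemann e x s" if "e \<in> B" for e
      using rs[OF that] end_ray_le_iff[OF E[OF that] xs] busemann_of_le[OF E[OF that] xz] by simp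
    then have "w \<le> s" using w(4) xs by blast
    with bases_at_eqI[OF w(1) B(2) w(2,3)] show ?thesis by simp
  qed
  ultimately show ?thesis using s(1) by (simp add: order.antisym)
qed

text \<open>Any apartment point is lifted above the base point by a power of \<open>asc\<close>,
  found there by \<open>span_at_ge\<close>, and lowered again. The right-hand side does not mention
  a base point, so the choice made in \<open>span_inf\<close> has no influence.\<close>

lemma span_inf_eq:
  assumes B: "B \<in> bases_inf n" and n: "n \<noteq> 0"
  shows "span_inf n B = {z::'a. B \<in> bases_at n z}"
proof -
  define x :: 'a where "x = (SOME x. B \<in> bases_at n x)"
  have x: "B \<in> bases_at n x"
    using B unfolding x_def by (auto simp: bases_inf_def intro: someI)
  have "span_at x B \<subseteq> {z. B \<in> bases_at n z}"
    unfolding span_at_def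
    by (rule hull_minimal) (use x bases_at_end_ray bases_at_sup_inf in \<open>auto simp: is_sublattice_def\<close>)
  then have "span_inf n B \<subseteq> {z. B \<in> bases_at n z}"
    by (auto simp: span_inf_def bases_at_asc_pow simp flip: x_def)
  moreover have "z \<in> span_inf n B" if z: "B \<in> bases_at n z" for z
  proof -
    obtain m where "(dsc ^^ m) x \<le> z" using exists_funpow_dsc_le by blast
    then have "x \<le> (asc ^^ m) z" by (simp add: funpow_dsc_le_iff)
    then have "(asc ^^ m) z \<in> span_at x B"
      using span_at_ge[OF x _ _ n] z bases_at_funpow_asc by blast
    moreover have "z = asc_pow (- int m) ((asc ^^ m) z)" by (simp add: asc_pow_neg)
    ultimately show ?thesis unfolding span_inf_def x_def by blast
  qed
  ultimately show ?thesis by blast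
qed

text \<open>For \<open>n = 0\<close> heights make \<open>asc\<close> the identity, which excludes
  covers. In this case no ray generates \<open>span_inf\<close>, so \<open>proj\<close> is settled
  by the lattice having a single point.\<close>

lemma rank_0_trivial:
  assumes "n = 0"
  shows "a = (b::'a)"
proof -
  have "a = c" if "a \<le> c" for a c :: 'a
  proof (rule ccontr)
    assume "a \<noteq> c"
    with that have "a < c" by simp
    then obtain z where z: "a \<prec>\<^sub>1 z" using exists_cover_below by blast
    have "asc a = a" using height_eq_imp_eq[OF le_asc, of a] height_asc[of a] assms by simp
    with covers_le_asc[OF z] covers_less[OF z] show False by simp
  qed
  from this[OF sup_ge1] this[OF sup_ge2] show ?thesis by metis
qed

text \<open>The apartment point with the \<open>B\<close>-coordinates of \<open>y\<close> is below
  \<open>y\<close>, and any apartment point below \<open>y\<close> has coordinates at most these. So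
  it is the join in the definition of \<open>proj\<close>.\<close>

lemma proj_properties:
  assumes B: "B \<in> bases_inf n"
  shows proj_bases_at: "B \<in> bases_at n (proj n (y::'a) B)" and proj_le: "proj n y B \<le> y"
    and busemann_proj: "\<And>e. e \<in> B \<Longrightarrow> busemann e (proj n y B) y = 0"
proof -
  obtain x :: 'a where x: "B \<in> bases_at n x" using B by (auto simp: bases_inf_def)
  obtain u where u: "B \<in> bases_at n u" "u \<le> y" using bases_at_lower[OF x] by blast
  obtain p where p: "B \<in> bases_at n p" "p \<le> y" "\<forall>e\<in>B. busemann e p y = 0"
    using bases_at_coordinates[OF u] by blast
  have "proj n y B = p"
  proof (cases "n = 0")
    case False
    have "z \<le> p" if z: "B \<in> bases_at n z" "z \<le> y" for z
    proof (rule bases_at_le[OF z(1) p(1)], rule ballI)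
      fix e assume e: "e \<in> B"
      have "e \<in> ends" using bases_at_subset_ends[OF x e] .
      then show "0 \<le> busemann e z p"
        using busemann_add[of e z p y] p(3) e busemann_nonneg[of e z y] z(2) by simp
    qed
    then show ?thesis
      unfolding proj_def span_inf_eq[OF B False] using p by (intro join_eqI) (auto simp: isLub_UNIV_iff)
  qed (rule rank_0_trivial)
  with p show "B \<in> bases_at n (proj n y B)" "proj n y B \<le> y"
    "\<And>e. e \<in> B \<Longrightarrow> busemann e (proj n y B) y = 0" by simp_all
qed

section \<open>Bounds for the valuation and its change with the base point\<close>

lemma omega_eq: "B \<in> bases_inf n \<Longrightarrow> omega n y B = height (proj n y B) - height (y::'a)"
  using interval_rank[OF proj_le, of B y] by (simp add: omega_def)

lemma omega_le_0: "B \<in> bases_inf n \<Longrightarrow> omega n (y::'a) B \<le> 0"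
  by (simp add: omega_def)

text \<open>The projection is the greatest apartment point below \<open>y\<close>, so any apartment
  point below \<open>y\<close> yields a lower bound for the valuation.\<close>

lemma le_omega:
  assumes "B \<in> bases_at n z" "z \<le> (y::'a)"
  shows "height z - height y \<le> omega n y B"
proof -
  have B: "B \<in> bases_inf n" using assms by (auto simp: bases_inf_def)
  have "z \<le> proj n y B"
  proof (rule bases_at_le[OF assms(1) proj_bases_at[OF B]], rule ballI)
    fix e assume "e \<in> B"
    then show "0 \<le> busemann e z (proj n y B)"
      using busemann_add[of e z "proj n y B" y] busemann_proj[OF B] busemann_nonneg[of e z y] assms
        bases_at_subset_ends[OF assms(1)] by simp
  qed
  then show ?thesis using height_mono omega_eq[OF B, of y] by simp
qed

lemma omega_eq_0_iff:
  assumes B: "B \<in> bases_inf n"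
  shows "omega n y B = 0 \<longleftrightarrow> B \<in> bases_at n (y::'a)"
proof
  assume "omega n y B = 0"
  then have "proj n y B = y" using omega_eq[OF B, of y] height_eq_imp_eq[OF proj_le[OF B]] by simp
  then show "B \<in> bases_at n y" using proj_bases_at[OF B, of y] by simp
next
  assume "B \<in> bases_at n y"
  then show "omega n y B = 0" using le_omega[of B y y] omega_le_0[OF B, of y] by simp
qed

text \<open>The projections of \<open>x\<close> and \<open>y\<close> have the
  \<open>B\<close>-coordinates of \<open>x\<close> and \<open>y\<close>, and inside one apartment
  height differences are sums of coordinate differences.\<close>

lemma omega_shift:
  assumes B: "B \<in> bases_inf n"
  shows "omega n y B = omega n x B + (\<Sum>e\<in>B. busemann e x y) - (height y - height (x::'a))"
proof -
  note p = proj_properties[OF B]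
  have "height (proj n y B) - height (proj n x B) = (\<Sum>e\<in>B. busemann e (proj n x B) (proj n y B))"
    by (rule bases_at_height[OF p(1) p(1)])
  also have "\<dots> = (\<Sum>e\<in>B. busemann e x y)"
  proof (rule sum.cong[OF refl])
    fix e assume e: "e \<in> B"
    then have E: "e \<in> ends" using bases_at_subset_ends[OF p(1)] by blast
    show "busemann e (proj n x B) (proj n y B) = busemann e x y"
      using p(3)[OF e, of x] p(3)[OF e, of y] busemann_add[OF E, of "proj n x B" x y]
        busemann_add[OF E, of "proj n x B" "proj n y B" y] by simp
  qed
  finally show ?thesis using omega_eq[OF B, of y] omega_eq[OF B, of x] by simp
qed

section \<open>The exchange property\<close>

text \<open>A smallest \<open>I\<close> in \<open>B\<close> whose join dominates the atom of
  \<open>e\<close> plays the role of a circuit with \<open>e\<close> removed. For \<open>f\<close>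
  in \<open>I\<close>, replacing \<open>f\<close> by \<open>e\<close> leaves the join of
  \<open>I\<close> unchanged: it is not larger, and dropping \<open>f\<close> costs at most the one
  level that \<open>e\<close> regains.\<close>

lemma basis_swap:
  assumes B: "B \<in> bases_at n (z::'a)" and e: "e \<in> ends" "e \<notin> B"
  obtains f where "f \<in> B" "insert e (B - {f}) \<in> bases_at n z"
proof -
  have b: "B \<subseteq> ends" "finite B" "card B = n" "atom_join z B = asc z"
    using B by (auto simp: bases_at_iff)
  let ?P = "\<lambda>I. I \<subseteq> B \<and> end_ray e z 1 \<le> atom_join z I"
  have "?P B" using b(4) covers_le_asc[OF covers_end_ray[OF e(1)], of z] by simp
  then obtain I where I: "?P I" and least: "\<And>J. ?P J \<Longrightarrow> card I \<le> card J"
    using ex_has_least_nat[of ?P B card] by blast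
  have finI: "finite I" using I b(2) finite_subset by blast
  have "\<not> end_ray e z 1 \<le> atom_join z {}"
    using covers_less[OF covers_end_ray[OF e(1)], of z] by auto
  with I have "I \<noteq> {}" by metis
  then obtain f where f: "f \<in> I" by blast
  let ?J = "I - {f}"
  have "\<not> ?P ?J" using least[of ?J] f finI card_Diff1_less[of I f] by auto
  then have notle: "\<not> end_ray e z 1 \<le> atom_join z ?J" using I by blast
  have ins: "atom_join z (insert e ?J) \<le> atom_join z I"
    using I atom_join_mono[OF finI, of ?J z] finI by (simp add: atom_join_insert)
  have "height (atom_join z I) \<le> height (atom_join z ?J) + 1"
    using height_atom_join_union_le[of ?J "{f}" z] finI f I b(1) by (auto simp: insert_absorb)
  then have "atom_join z (insert e ?J) = atom_join z I"
    using height_eq_imp_eq[OF ins] height_covers[OF covers_atom_join_insert[OF _ e(1) notle]] finI by simp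
  then have "end_ray f z 1 \<le> atom_join z (insert e ?J)" using atom_join_upper[OF finI f] by simp
  also have "\<dots> \<le> atom_join z (insert e (B - {f}))" using I b(2) by (intro atom_join_mono) auto
  finally have fle: "end_ray f z 1 \<le> atom_join z (insert e (B - {f}))" .
  have fin: "finite (insert e (B - {f}))" using b(2) by simp
  have "asc z \<le> atom_join z (insert e (B - {f}))"
    unfolding b(4)[symmetric] using fle atom_join_upper[OF fin, of _ z] le_atom_join[OF fin, of z]
    by (auto simp: atom_join_le_iff b(2))
  moreover have "atom_join z (insert e (B - {f})) \<le> asc z"
    by (rule atom_join_le_asc) (use b e in auto)
  moreover have fB: "f \<in> B" using f I by blast
  moreover have "card (insert e (B - {f})) = n"
    using b(2,3) e(2) fB card_Suc_Diff1[of B f] by simp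
  ultimately show thesis using that b e by (simp add: bases_at_iff order.antisym subset_iff)
qed

text \<open>The swap is made at the projection of \<open>y\<close> to the apartment of
  \<open>B\<close>. This point then also belongs to the apartment of the new basis, so
  \<open>le_omega\<close> applies.\<close>

lemma bases_inf_swap:
  assumes B: "B \<in> bases_inf n" and e: "e \<in> ends" "e \<notin> B"
  obtains f where "f \<in> B" "insert e (B - {f}) \<in> bases_inf n"
    "omega n (y::'a) B \<le> omega n y (insert e (B - {f}))"
proof -
  obtain f where f: "f \<in> B" "insert e (B - {f}) \<in> bases_at n (proj n y B)"
    using basis_swap[OF proj_bases_at[OF B] e] by blast
  from le_omega[OF f(2) proj_le[OF B]] omega_eq[OF B, of y] f show thesis
    using that by (auto simp: bases_inf_def)
qed

lemma bases_at_atom_join: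
  assumes B: "B \<in> bases_at n (y::'a)" and A: "A \<subseteq> B"
  shows "B \<in> bases_at n (atom_join y A)"
    and "\<And>e. e \<in> B \<Longrightarrow> busemann e y (atom_join y A) = (if e \<in> A then 1 else 0)"
proof -
  have E: "e \<in> ends" if "e \<in> B" for e using bases_at_subset_ends[OF B that] .
  have fin: "finite A" using A bases_at_finite[OF B] finite_subset by blast
  let ?k = "\<lambda>e. if e \<in> A then 1 else 0 :: nat"
  obtain w where w: "B \<in> bases_at n w" "y \<le> w" "\<forall>e\<in>B. busemann e y w = int (?k e)"
    "\<forall>v. y \<le> v \<longrightarrow> (\<forall>e\<in>B. end_ray e y (?k e) \<le> v) \<longrightarrow> w \<le> v"
    using bases_at_move[OF B, of ?k] by blast
  have "end_ray e y (?k e) \<le> atom_join y A" if "e \<in> B" for e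
    using atom_join_upper[OF fin, of e y] le_atom_join[OF fin, of y] E[OF that] by simp
  then have "w \<le> atom_join y A" using w(4) le_atom_join[OF fin] by blast
  moreover have "atom_join y A \<le> w"
    using w(2,3) A E end_ray_le_iff[OF _ w(2), of _ 1] by (auto simp: atom_join_le_iff fin)
  ultimately have "w = atom_join y A" by (rule order.antisym)
  with w show "B \<in> bases_at n (atom_join y A)"
    "\<And>e. e \<in> B \<Longrightarrow> busemann e y (atom_join y A) = (if e \<in> A then 1 else 0)" by auto
qed

text \<open>If \<open>f\<close> does not complete \<open>B - {e}\<close> to a basis at
  \<open>y\<close>, its atom lies in the hyperplane spanned by \<open>B - {e}\<close>. Moving to the
  join of that hyperplane therefore advances along \<open>f\<close> as well.\<close>

lemma busemann_atom_join_ge: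
  assumes B: "B \<in> bases_at n (y::'a)" and e: "e \<in> B" and f: "f \<in> ends"
    and not_basis: "insert f (B - {e}) \<notin> bases_at n y"
  shows "1 \<le> busemann f y (atom_join y (B - {e}))"
proof -
  let ?A = "B - {e}"
  have fin: "finite B" "finite ?A" using bases_at_finite[OF B] by simp_all
  have "end_ray f y 1 \<le> atom_join y ?A"
  proof (rule ccontr)
    assume "\<not> ?thesis"
    moreover from this have "f \<notin> ?A" using atom_join_upper[OF fin(2)] by blast
    ultimately have "independent_at y (insert f ?A)" "card (insert f ?A) = n"
      using independent_at_insert[OF bases_at_independent[OF B] f, of ?A] B e fin
        card_Suc_Diff1[of B e] by (auto simp: bases_at_iff)
    with not_basis show False by (simp add: bases_at_def)
  qed
  then show ?thesis using end_ray_le_iff[OF f le_atom_join[OF fin(2)], of y 1] by simp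
qed

text \<open>The exchange property at \<open>e \<in> B - B'\<close> is read off from \<open>bases_inf_swap\<close> for \<open>B'\<close> at a point
  of the apartment of \<open>B\<close> which is far away in all directions of \<open>B - {e}\<close>: there the exchanged
  end \<open>f\<close> is forced to complete \<open>B - {e}\<close> to a basis.\<close>

theorem omega_exchange:
  fixes x :: 'a
  assumes B: "B \<in> bases_inf n" and B': "B' \<in> bases_inf n" and e: "e \<in> B - B'"
  shows "\<exists>f\<in>B' - B. insert f (B - {e}) \<in> bases_inf n \<and> insert e (B' - {f}) \<in> bases_inf n \<and>
    omega n x B + omega n x B' \<le> omega n x (insert f (B - {e})) + omega n x (insert e (B' - {f}))"
proof -
  obtain y0 :: 'a where y0: "B \<in> bases_at n y0" using B by (auto simp: bases_inf_def)
  obtain y0' :: 'a where y0': "B' \<in> bases_at n y0'" using B' by (auto simp: bases_inf_def)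
  let ?A = "B - {e}"
  \<comment> \<open>The walk takes one step along every ray of \<open>B - {e}\<close> at a time. It
    stays in the apartment of \<open>B\<close> and does not change the
    \<open>e\<close>-coordinate.\<close>
  define Y where "Y N = ((\<lambda>y. atom_join y ?A) ^^ N) y0" for N
  have Y0: "Y 0 = y0" and YS: "Y (Suc N) = atom_join (Y N) ?A" for N by (simp_all add: Y_def)
  have finB: "finite B" "finite B'" "card B = n" using y0 y0' by (auto simp: bases_at_iff)
  have E: "f \<in> ends" if "f \<in> B \<union> B'" for f
    using that bases_at_subset_ends[OF y0] bases_at_subset_ends[OF y0'] by blast
  have eB: "e \<in> B" "e \<notin> B'" "e \<in> ends" using e E by auto
  have BY: "B \<in> bases_at n (Y N)" for N
    by (induction N) (simp_all add: Y0 YS y0 bases_at_atom_join(1))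
  have be: "busemann e y0 (Y N) = 0" for N
  proof (induction N)
    case (Suc N)
    have "busemann e (Y N) (Y (Suc N)) = 0" using bases_at_atom_join(2)[OF BY, of ?A e] eB by (simp add: YS)
    with Suc show ?case using busemann_add[OF eB(3), of y0 "Y N" "Y (Suc N)"] by simp
  qed (simp add: Y0 eB)
  have stay: "insert f ?A \<in> bases_at n (Y M)" if "insert f ?A \<in> bases_at n (Y N)" "N \<le> M" for f N M
    using that(2,1) by (induction rule: dec_induct) (simp_all add: YS bases_at_atom_join(1) subset_insertI)
  have far: "int N \<le> busemann f y0 (Y N)"
    if "f \<in> ends" "\<forall>N. insert f ?A \<notin> bases_at n (Y N)" for f N
  proof (induction N)
    case (Suc N)
    have "1 \<le> busemann f (Y N) (Y (Suc N))"
      using busemann_atom_join_ge[OF BY eB(1) that(1)] that(2) by (simp add: YS)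
    with Suc show ?case using busemann_add[OF that(1), of y0 "Y N" "Y (Suc N)"] by simp
  qed (simp add: Y0 that)
  \<comment> \<open>By \<open>omega_shift\<close>, replacing \<open>f\<close> by \<open>e\<close> in
    \<open>B'\<close> can avoid lowering the valuation at \<open>Y N\<close> only if the
    \<open>f\<close>-coordinate gained since \<open>y0\<close> is at most \<open>K f\<close>. This
    bound is the same for all \<open>N\<close>, and there are finitely many \<open>f\<close> in
    \<open>B'\<close>.\<close>
  define K where "K f = omega n x (insert e (B' - {f})) - omega n x B' + busemann e x y0 - busemann f x y0" for f
  have "\<forall>\<^sub>F N in sequentially. \<forall>f\<in>B'. insert f ?A \<in> bases_at n (Y N) \<or> K f < busemann f y0 (Y N)"
  proof (rule eventually_ball_finite[OF finB(2)], rule ballI)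
    fix f assume f: "f \<in> B'"
    show "\<forall>\<^sub>F N in sequentially. insert f ?A \<in> bases_at n (Y N) \<or> K f < busemann f y0 (Y N)"
    proof (cases "\<exists>N. insert f ?A \<in> bases_at n (Y N)")
      case True
      then obtain N where N: "insert f ?A \<in> bases_at n (Y N)" ..
      show ?thesis
        using eventually_ge_at_top[of N] by eventually_elim (use stay[OF N] in blast)
    next
      case False
      show ?thesis
        using eventually_ge_at_top[of "nat (K f + 1)"]
      proof eventually_elim
        case (elim N)
        then have "K f < int N" by linarith
        also have "int N \<le> busemann f y0 (Y N)" using far[of f N] f E False by blast
        finally show ?case ..
      qed
    qed
  qed
  then obtain N where N: "\<And>f. f \<in> B' \<Longrightarrow> insert f ?A \<in> bases_at n (Y N) \<or> K f < busemann f y0 (Y N)"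
    by (auto simp: eventually_sequentially)
  let ?y = "Y N"
  obtain f where f: "f \<in> B'" "insert e (B' - {f}) \<in> bases_inf n"
    "omega n ?y B' \<le> omega n ?y (insert e (B' - {f}))"
    using bases_inf_swap[OF B' eB(3,2)] by blast
  have swap_sum: "(\<Sum>g\<in>insert e (B' - {f}). busemann g x ?y) =
      (\<Sum>g\<in>B'. busemann g x ?y) - busemann f x ?y + busemann e x ?y"
    using finB(2) f(1) eB(2) sum.remove[OF finB(2) f(1), of "\<lambda>g. busemann g x ?y"] by simp
  have bex: "busemann e x ?y = busemann e x y0"
    using busemann_add[OF eB(3), of x y0 ?y] be by simp
  have bfx: "busemann f x ?y = busemann f x y0 + busemann f y0 ?y"
    using busemann_add[of f x y0 ?y] E f(1) by simp
  have le: "omega n x B' + busemann f x ?y \<le> omega n x (insert e (B' - {f})) + busemann e x ?y"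
    using f(3) omega_shift[OF B', of ?y x] omega_shift[OF f(2), of ?y x] swap_sum by simp
  then have "busemann f y0 ?y \<le> K f" using bex bfx by (simp add: K_def)
  with N[OF f(1)] have fA: "insert f ?A \<in> bases_at n ?y" by auto
  then have fA': "insert f ?A \<in> bases_inf n" by (auto simp: bases_inf_def)
  have "f \<notin> B"
  proof
    assume "f \<in> B"
    then have "insert f ?A = ?A" using f(1) eB(2) by auto
    then have "card ?A = card B" using fA finB(3) by (simp add: bases_at_iff)
    then show False using card_Diff1_less[OF finB(1) eB(1)] by simp
  qed
  \<comment> \<open>At \<open>?y\<close> both sets are bases, hence both valuations vanish there.
    Shifting back to \<open>x\<close> gives an equality whose coordinate terms cancel those of
    \<open>le\<close>.\<close>
  moreover have "omega n x (insert f ?A) + busemann f x ?y = omega n x B + busemann e x ?y"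
  proof -
    have "(\<Sum>g\<in>insert f ?A. busemann g x ?y) = (\<Sum>g\<in>B. busemann g x ?y) - busemann e x ?y + busemann f x ?y"
      using finB(1) \<open>f \<notin> B\<close> sum.remove[OF finB(1) eB(1), of "\<lambda>g. busemann g x ?y"] by simp
    then show ?thesis
      using omega_shift[OF fA', of ?y x] omega_shift[OF B, of ?y x]
        omega_eq_0_iff[OF fA', of ?y] omega_eq_0_iff[OF B, of ?y] fA BY by simp
  qed
  ultimately show ?thesis using f fA' le by (intro bexI[of _ f]) auto
qed

end

section \<open>Tight spans and tropical linear spaces of valuated matroids\<close>

locale valuated =
  fixes E :: "'e set" and \<B> :: "'e set set" and n :: nat and \<omega> :: "'e set \<Rightarrow> real"
  assumes valuated: "valuated_matroid E \<B> n \<omega>"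
begin

lemma base_subset: "B \<in> \<B> \<Longrightarrow> e \<in> B \<Longrightarrow> e \<in> E"
  using valuated by (auto simp: valuated_matroid_def matroid_bases_def)

lemma base_finite: "B \<in> \<B> \<Longrightarrow> finite B"
  using valuated by (auto simp: valuated_matroid_def matroid_bases_def)

lemma base_card: "B \<in> \<B> \<Longrightarrow> card B = n"
  using valuated by (auto simp: valuated_matroid_def matroid_bases_def)

lemma sum_swap:
  fixes q :: "'e \<Rightarrow> real"
  assumes "B \<in> \<B>" "g \<in> B" "f \<notin> B"
  shows "(\<Sum>h\<in>insert f (B - {g}). q h) = (\<Sum>h\<in>B. q h) - q g + q f"
  using assms base_finite[OF assms(1)] sum.remove[of B g q] by simp

lemma perturbed_swap:
  assumes "B \<in> \<B>" "g \<in> B" "f \<notin> B"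
  shows "perturbed \<omega> q (insert f (B - {g})) =
    perturbed \<omega> q B + \<omega> (insert f (B - {g})) - \<omega> B - q g + q f"
  using sum_swap[OF assms] by (simp add: perturbed_def)

text \<open>An exchange only moves two elements between the bases, so a linear perturbation adds the
  same amount to both sides.\<close>

lemma perturbed_exchange:
  assumes "B \<in> \<B>" "B' \<in> \<B>" "f \<in> B - B'"
  obtains g where "g \<in> B' - B" "insert g (B - {f}) \<in> \<B>" "insert f (B' - {g}) \<in> \<B>"
    "perturbed \<omega> q B + perturbed \<omega> q B' \<le>
      perturbed \<omega> q (insert g (B - {f})) + perturbed \<omega> q (insert f (B' - {g}))"
proof -
  obtain g where g: "g \<in> B' - B" "insert g (B - {f}) \<in> \<B>" "insert f (B' - {g}) \<in> \<B>"
    "\<omega> B + \<omega> B' \<le> \<omega> (insert g (B - {f})) + \<omega> (insert f (B' - {g}))"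
    using valuated assms unfolding valuated_matroid_def by meson
  show thesis
    by (rule that[OF g(1-3)])
      (use g assms perturbed_swap[of B f g q] perturbed_swap[of B' g f q] in simp)
qed

section \<open>Maximizers and points of the tropical linear space\<close>

lemma maximizersD: "B \<in> maximizers \<B> (perturbed \<omega> q) \<Longrightarrow> B \<in> \<B>"
  by (simp add: maximizers_def)

lemma maximizers_le:
  "B \<in> maximizers \<B> (perturbed \<omega> q) \<Longrightarrow> B' \<in> \<B> \<Longrightarrow> perturbed \<omega> q B' \<le> perturbed \<omega> q B"
  by (simp add: maximizers_def)

text \<open>The exchange inequality is spent on two maximizers: the set obtained from
  \<open>B'\<close> cannot exceed the maximum, so the set obtained from \<open>B\<close> must reach
  it.\<close>

lemma maximizers_swap:
  assumes B: "B \<in> maximizers \<B> (perturbed \<omega> q)" and B': "B' \<in> maximizers \<B> (perturbed \<omega> q)"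
    and f: "f \<in> B' - B"
  obtains g where "g \<in> B - B'" "insert f (B - {g}) \<in> maximizers \<B> (perturbed \<omega> q)"
proof -
  obtain g where g: "g \<in> B - B'" "insert g (B' - {f}) \<in> \<B>" "insert f (B - {g}) \<in> \<B>"
    "perturbed \<omega> q B' + perturbed \<omega> q B \<le>
      perturbed \<omega> q (insert g (B' - {f})) + perturbed \<omega> q (insert f (B - {g}))"
    using perturbed_exchange[OF maximizersD[OF B'] maximizersD[OF B] f] by blast
  have "perturbed \<omega> q B \<le> perturbed \<omega> q (insert f (B - {g}))"
    using g(4) maximizers_le[OF B' g(2)] by simp
  then have "insert f (B - {g}) \<in> maximizers \<B> (perturbed \<omega> q)"
    using g(3) maximizers_le[OF B] unfolding maximizers_def by fastforce
  with g(1) show thesis by (rule that)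
qed

text \<open>Outside an optimal basis, \<open>q f\<close> is the minimum of these right-hand sides
  over the admissible swaps. This is the bound, and \<open>tropical_eq\<close> says that it is
  attained.\<close>

lemma tropical_le:
  assumes B: "B \<in> maximizers \<B> (perturbed \<omega> q)" and f: "f \<notin> B"
    and g: "g \<in> B" "insert f (B - {g}) \<in> \<B>"
  shows "q f \<le> \<omega> B - \<omega> (insert f (B - {g})) + q g"
  using maximizers_le[OF B g(2)] perturbed_swap[OF maximizersD[OF B] g(1) f, of q] by simp

lemma tropical_eq:
  assumes q: "q \<in> tropical_linear_space E \<B> \<omega>" and B: "B \<in> maximizers \<B> (perturbed \<omega> q)"
    and f: "f \<in> E - B"
  obtains g where "g \<in> B" "insert f (B - {g}) \<in> \<B>" "q f = \<omega> B - \<omega> (insert f (B - {g})) + q g"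
proof -
  obtain B' where "B' \<in> maximizers \<B> (perturbed \<omega> q)" "f \<in> B'"
    using q f by (auto simp: tropical_linear_space_def)
  then obtain g where g: "g \<in> B" "insert f (B - {g}) \<in> maximizers \<B> (perturbed \<omega> q)"
    using maximizers_swap[OF B] f by blast
  note g' = maximizersD[OF g(2)]
  have "perturbed \<omega> q (insert f (B - {g})) = perturbed \<omega> q B"
    using maximizers_le[OF B g'] maximizers_le[OF g(2) maximizersD[OF B]] by simp
  then have "q f = \<omega> B - \<omega> (insert f (B - {g})) + q g"
    using perturbed_swap[OF maximizersD[OF B] g(1), of f q] f by simp
  with g(1) g' show thesis by (rule that)
qed

text \<open>Off \<open>B\<close> both \<open>q\<close> and \<open>r\<close> are the same minimum of
  integer shifts of their values on \<open>B\<close>. Taking the floor of a translate is monotone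
  and commutes with integer shifts, so it commutes with such minima. Here \<open>g\<close> attains
  the minimum for \<open>q\<close>, and \<open>h\<close> the one for \<open>r\<close>.\<close>

lemma tropical_floor:
  assumes int: "\<And>B. B \<in> \<B> \<Longrightarrow> \<omega> B \<in> \<int>"
    and q: "q \<in> tropical_linear_space E \<B> \<omega>" "B \<in> maximizers \<B> (perturbed \<omega> q)"
    and r: "r \<in> tropical_linear_space E \<B> \<omega>" "B \<in> maximizers \<B> (perturbed \<omega> r)"
    and B: "\<And>g. g \<in> B \<Longrightarrow> r g = of_int \<lfloor>q g + t\<rfloor>" and f: "f \<in> E"
  shows "r f = of_int \<lfloor>q f + t\<rfloor>"
proof (cases "f \<in> B")
  case False
  with f have f: "f \<in> E - B" "f \<notin> B" by simp_all
  note BB = maximizersD[OF q(2)]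
  have diff: "\<exists>k. \<omega> B - \<omega> (insert f (B - {g})) = of_int k" if "insert f (B - {g}) \<in> \<B>" for g
    using Ints_diff[OF int[OF BB] int[OF that]] by (auto elim: Ints_cases)
  obtain g where g: "g \<in> B" "insert f (B - {g}) \<in> \<B>" "q f = \<omega> B - \<omega> (insert f (B - {g})) + q g"
    using tropical_eq[OF q f(1)] .
  obtain h where h: "h \<in> B" "insert f (B - {h}) \<in> \<B>" "r f = \<omega> B - \<omega> (insert f (B - {h})) + r h"
    using tropical_eq[OF r f(1)] .
  obtain k l where k: "\<omega> B - \<omega> (insert f (B - {g})) = of_int k"
    and l: "\<omega> B - \<omega> (insert f (B - {h})) = of_int l"
    using diff g(2) h(2) by meson
  have "\<lfloor>q f + t\<rfloor> = k + \<lfloor>q g + t\<rfloor>"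
    using g(3) k by (simp add: add.assoc)
  moreover have "r f \<le> of_int (k + \<lfloor>q g + t\<rfloor>)"
    using tropical_le[OF r(2) f(2) g(1,2)] k B[OF g(1)] by simp
  moreover have "\<lfloor>q f + t\<rfloor> \<le> l + \<lfloor>q h + t\<rfloor>"
  proof -
    have "q f + t \<le> of_int l + (q h + t)"
      using tropical_le[OF q(2) f(2) h(1,2)] l by simp
    then have "\<lfloor>q f + t\<rfloor> \<le> \<lfloor>of_int l + (q h + t)\<rfloor>" by (rule floor_mono)
    then show ?thesis by (simp only: floor_add_int int_add_floor)
  qed
  moreover have "r f = of_int (l + \<lfloor>q h + t\<rfloor>)" using h(3) l B[OF h(1)] by simp
  ultimately show ?thesis by simp
qed (use B in simp)

section \<open>The tight span and its distances\<close>

lemma perturbed_minus: "perturbed \<omega> (\<lambda>e. - p e) B = \<omega> B - (\<Sum>e\<in>B. p e)"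
  by (simp add: perturbed_def sum_negf)

text \<open>Moving \<open>p e\<close> to the other side of the defining equation shows what the
  tight span is: the negative of \<open>p\<close> behaves like a tropical point normalised to
  maximum 0, with every element in an optimal basis.\<close>

lemma tight_span_le:
  assumes p: "p \<in> tight_span E \<B> \<omega>" and B: "B \<in> \<B>" "e \<in> B"
  shows "perturbed \<omega> (\<lambda>e. - p e) B \<le> 0"
proof -
  have "is_maximum {\<omega> B - (\<Sum>f\<in>B - {e}. p f) |B. B \<in> \<B> \<and> e \<in> B} (p e)"
    using p base_subset[OF B] by (simp add: tight_span_def)
  then have "\<omega> B - (\<Sum>f\<in>B - {e}. p f) \<le> p e" using B by (auto simp: is_maximum_def)
  then show ?thesis
    using sum.remove[OF base_finite[OF B(1)] B(2), of p] by (simp add: perturbed_minus)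
qed

lemma tight_span_attained:
  assumes p: "p \<in> tight_span E \<B> \<omega>" and e: "e \<in> E"
  obtains B where "B \<in> \<B>" "e \<in> B" "perturbed \<omega> (\<lambda>e. - p e) B = 0"
proof -
  have "is_maximum {\<omega> B - (\<Sum>f\<in>B - {e}. p f) |B. B \<in> \<B> \<and> e \<in> B} (p e)"
    using p e by (simp add: tight_span_def)
  then obtain B where B: "B \<in> \<B>" "e \<in> B" "p e = \<omega> B - (\<Sum>f\<in>B - {e}. p f)"
    by (auto simp: is_maximum_def)
  then have "perturbed \<omega> (\<lambda>e. - p e) B = 0"
    using sum.remove[OF base_finite[OF B(1)] B(2), of p] by (simp add: perturbed_minus)
  with B(1,2) show thesis by (rule that)
qed

text \<open>The set obtained from \<open>B'\<close> has value at most 0, which is the value of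
  \<open>B\<close>. So any basis containing \<open>f\<close> is dominated by a swap of the fixed
  basis \<open>B\<close>, and there are only finitely many of these.\<close>

lemma tight_span_swap:
  assumes p: "p \<in> tight_span E \<B> \<omega>" and B: "B \<in> \<B>" "perturbed \<omega> (\<lambda>e. - p e) B = 0"
    and B': "B' \<in> \<B>" and f: "f \<in> B' - B"
  obtains g where "g \<in> B - B'" "insert f (B - {g}) \<in> \<B>"
    "perturbed \<omega> (\<lambda>e. - p e) B' \<le> perturbed \<omega> (\<lambda>e. - p e) (insert f (B - {g}))"
proof -
  obtain g where g: "g \<in> B - B'" "insert g (B' - {f}) \<in> \<B>" "insert f (B - {g}) \<in> \<B>"
    "perturbed \<omega> (\<lambda>e. - p e) B' + perturbed \<omega> (\<lambda>e. - p e) B \<le>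
      perturbed \<omega> (\<lambda>e. - p e) (insert g (B' - {f})) + perturbed \<omega> (\<lambda>e. - p e) (insert f (B - {g}))"
    using perturbed_exchange[OF B' B(1) f] by blast
  have "perturbed \<omega> (\<lambda>e. - p e) (insert g (B' - {f})) \<le> 0" using tight_span_le[OF p g(2)] by blast
  with g B(2) show thesis using that by simp
qed

text \<open>The ground set may be infinite, so a bound has to come from one basis \<open>B\<close>
  optimal for \<open>q\<close>. Every other element enters by a swap of \<open>B\<close> that is
  optimal for \<open>q\<close> and has value at most 0 for \<open>p\<close>; this bounds the
  difference there by the differences on \<open>B\<close>.\<close>

lemma tight_span_diff_bounded_above:
  assumes p: "p \<in> tight_span E \<B> \<omega>" and q: "q \<in> tight_span E \<B> \<omega>"
  shows "\<exists>c. \<forall>e\<in>E. q e - p e \<le> c"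
proof (cases "E = {}")
  case False
  then obtain e0 where "e0 \<in> E" by blast
  then obtain B where B: "B \<in> \<B>" "perturbed \<omega> (\<lambda>e. - q e) B = 0"
    using tight_span_attained[OF q] by blast
  let ?c = "\<Sum>g\<in>B. \<bar>q g - p g\<bar>"
  note fin = base_finite[OF B(1)]
  have "q e - p e \<le> ?c" if e: "e \<in> E" for e
  proof (cases "e \<in> B")
    case True
    then have "\<bar>q e - p e\<bar> \<le> ?c" using fin by (intro member_le_sum) simp_all
    then show ?thesis by simp
  next
    case False
    obtain B' where B': "B' \<in> \<B>" "e \<in> B'" "perturbed \<omega> (\<lambda>e. - q e) B' = 0"
      using tight_span_attained[OF q e] .
    obtain g where g: "g \<in> B" "insert e (B - {g}) \<in> \<B>"
      "0 \<le> perturbed \<omega> (\<lambda>e. - q e) (insert e (B - {g}))"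
      using tight_span_swap[OF q B B'(1), of e] B' False by auto
    have "perturbed \<omega> (\<lambda>e. - p e) (insert e (B - {g})) \<le> 0" using tight_span_le[OF p g(2)] by blast
    with g(3) have "(\<Sum>h\<in>insert e (B - {g}). q h) \<le> (\<Sum>h\<in>insert e (B - {g}). p h)"
      by (simp add: perturbed_minus)
    then have "q e - p e \<le> (\<Sum>h\<in>B - {g}. p h) - (\<Sum>h\<in>B - {g}. q h)"
      using fin False by simp
    also have "\<dots> = (\<Sum>h\<in>B - {g}. p h - q h)" by (simp add: sum_subtractf)
    also have "\<dots> \<le> (\<Sum>h\<in>B - {g}. \<bar>q h - p h\<bar>)" by (rule sum_mono) simp
    also have "\<dots> \<le> ?c" using fin by (intro sum_mono2) auto
    finally show ?thesis .
  qed
  then show ?thesis by blast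
qed simp

definition pair_max :: "('e \<Rightarrow> real) \<Rightarrow> 'e \<Rightarrow> 'e \<Rightarrow> real" where
  "pair_max p e f = (THE m. is_maximum {\<omega> B - (\<Sum>g\<in>B. p g) |B. B \<in> \<B> \<and> {e, f} \<subseteq> B} m)"

lemma tight_dist_eq: "tight_dist \<B> \<omega> p e f = (if e = f then 0 else exp (pair_max p e f))"
  by (simp add: tight_dist_def pair_max_def)

lemma pair_max_commute: "pair_max p e f = pair_max p f e"
  by (simp add: pair_max_def insert_commute)

end

locale simple_valuated = valuated E \<B> n \<omega>
  for E :: "'e set" and \<B> :: "'e set set" and n :: nat and \<omega> :: "'e set \<Rightarrow> real" +
  assumes simple: "simple_matroid E \<B>"
begin

text \<open>Infinitely many bases may contain \<open>e\<close> and \<open>f\<close>. Fix an optimal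
  basis \<open>B\<close> through \<open>e\<close>. If \<open>f\<close> is in \<open>B\<close>, the
  maximum is 0; otherwise \<open>tight_span_swap\<close> reduces the competitors to finitely many
  swaps.\<close>

lemma pair_max_is_maximum:
  assumes p: "p \<in> tight_span E \<B> \<omega>" and ef: "e \<in> E" "f \<in> E" "e \<noteq> f"
  shows "is_maximum {\<omega> B - (\<Sum>g\<in>B. p g) |B. B \<in> \<B> \<and> {e, f} \<subseteq> B} (pair_max p e f)"
proof -
  let ?w = "perturbed \<omega> (\<lambda>e. - p e)"
  let ?A = "{\<omega> B - (\<Sum>g\<in>B. p g) |B. B \<in> \<B> \<and> {e, f} \<subseteq> B}"
  have "\<exists>m. is_maximum ?A m"
  proof -
    obtain B where B: "B \<in> \<B>" "e \<in> B" "?w B = 0" using tight_span_attained[OF p ef(1)] .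
    \<comment> \<open>The swap must not remove \<open>e\<close>. This is automatic for swaps
      obtained from a competitor, since the removed element lies outside it and the competitor
      contains \<open>e\<close>.\<close>
    let ?I = "{g \<in> B - {e}. insert f (B - {g}) \<in> \<B>}"
    show ?thesis
    proof (cases "f \<in> B")
      case True
      have "is_maximum ?A 0"
        unfolding is_maximum_def
      proof
        show "0 \<in> ?A" using B True by (auto simp: perturbed_minus intro!: exI[of _ B])
        show "\<forall>a\<in>?A. a \<le> 0" using tight_span_le[OF p] by (auto simp: perturbed_minus)
      qed
      then show ?thesis ..
    next
      case False
      have swap: "\<exists>g\<in>?I. ?w B' \<le> ?w (insert f (B - {g}))" if B': "B' \<in> \<B>" "{e, f} \<subseteq> B'" for B'
      proof -
        obtain g where "g \<in> B - B'" "insert f (B - {g}) \<in> \<B>" "?w B' \<le> ?w (insert f (B - {g}))"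
          using tight_span_swap[OF p B(1,3) B'(1), of f] B'(2) False by auto
        with B'(2) show ?thesis by (intro bexI[of _ g]) auto
      qed
      let ?S = "(\<lambda>g. ?w (insert f (B - {g}))) ` ?I"
      obtain B0 where "B0 \<in> \<B>" "{e, f} \<subseteq> B0"
        using simple ef unfolding simple_matroid_def matroid_indep_def by blast
      with swap have "?S \<noteq> {}" by blast
      moreover have fin: "finite ?S" using base_finite[OF B(1)] by simp
      ultimately have "Max ?S \<in> ?S" by (intro Max_in)
      then obtain g where g: "Max ?S = ?w (insert f (B - {g}))" "g \<in> ?I" by (rule imageE)
      have "is_maximum ?A (Max ?S)"
        unfolding is_maximum_def
      proof
        have "insert f (B - {g}) \<in> \<B>" "{e, f} \<subseteq> insert f (B - {g})" using g(2) B(2) by auto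
        moreover have "Max ?S = \<omega> (insert f (B - {g})) - sum p (insert f (B - {g}))"
          using g(1) by (simp only: perturbed_minus)
        ultimately show "Max ?S \<in> ?A" by (intro CollectI exI conjI)
        show "\<forall>a\<in>?A. a \<le> Max ?S"
        proof
          fix a assume "a \<in> ?A"
          then obtain B' where B': "B' \<in> \<B>" "{e, f} \<subseteq> B'" "a = ?w B'" by (auto simp: perturbed_minus)
          obtain h where h: "h \<in> ?I" "?w B' \<le> ?w (insert f (B - {h}))" using swap[OF B'(1,2)] by blast
          have "?w (insert f (B - {h})) \<le> Max ?S" by (rule Max_ge[OF fin]) (use h(1) in blast)
          with h(2) B'(3) show "a \<le> Max ?S" by simp
        qed
      qed
      then show ?thesis ..
    qed
  qed
  then obtain m where m: "is_maximum ?A m" ..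
  show ?thesis
    unfolding pair_max_def
  proof (rule theI[where P = "is_maximum ?A" and a = m, OF m])
    fix m' assume "is_maximum ?A m'"
    with m have "m' \<le> m" "m \<le> m'" unfolding is_maximum_def by blast+
    then show "m' = m" by simp
  qed
qed

lemma pair_max_ge:
  assumes "p \<in> tight_span E \<B> \<omega>" "B \<in> \<B>" "e \<in> B" "f \<in> B" "e \<noteq> f"
  shows "perturbed \<omega> (\<lambda>e. - p e) B \<le> pair_max p e f"
proof -
  have "\<omega> B - (\<Sum>g\<in>B. p g) \<in> {\<omega> B - (\<Sum>g\<in>B. p g) |B. B \<in> \<B> \<and> {e, f} \<subseteq> B}" using assms by blast
  with pair_max_is_maximum[OF assms(1) base_subset[OF assms(2,3)] base_subset[OF assms(2,4)] assms(5)]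
  show ?thesis by (simp only: is_maximum_def perturbed_minus)
qed

lemma pair_max_attained:
  assumes "p \<in> tight_span E \<B> \<omega>" "e \<in> E" "f \<in> E" "e \<noteq> f"
  obtains B where "B \<in> \<B>" "e \<in> B" "f \<in> B" "pair_max p e f = perturbed \<omega> (\<lambda>e. - p e) B"
  using pair_max_is_maximum[OF assms] by (auto simp: is_maximum_def perturbed_minus)

text \<open>Exchange \<open>f\<close> into a basis that is best for \<open>e\<close> and
  \<open>g\<close>. Only one element leaves, so \<open>f\<close> ends up in a basis together with
  \<open>e\<close> or with \<open>g\<close>, and the value does not drop.\<close>

lemma pair_max_ultrametric:
  assumes p: "p \<in> tight_span E \<B> \<omega>" and E: "e \<in> E" "f \<in> E" "g \<in> E"
    and "e \<noteq> f" "f \<noteq> g" "e \<noteq> g"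
  shows "pair_max p e g \<le> max (pair_max p e f) (pair_max p f g)"
proof -
  obtain B where B: "B \<in> \<B>" "e \<in> B" "g \<in> B" "pair_max p e g = perturbed \<omega> (\<lambda>e. - p e) B"
    using pair_max_attained[OF p E(1,3) assms(7)] .
  show ?thesis
  proof (cases "f \<in> B")
    case True
    then show ?thesis using pair_max_ge[OF p B(1,2) True assms(5)] B(4) by simp
  next
    case False
    obtain B' where B': "B' \<in> \<B>" "f \<in> B'" "perturbed \<omega> (\<lambda>e. - p e) B' = 0"
      using tight_span_attained[OF p E(2)] .
    obtain h where h: "h \<in> B - B'" "insert h (B' - {f}) \<in> \<B>" "insert f (B - {h}) \<in> \<B>"
      "perturbed \<omega> (\<lambda>e. - p e) B' + perturbed \<omega> (\<lambda>e. - p e) B \<le>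
        perturbed \<omega> (\<lambda>e. - p e) (insert h (B' - {f})) + perturbed \<omega> (\<lambda>e. - p e) (insert f (B - {h}))"
      using perturbed_exchange[OF B'(1) B(1)] False B'(2) by blast
    have "perturbed \<omega> (\<lambda>e. - p e) (insert h (B' - {f})) \<le> 0" using tight_span_le[OF p h(2)] by blast
    then have le: "pair_max p e g \<le> perturbed \<omega> (\<lambda>e. - p e) (insert f (B - {h}))"
      using h(4) B(4) B'(3) by simp
    show ?thesis
    proof (cases "h = e")
      case True
      then have "perturbed \<omega> (\<lambda>e. - p e) (insert f (B - {h})) \<le> pair_max p f g"
        using B(3) assms(5-7) by (intro pair_max_ge[OF p h(3)]) auto
      with le show ?thesis by simp
    next
      case False
      then have "perturbed \<omega> (\<lambda>e. - p e) (insert f (B - {h})) \<le> pair_max p e f"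
        using B(2) assms(5-7) by (intro pair_max_ge[OF p h(3)]) auto
      with le show ?thesis by simp
    qed
  qed
qed

lemma metric_space_tight_dist:
  assumes p: "p \<in> tight_span E \<B> \<omega>"
  shows "Metric_space E (tight_dist \<B> \<omega> p)"
proof
  fix e f :: 'e
  show "0 \<le> tight_dist \<B> \<omega> p e f" by (simp add: tight_dist_eq)
  show "tight_dist \<B> \<omega> p e f = tight_dist \<B> \<omega> p f e" by (simp add: tight_dist_eq pair_max_commute)
  show "(tight_dist \<B> \<omega> p e f = 0) = (e = f)" by (simp add: tight_dist_eq)
next
  fix e f g assume E: "e \<in> E" "f \<in> E" "g \<in> E"
  show "tight_dist \<B> \<omega> p e g \<le> tight_dist \<B> \<omega> p e f + tight_dist \<B> \<omega> p f g"
  proof (cases "e \<noteq> f \<and> f \<noteq> g \<and> e \<noteq> g")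
    case True
    then have "pair_max p e g \<le> pair_max p e f \<or> pair_max p e g \<le> pair_max p f g"
      using pair_max_ultrametric[OF p E] by linarith
    then have "exp (pair_max p e g) \<le> exp (pair_max p e f) \<or> exp (pair_max p e g) \<le> exp (pair_max p f g)"
      by simp
    then show ?thesis using True exp_gt_zero[of "pair_max p e f"] exp_gt_zero[of "pair_max p f g"]
      unfolding tight_dist_eq by (auto intro: add_increasing add_increasing2)
  qed (auto simp: tight_dist_eq)
qed

text \<open>A bound \<open>c\<close> on \<open>q - p\<close> changes a sum over the \<open>n\<close>
  elements of a basis by at most \<open>n * c\<close>, whence the factor \<open>exp (n * c)\<close>.
  With the roles exchanged the two metrics are Lipschitz equivalent, so completeness can be checked
  at a single point of the tight span.\<close>

lemma tight_dist_le:
  assumes p: "p \<in> tight_span E \<B> \<omega>" and q: "q \<in> tight_span E \<B> \<omega>"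
  shows "\<exists>C>0. \<forall>e\<in>E. \<forall>f\<in>E. tight_dist \<B> \<omega> p e f \<le> C * tight_dist \<B> \<omega> q e f"
proof -
  obtain c where c: "\<forall>e\<in>E. q e - p e \<le> c" using tight_span_diff_bounded_above[OF p q] ..
  have "tight_dist \<B> \<omega> p e f \<le> exp (n * c) * tight_dist \<B> \<omega> q e f" if E: "e \<in> E" "f \<in> E" for e f
  proof (cases "e = f")
    case False
    obtain B where B: "B \<in> \<B>" "e \<in> B" "f \<in> B" "pair_max p e f = perturbed \<omega> (\<lambda>e. - p e) B"
      using pair_max_attained[OF p E False] .
    have "(\<Sum>g\<in>B. q g - p g) \<le> (\<Sum>g\<in>B. c)" using c base_subset[OF B(1)] by (intro sum_mono) blast
    then have "(\<Sum>g\<in>B. q g) - (\<Sum>g\<in>B. p g) \<le> n * c" using base_card[OF B(1)] by (simp add: sum_subtractf)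
    then have "pair_max p e f \<le> n * c + pair_max q e f"
      using pair_max_ge[OF q B(1-3) False] B(4) by (simp add: perturbed_minus)
    then have "exp (pair_max p e f) \<le> exp (n * c + pair_max q e f)" by simp
    then show ?thesis using False by (simp add: tight_dist_eq exp_add)
  qed (simp add: tight_dist_eq)
  then show ?thesis by (intro exI[of _ "exp (n * c)"]) simp
qed

lemma mcomplete_tight_dist:
  assumes p: "p \<in> tight_span E \<B> \<omega>" and q: "q \<in> tight_span E \<B> \<omega>"
    and complete: "Metric_space.mcomplete E (tight_dist \<B> \<omega> q)"
  shows "Metric_space.mcomplete E (tight_dist \<B> \<omega> p)"
proof -
  interpret P: Metric_space E "tight_dist \<B> \<omega> p" by (rule metric_space_tight_dist[OF p])
  interpret Q: Metric_space E "tight_dist \<B> \<omega> q" by (rule metric_space_tight_dist[OF q])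
  obtain C where C: "0 < C" "\<And>e f. e \<in> E \<Longrightarrow> f \<in> E \<Longrightarrow> tight_dist \<B> \<omega> p e f \<le> C * tight_dist \<B> \<omega> q e f"
    using tight_dist_le[OF p q] by blast
  obtain D where D: "0 < D" "\<And>e f. e \<in> E \<Longrightarrow> f \<in> E \<Longrightarrow> tight_dist \<B> \<omega> q e f \<le> D * tight_dist \<B> \<omega> p e f"
    using tight_dist_le[OF q p] by blast
  show ?thesis
    unfolding P.mcomplete_def
  proof (intro allI impI)
    fix \<sigma> assume \<sigma>: "P.MCauchy \<sigma>"
    then have E: "\<sigma> i \<in> E" for i by (auto simp: P.MCauchy_def)
    have "Q.MCauchy \<sigma>"
      unfolding Q.MCauchy_def
    proof (intro conjI allI impI)
      fix \<epsilon> :: real assume "0 < \<epsilon>"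
      then have "0 < \<epsilon> / D" using D(1) by simp
      then obtain N where N: "\<And>i j. N \<le> i \<Longrightarrow> N \<le> j \<Longrightarrow> tight_dist \<B> \<omega> p (\<sigma> i) (\<sigma> j) < \<epsilon> / D"
        using \<sigma> unfolding P.MCauchy_def by meson
      have "tight_dist \<B> \<omega> q (\<sigma> i) (\<sigma> j) < \<epsilon>" if "N \<le> i" "N \<le> j" for i j
        using N[OF that] D(2)[OF E E, of i j] D(1) by (simp add: field_simps)
      then show "\<exists>N. \<forall>i j. N \<le> i \<longrightarrow> N \<le> j \<longrightarrow> tight_dist \<B> \<omega> q (\<sigma> i) (\<sigma> j) < \<epsilon>" by blast
    qed (use E in blast)
    then obtain l where l: "limitin Q.mtopology \<sigma> l sequentially"
      using complete unfolding Q.mcomplete_def by blast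
    have "limitin P.mtopology \<sigma> l sequentially"
      unfolding P.limitin_metric
    proof (intro conjI allI impI)
      show lE: "l \<in> E" using l by (simp add: Q.limitin_metric)
      fix \<epsilon> :: real assume "0 < \<epsilon>"
      then have "0 < \<epsilon> / C" using C(1) by simp
      then have "\<forall>\<^sub>F i in sequentially. \<sigma> i \<in> E \<and> tight_dist \<B> \<omega> q (\<sigma> i) l < \<epsilon> / C"
        using l unfolding Q.limitin_metric by blast
      then show "\<forall>\<^sub>F i in sequentially. \<sigma> i \<in> E \<and> tight_dist \<B> \<omega> p (\<sigma> i) l < \<epsilon>"
      proof eventually_elim
        case (elim i)
        then show ?case using C(2)[OF _ lE, of "\<sigma> i"] C(1) by (simp add: field_simps)
      qed
    qed
    then show "\<exists>l. limitin P.mtopology \<sigma> l sequentially" ..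
  qed
qed

end

section \<open>Completeness of the valuation\<close>

context uniform_lattice
begin

lemma basis_containing:
  assumes e: "e \<in> ends"
  obtains B where "B \<in> bases_at n (x::'a)" "e \<in> B"
proof -
  have "\<not> end_ray e x 1 \<le> atom_join x {}" using covers_less[OF covers_end_ray[OF e], of x] by auto
  then have "independent_at x {e}" using independent_at_insert[OF independent_at_empty e] by simp
  then obtain B where "{e} \<subseteq> B" "B \<in> bases_at n x" by (rule basis_extend)
  then show thesis using that by simp
qed

lemma basis_containing_pair:
  assumes e: "e \<in> ends" and f: "f \<in> ends" and ne: "end_ray e x 1 \<noteq> end_ray f (x::'a) 1"
  obtains B where "B \<in> bases_at n x" "e \<in> B" "f \<in> B"
proof -
  have "\<not> end_ray e x 1 \<le> atom_join x {}" using covers_less[OF covers_end_ray[OF e], of x] by auto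
  then have ind: "independent_at x {e}" using independent_at_insert[OF independent_at_empty e] by simp
  have "atom_join x {e} = end_ray e x 1"
    using atom_join_insert[of "{}" x e] le_end_ray[OF e, of x 1] by (simp add: sup.absorb1)
  then have "\<not> end_ray f x 1 \<le> atom_join x {e}"
    using covers_eq[OF covers_end_ray[OF f, of x] covers_end_ray[OF e, of x]] ne by auto
  then have "independent_at x {f, e}" using independent_at_insert[OF ind f] by simp
  then obtain B where "{f, e} \<subseteq> B" "B \<in> bases_at n x" by (rule basis_extend)
  then show thesis using that by simp
qed

lemma rays_split:
  assumes "e \<in> ends" "f \<in> ends" "e \<noteq> f"
  shows "\<exists>k. (\<forall>j\<le>k. end_ray e x j = end_ray f (x::'a) j) \<and> end_ray e x (Suc k) \<noteq> end_ray f x (Suc k)"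
proof -
  let ?P = "\<lambda>j. end_ray e x j \<noteq> end_ray f x j"
  have ex: "\<exists>j. ?P j" using end_ray_inj[OF assms(1,2), of x] assms(3) by auto
  have l: "?P (LEAST j. ?P j)" by (rule LeastI_ex[OF ex])
  have least: "j < (LEAST j. ?P j) \<Longrightarrow> \<not> ?P j" for j by (rule not_less_Least)
  obtain k where k: "(LEAST j. ?P j) = Suc k"
    using l assms(1,2) by (cases "LEAST j. ?P j") auto
  show ?thesis by (rule exI[of _ k]) (use l least k in auto)
qed

text \<open>At the point where two distinct rays separate, their atoms differ, hence are independent
  and extend to a basis. This gives both simplicity of the matroid and a lower bound for distances
  of ends.\<close>

lemma basis_at_split:
  assumes "e \<in> ends" "f \<in> ends" "e \<noteq> f"
  shows "\<exists>k B. (\<forall>j\<le>k. end_ray e x j = end_ray f (x::'a) j) \<and>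
    B \<in> bases_at n (end_ray e x k) \<and> e \<in> B \<and> f \<in> B"
proof -
  obtain k where k: "\<forall>j\<le>k. end_ray e x j = end_ray f x j"
    "end_ray e x (Suc k) \<noteq> end_ray f x (Suc k)"
    using rays_split[OF assms] by blast
  have "end_ray e (end_ray e x k) 1 \<noteq> end_ray f (end_ray e x k) 1"
    using k(2) end_ray_tail[OF assms(1), of x k] end_ray_tail[OF assms(2), of x k] k(1) by simp
  then obtain B where "B \<in> bases_at n (end_ray e x k)" "e \<in> B" "f \<in> B"
    by (rule basis_containing_pair[OF assms(1,2)])
  with k(1) show ?thesis by blast
qed

section \<open>The valuated matroid of ends, and how common initial pieces bound its values\<close>

lemma bases_inf_iff: "B \<in> bases_inf n \<longleftrightarrow> (\<exists>x::'a. B \<in> bases_at n x)"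
  by (auto simp: bases_inf_def)

lemma bases_at_imp_inf: "B \<in> bases_at n (x::'a) \<Longrightarrow> B \<in> bases_inf n"
  by (auto simp: bases_inf_iff)

lemma bases_inf_subset_ends: "B \<in> bases_inf n \<Longrightarrow> e \<in> B \<Longrightarrow> e \<in> (ends :: (nat \<Rightarrow> 'a) set set)"
  using bases_at_subset_ends by (auto simp: bases_inf_iff)

lemma valuated_omega:
  "valuated_matroid ends (bases_inf n) n (\<lambda>B. real_of_int (omega n (x::'a) B))"
proof -
  obtain B :: "(nat \<Rightarrow> 'a) set set" where "B \<in> bases_at n (undefined :: 'a)"
    using basis_extend[OF independent_at_empty] .
  then have "bases_inf n \<noteq> ({} :: (nat \<Rightarrow> 'a) set set set)" using bases_at_imp_inf by blast
  moreover have "B \<subseteq> ends \<and> finite B \<and> card B = n" if "B \<in> bases_inf n" for B :: "(nat \<Rightarrow> 'a) set set"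
    using that by (auto simp: bases_inf_iff bases_at_iff)
  moreover have "\<exists>f\<in>B' - B. insert f (B - {e}) \<in> bases_inf n \<and> insert e (B' - {f}) \<in> bases_inf n \<and>
      real_of_int (omega n x B) + real_of_int (omega n x B') \<le>
        real_of_int (omega n x (insert f (B - {e}))) + real_of_int (omega n x (insert e (B' - {f})))"
    if BB: "B \<in> bases_inf n" "B' \<in> bases_inf n" "e \<in> B - B'" for B B' :: "(nat \<Rightarrow> 'a) set set" and e
    using omega_exchange[OF BB, of x] by (simp flip: of_int_add)
  ultimately show ?thesis
    unfolding valuated_matroid_def matroid_bases_def by blast
qed

lemma simple_bases_inf: "simple_matroid (ends :: (nat \<Rightarrow> 'a) set set) (bases_inf n)"
  unfolding simple_matroid_def matroid_indep_def
proof (intro conjI ballI impI)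
  fix e :: "(nat \<Rightarrow> 'a) set" assume e: "e \<in> ends"
  obtain B where "B \<in> bases_at n (undefined :: 'a)" "e \<in> B" using basis_containing[OF e] .
  then show "\<exists>B\<in>bases_inf n. {e} \<subseteq> B" using bases_at_imp_inf by blast
next
  fix e f :: "(nat \<Rightarrow> 'a) set" assume ef: "e \<in> ends" "f \<in> ends" "e \<noteq> f"
  obtain k B where "B \<in> bases_at n (end_ray e (undefined :: 'a) k)" "e \<in> B" "f \<in> B"
    using basis_at_split[OF ef] by blast
  then show "\<exists>B\<in>bases_inf n. {e, f} \<subseteq> B" using bases_at_imp_inf by blast
qed

text \<open>From the projection of \<open>x\<close>, moving \<open>k\<close> steps along both
  \<open>e\<close> and \<open>f\<close> climbs \<open>2 * k\<close> levels. Since the two rays at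
  \<open>x\<close> agree up to index \<open>k\<close>, the point reached is still below a single
  point only \<open>k\<close> levels above \<open>x\<close>.\<close>

lemma omega_le_common_length:
  assumes B: "B \<in> bases_inf n" "e \<in> B" "f \<in> B" "e \<noteq> f"
    and k: "end_ray e x k = end_ray f (x::'a) k"
  shows "omega n x B \<le> - int k"
proof -
  let ?z = "proj n x B"
  note z = proj_properties[OF B(1), where y = x]
  have E: "g \<in> ends" if "g \<in> B" for g using bases_inf_subset_ends[OF B(1) that] .
  have le: "end_ray g ?z k \<le> end_ray g x k" if "g \<in> B" for g
  proof -
    have "ray_steps g ?z x = 0" using z(3)[OF that] busemann_of_le[OF E[OF that] z(2)] by simp
    then show ?thesis using end_ray_sup[OF E[OF that] z(2), of k] by simp
  qed
  let ?k = "\<lambda>g. if g \<in> {e, f} then k else 0"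
  obtain w where w: "height w = height ?z + (\<Sum>g\<in>B. int (?k g))"
    "\<forall>y. ?z \<le> y \<longrightarrow> (\<forall>g\<in>B. end_ray g ?z (?k g) \<le> y) \<longrightarrow> w \<le> y"
    using bases_at_move[OF z(1), of ?k] by blast
  have zx: "?z \<le> end_ray e x k" using order.trans[OF z(2) le_end_ray[OF E[OF B(2)]]] .
  have "end_ray g ?z (?k g) \<le> end_ray e x k" if "g \<in> B" for g
    using le[OF B(2)] le[OF B(3)] k zx E[OF that] by auto
  then have "w \<le> end_ray e x k" using w(2) zx by blast
  then have "height w \<le> height x + int k" using height_mono height_end_ray[OF E[OF B(2)]] by metis
  moreover have "(\<Sum>g\<in>B. int (?k g)) = (\<Sum>g\<in>{e, f}. int k)"
    by (rule sum.mono_neutral_cong_right) (use B bases_at_finite[OF z(1)] in auto)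
  ultimately have "height ?z + 2 * int k \<le> height x + int k" using w(1) B(4) by simp
  then show ?thesis using omega_eq[OF B(1), of x] by simp
qed

text \<open>The valuation vanishes at the point where \<open>B\<close> is a basis. Returning to
  \<open>x\<close> loses at most \<open>k\<close> in each of the \<open>n\<close> coordinates,
  because a ray point below that point is at most \<open>k\<close> levels above \<open>x\<close>;
  the gain of \<open>k\<close> in height is dropped from the estimate.\<close>

lemma omega_ge_common_length:
  assumes e: "e \<in> ends" and B: "B \<in> bases_at n (end_ray e (x::'a) k)"
  shows "- (int n * int k) \<le> omega n x B"
proof -
  let ?z = "end_ray e x k"
  have BI: "B \<in> bases_inf n" using B by (auto simp: bases_inf_iff)
  have xz: "x \<le> ?z" using le_end_ray[OF e] .
  have "busemann g x ?z \<le> int k" if "g \<in> B" for g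
  proof -
    have g: "g \<in> ends" using bases_at_subset_ends[OF B that] .
    have "end_ray g x (ray_steps g x ?z) \<le> ?z" using le_ray_steps_iff[OF g xz] by simp
    from height_mono[OF this] show ?thesis
      using height_end_ray[OF g, of x "ray_steps g x ?z"] height_end_ray[OF e, of x k]
        busemann_of_le[OF g xz] by simp
  qed
  then have "(\<Sum>g\<in>B. busemann g x ?z) \<le> (\<Sum>g\<in>B. int k)" by (rule sum_mono)
  also have "\<dots> = int n * int k" using B by (simp add: bases_at_iff)
  finally show ?thesis
    using omega_shift[OF BI, of ?z x] omega_eq_0_iff[OF BI, of ?z] B height_end_ray[OF e, of x k] by simp
qed

lemma sum_zero_on_ends:
  "B \<in> bases_inf n \<Longrightarrow> A \<subseteq> B \<Longrightarrow> (\<Sum>e\<in>A. (\<lambda>e\<in>(ends :: (nat \<Rightarrow> 'a) set set). 0 :: real) e) = 0"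
  using bases_inf_subset_ends by (intro sum.neutral) auto

lemma zero_tight_span:
  "(\<lambda>e\<in>ends. 0) \<in> tight_span ends (bases_inf n) (\<lambda>B. real_of_int (omega n (x::'a) B))"
  unfolding tight_span_def
proof (intro CollectI conjI ballI)
  fix e :: "(nat \<Rightarrow> 'a) set" assume e: "e \<in> ends"
  obtain B where B: "B \<in> bases_at n x" "e \<in> B" using basis_containing[OF e] .
  then have BI: "B \<in> bases_inf n" by (auto simp: bases_inf_iff)
  have "omega n x B = 0" using omega_eq_0_iff[OF BI] B(1) by simp
  then have "0 = real_of_int (omega n x B) - (\<Sum>f\<in>B - {e}. (\<lambda>e\<in>ends. 0) f)"
    using sum_zero_on_ends[OF BI, of "B - {e}"] by simp
  moreover have "real_of_int (omega n x B') - (\<Sum>f\<in>B' - {e}. (\<lambda>e\<in>ends. 0) f) \<le> 0"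
    if "B' \<in> bases_inf n" for B'
    using sum_zero_on_ends[OF that, of "B' - {e}"] omega_le_0[OF that, of x] by simp
  ultimately show "is_maximum {real_of_int (omega n x B) - (\<Sum>f\<in>B - {e}. (\<lambda>e\<in>ends. 0) f) |B.
      B \<in> bases_inf n \<and> e \<in> B} ((\<lambda>e\<in>ends. 0) e)"
    using BI B(2) e unfolding is_maximum_def by auto
qed simp

end

sublocale uniform_lattice \<subseteq>
  V: simple_valuated "ends :: (nat \<Rightarrow> 'a) set set" "bases_inf n" n "\<lambda>B. real_of_int (omega n x B)" for x :: 'a
  by unfold_locales (fact valuated_omega simple_bases_inf)+

context uniform_lattice
begin

section \<open>The metric on ends at the zero vector of the tight span\<close>

definition base_dist :: "'a \<Rightarrow> (nat \<Rightarrow> 'a) set \<Rightarrow> (nat \<Rightarrow> 'a) set \<Rightarrow> real" where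
  "base_dist x = tight_dist (bases_inf n) (\<lambda>B. real_of_int (omega n x B)) (\<lambda>e\<in>ends. 0)"

lemma perturbed_zero:
  assumes "B \<in> bases_inf n"
  shows "perturbed (\<lambda>B. real_of_int (omega n (x::'a) B)) (\<lambda>e. - (\<lambda>e\<in>ends. 0) e) B = real_of_int (omega n x B)"
  using sum_zero_on_ends[OF assms, of B] by (simp add: perturbed_def sum_negf)

lemma base_dist_le:
  assumes "e \<in> ends" "f \<in> ends" "end_ray e x k = end_ray f (x::'a) k"
  shows "base_dist x e f \<le> exp (- real k)"
proof (cases "e = f")
  case False
  obtain B where B: "B \<in> bases_inf n" "e \<in> B" "f \<in> B" "V.pair_max x (\<lambda>e\<in>ends. 0) e f = real_of_int (omega n x B)"
    using V.pair_max_attained[OF zero_tight_span assms(1,2) False, of x] perturbed_zero by metis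
  have "omega n x B \<le> - int k" using omega_le_common_length[OF B(1-3) False assms(3)] .
  then have "real_of_int (omega n x B) \<le> - real k" by linarith
  then show ?thesis using False B(4) by (simp add: base_dist_def V.tight_dist_eq)
qed (simp add: base_dist_def V.tight_dist_eq)

text \<open>The threshold comes from \<open>omega_ge_common_length\<close>: ends that separate at
  index \<open>l\<close> are at distance at least \<open>exp (- (n * l))\<close>, so a smaller
  distance forces \<open>l\<close> beyond \<open>k\<close>.\<close>

lemma base_dist_small:
  assumes e: "e \<in> ends" "f \<in> ends" and small: "base_dist x e f < exp (- (real n * real k))" and "j \<le> k"
  shows "end_ray e x j = end_ray f (x::'a) j"
proof (cases "e = f")
  case False
  obtain l B where l: "\<forall>j\<le>l. end_ray e x j = end_ray f x j"
    and B: "B \<in> bases_at n (end_ray e x l)" "e \<in> B" "f \<in> B"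
    using basis_at_split[OF e False, of x] by blast
  then have BI: "B \<in> bases_inf n" by (auto simp: bases_inf_iff)
  have "real_of_int (omega n x B) \<le> V.pair_max x (\<lambda>e\<in>ends. 0) e f"
    using V.pair_max_ge[OF zero_tight_span BI B(2,3) False, of x] perturbed_zero[OF BI, of x] by simp
  moreover have "V.pair_max x (\<lambda>e\<in>ends. 0) e f < - (real n * real k)"
    using small False by (simp add: base_dist_def V.tight_dist_eq)
  moreover have "- (real n * real l) \<le> real_of_int (omega n x B)"
  proof -
    have "real_of_int (- (int n * int l)) \<le> real_of_int (omega n x B)"
      using omega_ge_common_length[OF e(1) B(1)] by (simp only: of_int_le_iff)
    then show ?thesis by simp
  qed
  ultimately have "real n * real k < real n * real l" by linarith
  then have "k < l" by (simp add: mult_less_cancel_left)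
  with l assms(4) show ?thesis by simp
qed simp

lemma mcomplete_base_dist: "Metric_space.mcomplete ends (base_dist (x::'a))"
proof -
  interpret M: Metric_space ends "base_dist x"
    unfolding base_dist_def by (rule V.metric_space_tight_dist[OF zero_tight_span])
  show ?thesis
    unfolding M.mcomplete_def
  proof (intro allI impI)
    fix \<sigma> assume \<sigma>: "M.MCauchy \<sigma>"
    then have E: "\<sigma> i \<in> ends" for i by (auto simp: M.MCauchy_def)
    have "\<exists>N. \<forall>i j. N \<le> i \<longrightarrow> N \<le> j \<longrightarrow> base_dist x (\<sigma> i) (\<sigma> j) < exp (- (real n * real k))" for k
      using \<sigma> by (simp add: M.MCauchy_def)
    then have "\<exists>N. \<forall>k. \<forall>i j. N k \<le> i \<longrightarrow> N k \<le> j \<longrightarrow> base_dist x (\<sigma> i) (\<sigma> j) < exp (- (real n * real k))"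
      by (intro choice allI)
    then obtain N where
      N': "\<forall>k. \<forall>i j. N k \<le> i \<longrightarrow> N k \<le> j \<longrightarrow> base_dist x (\<sigma> i) (\<sigma> j) < exp (- (real n * real k))" ..
    have N: "base_dist x (\<sigma> i) (\<sigma> j) < exp (- (real n * real k))" if "N k \<le> i" "N k \<le> j" for k i j
      using N' that by simp
    \<comment> \<open>The rays of a Cauchy sequence are eventually constant at every index. The
      diagonal \<open>g\<close> collects these values and is a ray, because the ray condition
      involves three consecutive points, which all occur on one member of the sequence.\<close>
    define g where "g l = end_ray (\<sigma> (N l)) x l" for l
    have g: "end_ray (\<sigma> i) x l = g l" if "N k \<le> i" "l \<le> k" for i k l
    proof -
      let ?j = "max i (N l)"
      have "end_ray (\<sigma> i) x l = end_ray (\<sigma> ?j) x l"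
        by (rule base_dist_small[OF E E N[of k i ?j] that(2)]) (use that(1) in simp_all)
      also have "\<dots> = g l" unfolding g_def by (rule base_dist_small[OF E E N[of l ?j "N l"] order.refl]) simp_all
      finally show ?thesis .
    qed
    have "g \<in> rays"
      unfolding rays_iff
    proof (intro conjI allI)
      fix l
      let ?r = "end_ray (\<sigma> (N (Suc (Suc l)))) x"
      have "g l = ?r l" "g (Suc l) = ?r (Suc l)" "g (Suc (Suc l)) = ?r (Suc (Suc l))"
        using g[of "Suc (Suc l)" "N (Suc (Suc l))"] by simp_all
      with ray_covers[OF end_ray_rays[OF E], of "N (Suc (Suc l))" x l]
        ray_not_le_asc[OF end_ray_rays[OF E], of "N (Suc (Suc l))" x l]
      show "g l \<prec>\<^sub>1 g (Suc l)" "\<not> g (Suc (Suc l)) \<le> asc (g l)" by simp_all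
    qed
    then obtain e where e: "e \<in> ends" "g \<in> e" using end_of_ray by blast
    have "g 0 = x" using E by (simp add: g_def)
    then have ge: "end_ray e x = g" using end_ray_eqI[OF e] by simp
    have "limitin M.mtopology \<sigma> e sequentially"
      unfolding M.limitin_metric
    proof (intro conjI allI impI)
      fix \<epsilon> :: real assume "0 < \<epsilon>"
      obtain k :: nat where "- ln \<epsilon> < real k" using reals_Archimedean2 by blast
      then have "exp (- real k) < exp (ln \<epsilon>)" by simp
      then have k: "exp (- real k) < \<epsilon>" using \<open>0 < \<epsilon>\<close> by simp
      show "\<forall>\<^sub>F i in sequentially. \<sigma> i \<in> ends \<and> base_dist x (\<sigma> i) e < \<epsilon>"
        using eventually_ge_at_top[of "N k"]
      proof eventually_elim
        case (elim i)
        have "base_dist x (\<sigma> i) e \<le> exp (- real k)"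
          using base_dist_le[OF E e(1)] g[OF elim order.refl] ge by simp
        with k E show ?case by simp
      qed
    qed (fact e(1))
    then show "\<exists>e. limitin M.mtopology \<sigma> e sequentially" ..
  qed
qed

lemma complete_omega:
  "complete_valuated_matroid ends (bases_inf n) n (\<lambda>B. real_of_int (omega n (x::'a) B))"
  unfolding complete_valuated_matroid_def
  using valuated_omega simple_bases_inf zero_tight_span[of x] V.metric_space_tight_dist
    V.mcomplete_tight_dist[OF _ zero_tight_span mcomplete_base_dist[unfolded base_dist_def], of _ x]
  by blast

section \<open>Lattice points of the tropical linear space\<close>

definition coord :: "'a \<Rightarrow> 'a \<Rightarrow> (nat \<Rightarrow> 'a) set \<Rightarrow> real" where
  "coord x y = (\<lambda>e\<in>ends. real_of_int (busemann e x y))"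

abbreviation tropical :: "'a \<Rightarrow> ((nat \<Rightarrow> 'a) set \<Rightarrow> real) set" where
  "tropical x \<equiv> tropical_linear_space ends (bases_inf n) (\<lambda>B. real_of_int (omega n x B))"

abbreviation optimal :: "'a \<Rightarrow> ((nat \<Rightarrow> 'a) set \<Rightarrow> real) \<Rightarrow> (nat \<Rightarrow> 'a) set set set" where
  "optimal x q \<equiv> maximizers (bases_inf n) (perturbed (\<lambda>B. real_of_int (omega n x B)) q)"

lemma perturbed_coord:
  assumes B: "B \<in> bases_inf n"
  shows "perturbed (\<lambda>B. real_of_int (omega n x B)) (coord x y) B =
    real_of_int (omega n y B + (height y - height x))"
proof -
  have "(\<Sum>e\<in>B. coord x y e) = (\<Sum>e\<in>B. real_of_int (busemann e x y))"
    by (rule sum.cong) (use bases_inf_subset_ends[OF B] in \<open>simp_all add: coord_def\<close>)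
  then show ?thesis using omega_shift[OF B, of y x] by (simp add: perturbed_def)
qed

lemma optimal_coord: "optimal x (coord x y) = bases_at n y"
proof -
  obtain B0 where B0: "B0 \<in> bases_at n y" using basis_extend[OF independent_at_empty] .
  have 1: "B \<in> optimal x (coord x y)" if B: "B \<in> bases_at n y" for B
  proof -
    have BI: "B \<in> bases_inf n" using bases_at_imp_inf[OF B] .
    then show ?thesis
      using B omega_eq_0_iff[OF BI, of y] omega_le_0
      by (auto simp: maximizers_def perturbed_coord)
  qed
  have 2: "B \<in> bases_at n y" if B: "B \<in> optimal x (coord x y)" for B
  proof -
    have BI: "B \<in> bases_inf n" using B by (simp add: maximizers_def)
    have "omega n y B0 \<le> omega n y B"
      using V.maximizers_le[OF B bases_at_imp_inf[OF B0]]
      by (simp add: perturbed_coord[OF BI] perturbed_coord[OF bases_at_imp_inf[OF B0]])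
    then show ?thesis
      using omega_eq_0_iff[OF BI, of y] omega_le_0[OF BI, of y]
        omega_eq_0_iff[OF bases_at_imp_inf[OF B0], of y] B0 by simp
  qed
  from 1 2 show ?thesis by blast
qed

lemma coord_tropical: "coord x y \<in> tropical x"
proof -
  obtain B0 where B0: "B0 \<in> bases_at n y" using basis_extend[OF independent_at_empty] .
  have "\<exists>B\<in>bases_at n y. e \<in> B" if "e \<in> ends" for e
    using basis_containing[OF that] by metis
  moreover have "coord x y \<in> ends \<rightarrow>\<^sub>E UNIV" by (simp add: coord_def)
  ultimately show ?thesis using B0
    unfolding tropical_linear_space_def mem_Collect_eq optimal_coord by blast
qed

text \<open>Take a basis at \<open>y\<close> and project \<open>z\<close> to its apartment. The
  projection keeps the coordinates of \<open>z\<close> in the basis, so it is above \<open>y\<close>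
  within the apartment, and it is below \<open>z\<close>.\<close>

lemma le_iff_busemann: "y \<le> z \<longleftrightarrow> (\<forall>e\<in>ends. busemann e x y \<le> busemann e x (z::'a))"
proof
  assume r: "\<forall>e\<in>ends. busemann e x y \<le> busemann e x z"
  obtain B where B: "B \<in> bases_at n y" using basis_extend[OF independent_at_empty] .
  note BI = bases_at_imp_inf[OF B]
  have "y \<le> proj n z B"
  proof (rule bases_at_le[OF B proj_bases_at[OF BI]], rule ballI)
    fix e assume e: "e \<in> B"
    have E: "e \<in> ends" using bases_at_subset_ends[OF B e] .
    then show "0 \<le> busemann e y (proj n z B)"
      using busemann_proj[OF BI e, of z] busemann_add[OF E, of y "proj n z B" z]
        busemann_add[OF E, of x y z] bspec[OF r E] by simp
  qed
  then show "y \<le> z" using proj_le[OF BI] by (rule order.trans)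
qed (simp add: busemann_mono)

lemma coord_le_iff: "y \<le> z \<longleftrightarrow> (\<forall>e\<in>ends. coord x y e \<le> coord x z e)"
  unfolding le_iff_busemann[of y z x] by (simp add: coord_def)

lemma coord_eq_iff: "(\<forall>e\<in>ends. coord x y e = coord x z e) \<longleftrightarrow> y = z"
  using coord_le_iff[of y z x] coord_le_iff[of z y x] by (auto intro: order.antisym)

lemma exists_apartment_point:
  fixes c :: "(nat \<Rightarrow> 'a) set \<Rightarrow> int"
  assumes "B \<in> bases_inf n"
  shows "\<exists>y. B \<in> bases_at n y \<and> (\<forall>e\<in>B. busemann e x y = c e)"
proof -
  obtain z :: 'a where z: "B \<in> bases_at n z" using assms by (auto simp: bases_inf_iff)
  define d where "d e = c e - busemann e x z" for e
  \<comment> \<open>The prescribed coordinates may be lower than those of \<open>z\<close>, while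
    \<open>bases_at_move\<close> only goes up. Descending \<open>m\<close> times first makes all
    required step counts nonnegative.\<close>
  define m where "m = nat (\<Sum>e\<in>B. \<bar>d e\<bar>)"
  let ?u = "(dsc ^^ m) z"
  have u: "B \<in> bases_at n ?u" using z by (simp add: bases_at_funpow_dsc)
  obtain w where w: "B \<in> bases_at n w" "\<forall>e\<in>B. busemann e ?u w = int (nat (int m + d e))"
    using bases_at_move[OF u, of "\<lambda>e. nat (int m + d e)"] by blast
  have "busemann e x w = c e" if e: "e \<in> B" for e
  proof -
    have E: "e \<in> ends" using bases_at_subset_ends[OF z e] .
    have "\<bar>d e\<bar> \<le> (\<Sum>e\<in>B. \<bar>d e\<bar>)"
      using bases_at_finite[OF z] e by (intro member_le_sum) simp_all
    then have "0 \<le> int m + d e" by (simp add: m_def)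
    then have "busemann e ?u w = int m + d e" using w(2) e by simp
    moreover have "busemann e ?u z = int m" using busemann_funpow_asc[OF E, of ?u m] by simp
    ultimately show ?thesis
      using busemann_add[OF E, of x z w] busemann_add[OF E, of ?u z w] by (simp add: d_def)
  qed
  with w(1) show ?thesis by blast
qed

text \<open>The coordinates of \<open>y\<close> are prescribed only on an optimal basis of
  \<open>q\<close>. As \<open>y\<close> lies in its apartment, the basis is optimal for both points,
  and \<open>tropical_floor\<close> carries the equality to all ends.\<close>

lemma tropical_floor_point:
  assumes q: "q \<in> tropical x"
  shows "\<exists>y. \<forall>e\<in>ends. coord x y e = of_int \<lfloor>q e + t\<rfloor>"
proof -
  obtain B where B: "B \<in> optimal x q" using q by (auto simp: tropical_linear_space_def)
  obtain y where y: "B \<in> bases_at n y" "\<forall>e\<in>B. busemann e x y = \<lfloor>q e + t\<rfloor>"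
    using exists_apartment_point[of B x "\<lambda>e. \<lfloor>q e + t\<rfloor>"] V.maximizersD[OF B] by blast
  have "coord x y e = of_int \<lfloor>q e + t\<rfloor>" if "e \<in> ends" for e
  proof (rule V.tropical_floor[OF _ q B coord_tropical _ _ that])
    show "B \<in> optimal x (coord x y)" using y(1) by (simp add: optimal_coord)
    show "coord x y g = of_int \<lfloor>q g + t\<rfloor>" if "g \<in> B" for g
      using y that bases_at_subset_ends[OF y(1)] by (simp add: coord_def)
  qed simp
  then show ?thesis by blast
qed

lemma bij_betw_coord: "bij_betw (coord x) UNIV (tropical x \<inter> (ends \<rightarrow>\<^sub>E \<int>))"
proof (rule bij_betw_imageI)
  show "inj (coord x)"
  proof (rule injI)
    fix y z assume "coord x y = coord x z"
    then show "y = z" using coord_eq_iff[of x y z] by simp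
  qed
  have surj: "q \<in> range (coord x)" if q: "q \<in> tropical x" "q \<in> ends \<rightarrow>\<^sub>E \<int>" for q
  proof -
    obtain y where y: "\<forall>e\<in>ends. coord x y e = of_int \<lfloor>q e + 0\<rfloor>"
      using tropical_floor_point[OF q(1), of 0] ..
    have "q e = coord x y e" for e
    proof (cases "e \<in> ends")
      case True
      then have "q e \<in> \<int>" using q(2) by (auto simp: PiE_iff)
      then show ?thesis using y True by (auto elim: Ints_cases)
    next
      case False
      then show ?thesis using q(2) by (auto simp: coord_def PiE_iff extensional_def)
    qed
    then have "q = coord x y" by (rule ext)
    then show ?thesis by blast
  qed
  have int: "coord x y \<in> ends \<rightarrow>\<^sub>E \<int>" for y by (simp add: coord_def)
  show "range (coord x) = tropical x \<inter> (ends \<rightarrow>\<^sub>E \<int>)"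
  proof (rule equalityI)
    show "range (coord x) \<subseteq> tropical x \<inter> (ends \<rightarrow>\<^sub>E \<int>)"
      by (rule image_subsetI) (rule IntI[OF coord_tropical int])
    show "tropical x \<inter> (ends \<rightarrow>\<^sub>E \<int>) \<subseteq> range (coord x)"
      by (rule subsetI, erule IntE) (rule surj)
  qed
qed

section \<open>Simplices of the chain complex\<close>

lemma chain_complex_iff:
  "\<sigma> \<in> (chain_complex :: 'a set set) \<longleftrightarrow> finite \<sigma> \<and> (\<exists>m\<in>\<sigma>. \<forall>v\<in>\<sigma>. m \<le> v \<and> v \<le> asc m) \<and>
    (\<forall>u\<in>\<sigma>. \<forall>v\<in>\<sigma>. u \<le> v \<or> v \<le> u)"
proof
  assume "\<sigma> \<in> chain_complex"
  then obtain xs where xs: "\<sigma> = set xs" "xs \<noteq> []" "sorted_wrt (<) xs" "last xs \<le> asc (hd xs)"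
    by (auto simp: chain_complex_def)
  have total: "u \<le> v \<or> v \<le> u" if "u \<in> set xs" "v \<in> set xs" for u v
    using that xs(3) by (induction xs) (auto simp: order.strict_iff_order)
  have hd: "hd xs \<le> v" if "v \<in> set xs" for v
    using that xs(3) by (cases xs) (auto simp: order.strict_iff_order)
  have last: "v \<le> last xs" if "v \<in> set xs" for v
    using that xs(3) by (cases xs rule: rev_cases) (auto simp: sorted_wrt_append order.strict_iff_order)
  have "v \<le> asc (hd xs)" if "v \<in> set xs" for v using order.trans[OF last[OF that] xs(4)] .
  with xs total hd show "finite \<sigma> \<and> (\<exists>m\<in>\<sigma>. \<forall>v\<in>\<sigma>. m \<le> v \<and> v \<le> asc m) \<and> (\<forall>u\<in>\<sigma>. \<forall>v\<in>\<sigma>. u \<le> v \<or> v \<le> u)"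
    by (metis hd_in_set List.finite_set)
next
  assume "finite \<sigma> \<and> (\<exists>m\<in>\<sigma>. \<forall>v\<in>\<sigma>. m \<le> v \<and> v \<le> asc m) \<and> (\<forall>u\<in>\<sigma>. \<forall>v\<in>\<sigma>. u \<le> v \<or> v \<le> u)"
  then obtain m where \<sigma>: "finite \<sigma>" "m \<in> \<sigma>" "\<forall>v\<in>\<sigma>. m \<le> v \<and> v \<le> asc m" "\<forall>u\<in>\<sigma>. \<forall>v\<in>\<sigma>. u \<le> v \<or> v \<le> u"
    by blast
  have enum: "\<exists>xs. set xs = \<tau> \<and> sorted_wrt (<) xs"
    if "finite \<tau>" "\<forall>u\<in>\<tau>. \<forall>v\<in>\<tau>. u \<le> v \<or> v \<le> u" for \<tau> :: "'a set"
    using that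
  proof (induction \<tau> rule: finite_psubset_induct)
    case (psubset \<tau>)
    show ?case
    proof (cases "\<tau> = {}")
      case False
      then obtain a where a: "a \<in> \<tau>" "\<And>v. v \<in> \<tau> \<Longrightarrow> v \<le> a \<Longrightarrow> a = v"
        using finite_has_minimal[OF psubset(1)] by blast
      then obtain xs where xs: "set xs = \<tau> - {a}" "sorted_wrt (<) xs"
        using psubset.IH[of "\<tau> - {a}"] psubset.prems by blast
      have "a < v" if "v \<in> \<tau> - {a}" for v
        using a(2)[of v] a(1) psubset.prems that by (auto simp: order.strict_iff_order)
      with xs a(1) have "set (a # xs) = \<tau>" "sorted_wrt (<) (a # xs)" by auto
      then show ?thesis by blast
    qed (intro exI[of _ "[]"]; simp)
  qed
  from enum[OF \<sigma>(1,4)] obtain xs where xs: "set xs = \<sigma>" "sorted_wrt (<) xs" by blast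
  have ne: "xs \<noteq> []" using xs(1) \<sigma>(2) by auto
  have "m \<in> set xs" using xs(1) \<sigma>(2) by simp
  then have "hd xs \<le> m" using xs(2) by (cases xs) (auto simp: order.strict_iff_order)
  moreover have "m \<le> hd xs" using ne xs(1) \<sigma>(3) by (metis hd_in_set)
  ultimately have "hd xs = m" by (rule order.antisym)
  then have "last xs \<le> asc (hd xs)" using ne xs(1) \<sigma>(3) by (metis last_in_set)
  with ne xs show "\<sigma> \<in> chain_complex" unfolding chain_complex_def by blast
qed

lemma chain_complex_subset:
  assumes "\<sigma> \<in> (chain_complex :: 'a set set)" "\<tau> \<subseteq> \<sigma>" "\<tau> \<noteq> {}"
  shows "\<tau> \<in> chain_complex"
proof -
  obtain m where m: "finite \<sigma>" "m \<in> \<sigma>" "\<forall>v\<in>\<sigma>. m \<le> v \<and> v \<le> asc m" "\<forall>u\<in>\<sigma>. \<forall>v\<in>\<sigma>. u \<le> v \<or> v \<le> u"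
    using assms(1) by (auto simp: chain_complex_iff)
  have fin: "finite \<tau>" using m(1) assms(2) finite_subset by blast
  obtain a where a: "a \<in> \<tau>" "\<And>v. v \<in> \<tau> \<Longrightarrow> v \<le> a \<Longrightarrow> a = v"
    using finite_has_minimal[OF fin assms(3)] by blast
  have "a \<le> v \<and> v \<le> asc a" if "v \<in> \<tau>" for v
  proof
    have "a \<in> \<sigma>" "v \<in> \<sigma>" using a(1) that assms(2) by auto
    then show "a \<le> v" using a(2)[OF that] m(4) by auto
    have "v \<le> asc m" "asc m \<le> asc a" using m(3) \<open>a \<in> \<sigma>\<close> \<open>v \<in> \<sigma>\<close> by simp_all
    then show "v \<le> asc a" by (rule order.trans)
  qed
  with fin a(1) m(4) assms(2) show ?thesis unfolding chain_complex_iff by blast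
qed

text \<open>The idea is to adapt a basis to the flag of flats that the simplex defines.\<close>

lemma chain_common_basis:
  fixes f :: "(nat \<Rightarrow> 'a) set"
  assumes "\<sigma> \<in> chain_complex"
  shows "\<exists>B. (f \<in> ends \<longrightarrow> f \<in> B) \<and> (\<forall>v\<in>\<sigma>. B \<in> bases_at n v)"
proof -
  obtain xs where xs: "\<sigma> = set xs" "xs \<noteq> []" "sorted_wrt (<) xs" "last xs \<le> asc (hd xs)"
    using assms by (auto simp: chain_complex_def)
  define x where "x = hd xs"
  have hd: "x \<le> v" if "v \<in> set xs" for v
    using that xs(3) by (cases xs) (auto simp: x_def order.strict_iff_order)
  have last: "v \<le> last xs" if "v \<in> set xs" for v
    using that xs(3) by (cases xs rule: rev_cases) (auto simp: sorted_wrt_append order.strict_iff_order)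
  have bounds: "x \<le> v \<and> v \<le> asc x" if "v \<in> set xs" for v
    using hd[OF that] order.trans[OF last[OF that] xs(4)] by (simp add: x_def)
  \<comment> \<open>The end \<open>f\<close> is inserted at the first vertex that dominates its
    atom. At that moment it is independent of the ends chosen before and does not push the join
    beyond the vertex.\<close>
  have step: "\<exists>J. I \<subseteq> J \<and> independent_at x J \<and> atom_join x J = v \<and>
      (f \<in> ends \<and> end_ray f x 1 \<le> v \<longrightarrow> f \<in> J)"
    if I: "independent_at x I" "atom_join x I \<le> v" "v \<le> asc x"
      "f \<in> ends \<and> end_ray f x 1 \<le> atom_join x I \<longrightarrow> f \<in> I" for I v
  proof (cases "f \<in> ends \<and> end_ray f x 1 \<le> v \<and> f \<notin> I")
    case True
    then have "\<not> end_ray f x 1 \<le> atom_join x I" using I(4) by blast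
    then have ind: "independent_at x (insert f I)" using independent_at_insert I(1) True by blast
    have "atom_join x (insert f I) \<le> v"
      using atom_join_insert[of I x f] I True by (simp add: independent_at_iff)
    from independent_at_extend[OF ind this I(3)] show ?thesis by (metis insert_subset)
  next
    case False
    from independent_at_extend[OF I(1-3)] show ?thesis using False by (metis subset_iff)
  qed
  \<comment> \<open>The join of \<open>I\<close> is the last vertex treated so far. It is described
    by bounds so that the empty prefix, where the join is \<open>x\<close>, fits the same
    statement.\<close>
  have flag: "\<exists>I. independent_at x I \<and> (\<forall>v\<in>set ys. atom_join x I \<ge> v) \<and>
      (\<forall>u. (\<forall>v\<in>set ys. v \<le> u) \<longrightarrow> x \<le> u \<longrightarrow> atom_join x I \<le> u) \<and>
      (\<forall>v\<in>set ys. \<exists>J\<subseteq>I. atom_join x J = v) \<and> (f \<in> ends \<and> end_ray f x 1 \<le> atom_join x I \<longrightarrow> f \<in> I)"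
    if "set ys \<subseteq> set xs" "sorted_wrt (<) ys" for ys
    using that
  proof (induction ys rule: rev_induct)
    case Nil
    have "\<not> end_ray f x 1 \<le> x" if "f \<in> ends" using covers_less[OF covers_end_ray[OF that], of x] by auto
    then show ?case by (intro exI[of _ "{}"]) (auto simp: independent_at_empty)
  next
    case (snoc v ys)
    then obtain I where I: "independent_at x I" "\<forall>v\<in>set ys. v \<le> atom_join x I"
      "\<forall>u. (\<forall>v\<in>set ys. v \<le> u) \<longrightarrow> x \<le> u \<longrightarrow> atom_join x I \<le> u"
      "\<forall>v\<in>set ys. \<exists>J\<subseteq>I. atom_join x J = v" "f \<in> ends \<and> end_ray f x 1 \<le> atom_join x I \<longrightarrow> f \<in> I"
      by (auto simp: sorted_wrt_append)
    have ys: "\<forall>u\<in>set ys. u \<le> v" using snoc.prems(2) by (auto simp: sorted_wrt_append order.strict_iff_order)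
    have v: "x \<le> v" "v \<le> asc x" using bounds snoc.prems(1) by auto
    have "atom_join x I \<le> v" using I(3) ys v(1) by blast
    from step[OF I(1) this v(2) I(5)]
    obtain J where J: "I \<subseteq> J" "independent_at x J" "atom_join x J = v"
      "f \<in> ends \<and> end_ray f x 1 \<le> v \<longrightarrow> f \<in> J"
      by blast
    have "\<forall>u\<in>set (ys @ [v]). \<exists>K\<subseteq>J. atom_join x K = u"
    proof
      fix u assume "u \<in> set (ys @ [v])"
      then consider "u = v" | "u \<in> set ys" by auto
      then show "\<exists>K\<subseteq>J. atom_join x K = u"
      proof cases
        case 2
        then obtain K where "K \<subseteq> I" "atom_join x K = u" using I(4) by blast
        with J(1) show ?thesis by blast
      qed (use J(3) in blast)
    qed
    then show ?case using J ys by (intro exI[of _ J]) auto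
  qed
  from flag[OF order.refl xs(3)] obtain I where I: "independent_at x I"
    "\<forall>u. (\<forall>v\<in>set xs. v \<le> u) \<longrightarrow> x \<le> u \<longrightarrow> atom_join x I \<le> u"
    "\<forall>v\<in>set xs. \<exists>J\<subseteq>I. atom_join x J = v" "f \<in> ends \<and> end_ray f x 1 \<le> atom_join x I \<longrightarrow> f \<in> I"
    by blast
  have "atom_join x I \<le> asc x" using I(2) bounds le_asc by blast
  from step[OF I(1) this order.refl I(4)]
  obtain B where B: "I \<subseteq> B" "independent_at x B" "atom_join x B = asc x"
    "f \<in> ends \<and> end_ray f x 1 \<le> asc x \<longrightarrow> f \<in> B"
    by blast
  then have "card B = n" by (simp add: independent_at_iff height_asc)
  with B(2) have Bx: "B \<in> bases_at n x" by (simp add: bases_at_def)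
  \<comment> \<open>Each vertex is the join of the atoms of a subset of \<open>B\<close> at
    \<open>x\<close>, and \<open>B\<close> persists as a basis at such joins.\<close>
  have "B \<in> bases_at n v" if v: "v \<in> set xs" for v
  proof -
    obtain J where "J \<subseteq> I" "atom_join x J = v" using I(3) v by blast
    then show ?thesis using bases_at_atom_join(1)[OF Bx, of J] B(1) by simp
  qed
  moreover have "f \<in> ends \<longrightarrow> f \<in> B" using B(4) covers_le_asc[OF covers_end_ray, of f x] by blast
  ultimately show ?thesis using xs(1) by blast
qed

text \<open>The perturbed valuation is affine in the perturbation, so a basis that is optimal at
  every vertex stays optimal at convex combinations. A common basis of the vertices can be chosen
  through any given end.\<close>

lemma simplex_hull_subset_tropical:
  assumes \<sigma>: "\<sigma> \<in> chain_complex"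
  shows "simplex_hull ends (coord x) \<sigma> \<subseteq> tropical x"
proof
  fix p assume "p \<in> simplex_hull ends (coord x) \<sigma>"
  then obtain w where w: "\<forall>v\<in>\<sigma>. 0 \<le> w v" "(\<Sum>v\<in>\<sigma>. w v) = 1"
    and p: "p = (\<lambda>e\<in>ends. \<Sum>v\<in>\<sigma>. w v * coord x v e)"
    by (auto simp: simplex_hull_def)
  let ?P = "perturbed (\<lambda>B. real_of_int (omega n x B))"
  have P: "?P p B = (\<Sum>v\<in>\<sigma>. w v * ?P (coord x v) B)" if B: "B \<in> bases_inf n" for B
  proof -
    have "(\<Sum>e\<in>B. p e) = (\<Sum>e\<in>B. \<Sum>v\<in>\<sigma>. w v * coord x v e)"
      by (rule sum.cong) (use bases_inf_subset_ends[OF B] p in simp_all)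
    also have "\<dots> = (\<Sum>v\<in>\<sigma>. w v * (\<Sum>e\<in>B. coord x v e))"
      by (subst sum.swap) (simp add: sum_distrib_left)
    finally have "?P p B = (\<Sum>v\<in>\<sigma>. w v) * real_of_int (omega n x B) + (\<Sum>v\<in>\<sigma>. w v * (\<Sum>e\<in>B. coord x v e))"
      using w(2) by (simp add: perturbed_def)
    then show ?thesis by (simp add: perturbed_def sum_distrib_right distrib_left sum.distrib)
  qed
  have opt: "B \<in> optimal x p" if B: "\<forall>v\<in>\<sigma>. B \<in> bases_at n v" for B
  proof -
    have "\<sigma> \<noteq> {}" using w(2) by auto
    then obtain v0 where "v0 \<in> \<sigma>" by blast
    then have BI: "B \<in> bases_inf n" using B bases_at_imp_inf by blast
    have "?P p B' \<le> ?P p B" if B': "B' \<in> bases_inf n" for B'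
      unfolding P[OF B'] P[OF BI]
    proof (intro sum_mono mult_left_mono)
      fix v assume v: "v \<in> \<sigma>"
      have "B \<in> optimal x (coord x v)" using B v by (simp add: optimal_coord)
      then show "?P (coord x v) B' \<le> ?P (coord x v) B" using V.maximizers_le B' by blast
      show "0 \<le> w v" using w(1) v by blast
    qed
    with BI show ?thesis by (simp add: maximizers_def)
  qed
  have "optimal x p \<noteq> {}" using chain_common_basis[OF \<sigma>] opt by blast
  moreover have "\<exists>B\<in>optimal x p. f \<in> B" if "f \<in> ends" for f
    using chain_common_basis[OF \<sigma>, of f] opt that by blast
  moreover have "p \<in> ends \<rightarrow>\<^sub>E UNIV" unfolding p by simp
  ultimately show "p \<in> tropical x" by (simp add: tropical_linear_space_def)
qed

end

text \<open>The weights are the gaps between consecutive elements of \<open>S\<close>, with 1 as the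
  upper end of the last gap, so tail sums telescope to \<open>1 - t\<close>. Adding a new smallest
  element \<open>b\<close> gives it what is missing from \<open>1 - b\<close>.\<close>

lemma breakpoint_weights:
  fixes S :: "real set"
  assumes "finite S" "S \<subseteq> {..1}"
  shows "\<exists>w. (\<forall>s\<in>S. 0 \<le> w s) \<and> (\<forall>t\<in>S. (\<Sum>s | s \<in> S \<and> t \<le> s. w s) = 1 - t)"
  using assms
proof (induction S rule: finite_linorder_min_induct)
  case (insert b S)
  then obtain w where w: "\<forall>s\<in>S. 0 \<le> w s" "\<forall>t\<in>S. (\<Sum>s | s \<in> S \<and> t \<le> s. w s) = 1 - t" by auto
  define W where "W = (\<Sum>s\<in>S. w s)"
  have W: "W \<le> 1 - b"
  proof (cases "S = {}")
    case False
    then have "Min S \<in> S" using insert.hyps(1) by simp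
    moreover have "{s \<in> S. Min S \<le> s} = S" using insert.hyps(1) by auto
    ultimately have "W = 1 - Min S" using w(2) by (metis W_def)
    moreover have "b < Min S" using insert.hyps(2) \<open>Min S \<in> S\<close> by blast
    ultimately show ?thesis by simp
  qed (use insert.prems in \<open>simp add: W_def\<close>)
  let ?w = "w(b := 1 - b - W)"
  have "b \<notin> S" using insert.hyps(2) by auto
  have "(\<Sum>s | s \<in> insert b S \<and> t \<le> s. ?w s) = 1 - t" if t: "t \<in> insert b S" for t
  proof (cases "t = b")
    case True
    have "{s \<in> insert b S. b \<le> s} = insert b S" using insert.hyps(2) by auto
    moreover have "(\<Sum>s\<in>S. ?w s) = W" unfolding W_def by (rule sum.cong) (use \<open>b \<notin> S\<close> in auto)
    ultimately show ?thesis using True \<open>b \<notin> S\<close> insert.hyps(1) by simp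
  next
    case False
    with t have "t \<in> S" by simp
    moreover have "{s \<in> insert b S. t \<le> s} = {s \<in> S. t \<le> s}" using insert.hyps(2) \<open>t \<in> S\<close> by auto
    moreover have "(\<Sum>s | s \<in> S \<and> t \<le> s. ?w s) = (\<Sum>s | s \<in> S \<and> t \<le> s. w s)"
      by (rule sum.cong) (use \<open>b \<notin> S\<close> in auto)
    ultimately show ?thesis using w(2) by simp
  qed
  moreover have "\<forall>s\<in>insert b S. 0 \<le> ?w s" using w(1) W by auto
  ultimately show ?case by blast
qed simp

text \<open>On \<open>[0, 1)\<close> the floor jumps once, at \<open>1 - frac q\<close>; for an
  integer \<open>q\<close> this would be at 1, so there is no jump.\<close>

lemma floor_add_eq:
  fixes q s :: real
  assumes "0 \<le> s" "s < 1"
  shows "\<lfloor>q + s\<rfloor> = \<lfloor>q\<rfloor> + (if 1 - frac q \<le> s then 1 else 0)"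
  using assms unfolding frac_def by (auto simp: floor_eq_iff) linarith+

lemma simplex_hull_mono:
  assumes "finite \<sigma>" "\<tau> \<subseteq> \<sigma>"
  shows "simplex_hull E \<phi> \<tau> \<subseteq> simplex_hull E \<phi> \<sigma>"
proof
  fix p assume "p \<in> simplex_hull E \<phi> \<tau>"
  then obtain w where w: "\<forall>v\<in>\<tau>. 0 \<le> w v" "(\<Sum>v\<in>\<tau>. w v) = 1" "p = (\<lambda>e\<in>E. \<Sum>v\<in>\<tau>. w v * \<phi> v e)"
    by (auto simp: simplex_hull_def)
  define u where "u v = (if v \<in> \<tau> then w v else 0)" for v
  have u: "(\<Sum>v\<in>\<sigma>. u v * g v) = (\<Sum>v\<in>\<tau>. w v * g v)" for g
    by (rule sum.mono_neutral_cong_right) (use assms in \<open>auto simp: u_def\<close>)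
  have "\<forall>v\<in>\<sigma>. 0 \<le> u v" using w(1) by (simp add: u_def)
  moreover have "(\<Sum>v\<in>\<sigma>. u v) = 1" using u[of "\<lambda>_. 1"] w(2) by simp
  moreover have "p = (\<lambda>e\<in>E. \<Sum>v\<in>\<sigma>. u v * \<phi> v e)" using w(3) u by simp
  ultimately show "p \<in> simplex_hull E \<phi> \<sigma>" unfolding simplex_hull_def by blast
qed

context uniform_lattice
begin

section \<open>The geometric realization\<close>

text \<open>The valuation is integral, so each coordinate of \<open>q\<close> differs by an integer
  from one in an optimal basis. Although there may be infinitely many ends, only finitely many
  fractional parts occur.\<close>

lemma tropical_frac:
  assumes q: "q \<in> tropical x" and B: "B \<in> optimal x q" and f: "f \<in> ends"
  shows "\<exists>g\<in>B. frac (q f) = frac (q g)"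
proof (cases "f \<in> B")
  case False
  with f obtain g where g: "g \<in> B"
    "q f = real_of_int (omega n x B) - real_of_int (omega n x (insert f (B - {g}))) + q g"
    using V.tropical_eq[OF q B, of f] by blast
  then have "q f = q g + real_of_int (omega n x B - omega n x (insert f (B - {g})))" by simp
  then have "frac (q f) = frac (q g)" by (simp only: frac_add_of_int_right)
  with g(1) show ?thesis by blast
qed blast

text \<open>Every \<open>q\<close> in the tropical linear space is the average over \<open>t \<in> [0, 1)\<close> of the lattice points
  \<open>\<lfloor>q + t\<rfloor>\<close>, which form a chain; only the breakpoints of \<open>t \<mapsto> \<lfloor>q + t\<rfloor>\<close> matter.\<close>

lemma tropical_subset_simplex_hulls:
  assumes q: "q \<in> tropical x"
  shows "\<exists>\<sigma>\<in>chain_complex. q \<in> simplex_hull ends (coord x) \<sigma>"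
proof -
  obtain B where B: "B \<in> optimal x q" using q by (auto simp: tropical_linear_space_def)
  have finB: "finite B" using V.base_finite[OF V.maximizersD[OF B]] .
  have "\<forall>t. \<exists>y. \<forall>e\<in>ends. coord x y e = of_int \<lfloor>q e + t\<rfloor>" using tropical_floor_point[OF q] by blast
  then obtain y where y: "\<And>t e. e \<in> ends \<Longrightarrow> coord x (y t) e = of_int \<lfloor>q e + t\<rfloor>" by metis
  have mono: "y s \<le> y t" if "s \<le> t" for s t
    unfolding coord_le_iff[of "y s" "y t" x] using y that by (auto intro: floor_mono)
  have "coord x (asc (y 0)) e = coord x (y 0) e + 1" if "e \<in> ends" for e
    using that busemann_add[OF that, of x "y 0" "asc (y 0)"] busemann_asc[OF that, of "y 0"]
    by (simp add: coord_def)
  then have "\<forall>e\<in>ends. coord x (y 1) e \<le> coord x (asc (y 0)) e" using y by simp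
  then have y1: "y 1 \<le> asc (y 0)" using coord_le_iff by blast
  \<comment> \<open>These are the breakpoints for ends in \<open>B\<close>, which by
    \<open>tropical_frac\<close> serve all ends. The value 0 is added so that the lowest point
    \<open>y 0\<close> is a vertex and the weights have total 1.\<close>
  define S where "S = insert 0 {1 - frac (q g) |g. g \<in> B \<and> frac (q g) \<noteq> 0}"
  have finS: "finite S" using finB by (simp add: S_def)
  have S: "0 \<le> s \<and> s < 1" if "s \<in> S" for s
    using that frac_lt_1[of "q _"] frac_ge_0[of "q _"] by (auto simp: S_def less_le)
  obtain w where w: "\<forall>s\<in>S. 0 \<le> w s" "\<forall>t\<in>S. (\<Sum>s | s \<in> S \<and> t \<le> s. w s) = 1 - t"
    using breakpoint_weights[OF finS] S by fastforce
  have "{s \<in> S. 0 \<le> s} = S" using S by blast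
  then have sum1: "(\<Sum>s\<in>S. w s) = 1" using w(2) by (auto simp: S_def)
  have avg: "(\<Sum>s\<in>S. w s * coord x (y s) e) = q e" if e: "e \<in> ends" for e
  proof -
    let ?t = "1 - frac (q e)"
    have "(\<Sum>s\<in>S. w s * coord x (y s) e) =
        (\<Sum>s\<in>S. w s * of_int \<lfloor>q e\<rfloor> + (if ?t \<le> s then w s else 0))"
      by (rule sum.cong) (use y[OF e] S floor_add_eq in \<open>auto simp: distrib_left\<close>)
    also have "\<dots> = of_int \<lfloor>q e\<rfloor> + (\<Sum>s | s \<in> S \<and> ?t \<le> s. w s)"
      using sum1 finS by (simp add: sum.distrib sum.inter_filter flip: sum_distrib_right)
    also have "(\<Sum>s | s \<in> S \<and> ?t \<le> s. w s) = frac (q e)"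
    proof (cases "frac (q e) = 0")
      case True
      have "\<not> ?t \<le> s" if "s \<in> S" for s using S[OF that] unfolding True by simp
      then have "{s \<in> S. ?t \<le> s} = {}" by blast
      then show ?thesis using True by (simp only: sum.empty)
    next
      case False
      obtain g where "g \<in> B" "frac (q e) = frac (q g)" using tropical_frac[OF q B e] by blast
      with False have "?t \<in> S" by (auto simp: S_def)
      with w(2) have "(\<Sum>s | s \<in> S \<and> ?t \<le> s. w s) = 1 - ?t" by blast
      then show ?thesis by simp
    qed
    finally show ?thesis by (simp add: frac_def)
  qed
  let ?\<sigma> = "y ` S"
  \<comment> \<open>Weights are collected over breakpoints that yield the same lattice
    point.\<close>
  define u where "u v = (\<Sum>s | s \<in> S \<and> y s = v. w s)" for v
  have u: "(\<Sum>v\<in>?\<sigma>. u v * g v) = (\<Sum>s\<in>S. w s * g (y s))" for g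
  proof -
    have "(\<Sum>s\<in>S. w s * g (y s)) = (\<Sum>v\<in>?\<sigma>. \<Sum>s | s \<in> S \<and> y s = v. w s * g (y s))"
      by (rule sum.image_gen[OF finS])
    also have "\<dots> = (\<Sum>v\<in>?\<sigma>. u v * g v)"
      unfolding u_def sum_distrib_right by (intro sum.cong) auto
    finally show ?thesis by simp
  qed
  have "?\<sigma> \<in> chain_complex"
    unfolding chain_complex_iff
  proof (intro conjI)
    show "finite ?\<sigma>" using finS by simp
    show "\<exists>m\<in>?\<sigma>. \<forall>v\<in>?\<sigma>. m \<le> v \<and> v \<le> asc m"
    proof (rule bexI[of _ "y 0"], rule ballI)
      show "y 0 \<in> ?\<sigma>" by (simp add: S_def)
      fix v assume "v \<in> ?\<sigma>"
      then obtain s where "s \<in> S" "v = y s" by blast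
      with S have "y 0 \<le> v" "v \<le> y 1" by (auto intro: mono less_imp_le)
      with y1 show "y 0 \<le> v \<and> v \<le> asc (y 0)" using order.trans by blast
    qed
    show "\<forall>a\<in>?\<sigma>. \<forall>b\<in>?\<sigma>. a \<le> b \<or> b \<le> a"
    proof (intro ballI)
      fix a b assume "a \<in> ?\<sigma>" "b \<in> ?\<sigma>"
      then obtain s t where "a = y s" "b = y t" by blast
      then show "a \<le> b \<or> b \<le> a" using mono[of s t] mono[of t s] linear[of s t] by blast
    qed
  qed
  moreover have "q \<in> simplex_hull ends (coord x) ?\<sigma>"
  proof -
    have "q = (\<lambda>e\<in>ends. \<Sum>v\<in>?\<sigma>. u v * coord x v e)"
    proof
      fix e
      show "q e = (\<lambda>e\<in>ends. \<Sum>v\<in>?\<sigma>. u v * coord x v e) e"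
        using u[of "\<lambda>v. coord x v e"] avg q
        by (cases "e \<in> ends") (auto simp: tropical_linear_space_def PiE_iff extensional_def)
    qed
    moreover have "\<forall>v\<in>?\<sigma>. 0 \<le> u v" using w(1) by (auto simp: u_def intro: sum_nonneg)
    moreover have "(\<Sum>v\<in>?\<sigma>. u v) = 1" using u[of "\<lambda>_. 1"] sum1 by simp
    ultimately show ?thesis unfolding simplex_hull_def by blast
  qed
  ultimately show ?thesis by blast
qed

section \<open>Affine independence of simplices and their intersections\<close>

lemma chain_minimum:
  assumes "\<sigma> \<in> (chain_complex :: 'a set set)"
  obtains m where "finite \<sigma>" "m \<in> \<sigma>" "\<forall>v\<in>\<sigma>. m \<le> v \<and> v \<le> asc m" "\<forall>u\<in>\<sigma>. \<forall>v\<in>\<sigma>. u \<le> v \<or> v \<le> u"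
  using assms unfolding chain_complex_iff by blast

lemma chain_coord:
  assumes "m \<le> v" "v \<le> asc m" and e: "e \<in> ends"
  shows "coord x v e = coord x m e \<or> coord x v e = coord x m e + 1"
proof -
  have "0 \<le> busemann e m v" using busemann_nonneg[OF e assms(1)] .
  moreover have "busemann e m v \<le> 1"
    using busemann_mono[OF e assms(2), of m] busemann_asc[OF e, of m] by simp
  ultimately have "busemann e m v = 0 \<or> busemann e m v = 1" by linarith
  then show ?thesis using busemann_add[OF e, of x m v] e by (auto simp: coord_def)
qed

lemma sum_chain_coord:
  fixes w :: "'a \<Rightarrow> real"
  assumes "finite \<sigma>" "\<forall>v\<in>\<sigma>. m \<le> v \<and> v \<le> asc m" "e \<in> ends"
  shows "(\<Sum>v\<in>\<sigma>. w v * coord x v e) =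
    (\<Sum>v\<in>\<sigma>. w v) * coord x m e + (\<Sum>v | v \<in> \<sigma> \<and> coord x v e \<noteq> coord x m e. w v)"
proof -
  have "(\<Sum>v\<in>\<sigma>. w v * coord x v e) =
      (\<Sum>v\<in>\<sigma>. w v * coord x m e + (if coord x v e \<noteq> coord x m e then w v else 0))"
  proof (rule sum.cong[OF refl])
    fix v assume "v \<in> \<sigma>"
    with assms(2) have "m \<le> v" "v \<le> asc m" by auto
    from chain_coord[OF this assms(3), of x]
    show "w v * coord x v e = w v * coord x m e + (if coord x v e \<noteq> coord x m e then w v else 0)"
      by (auto simp: distrib_left)
  qed
  also have "\<dots> = (\<Sum>v\<in>\<sigma>. w v) * coord x m e + (\<Sum>v | v \<in> \<sigma> \<and> coord x v e \<noteq> coord x m e. w v)"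
    using assms(1) by (simp add: sum.distrib sum.inter_filter flip: sum_distrib_right)
  finally show ?thesis .
qed

text \<open>For a vertex \<open>v\<close> other than the minimum there is an end whose coordinate
  separates \<open>v\<close> from its predecessor. Coordinates along the chain take only two
  consecutive values, so this coordinate equation says that the weights from \<open>v\<close>
  upwards sum to zero. All tail sums vanish, hence all weights.\<close>

lemma affinely_independent_coord:
  assumes "\<sigma> \<in> chain_complex"
  shows "affinely_independent ends (coord x) \<sigma>"
  unfolding affinely_independent_def
proof (intro allI impI)
  fix w assume w: "(\<Sum>v\<in>\<sigma>. w v) = 0 \<and> (\<forall>e\<in>ends. (\<Sum>v\<in>\<sigma>. w v * coord x v e) = 0)"
  obtain m where m: "finite \<sigma>" "m \<in> \<sigma>" "\<forall>v\<in>\<sigma>. m \<le> v \<and> v \<le> asc m" "\<forall>u\<in>\<sigma>. \<forall>v\<in>\<sigma>. u \<le> v \<or> v \<le> u"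
    using chain_minimum[OF assms] .
  have tail: "(\<Sum>u | u \<in> \<sigma> \<and> v \<le> u. w u) = 0" if v: "v \<in> \<sigma>" for v
  proof (cases "v = m")
    case True
    then have "{u \<in> \<sigma>. v \<le> u} = \<sigma>" using m(3) by auto
    then show ?thesis using w by simp
  next
    case False
    let ?A = "{u \<in> \<sigma>. u < v}"
    have "m \<in> ?A" using False m(2,3) v by (auto simp: order.strict_iff_order)
    then obtain a where a: "a \<in> ?A" "\<And>u. u \<in> ?A \<Longrightarrow> a \<le> u \<Longrightarrow> a = u"
      using finite_has_maximal[of ?A] m(1) by auto
    have le: "u \<le> a" if "u \<in> ?A" for u using a that m(4) by auto
    have "\<not> v \<le> a" using a(1) by auto
    then obtain e where e: "e \<in> ends" "coord x a e < coord x v e"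
      using coord_le_iff[of v a x] by (auto simp: not_le)
    have "{u \<in> \<sigma>. coord x u e \<noteq> coord x m e} = {u \<in> \<sigma>. v \<le> u}"
    proof (rule Collect_cong, rule conj_cong[OF refl])
      fix u assume u: "u \<in> \<sigma>"
      have ma: "coord x m e \<le> coord x a e" using m(3) a(1) e(1) coord_le_iff[of m a x] by auto
      show "coord x u e \<noteq> coord x m e \<longleftrightarrow> v \<le> u"
      proof
        assume "v \<le> u"
        then have "coord x v e \<le> coord x u e" using e(1) coord_le_iff[of v u x] by blast
        with ma e(2) show "coord x u e \<noteq> coord x m e" by simp
      next
        assume ne: "coord x u e \<noteq> coord x m e"
        show "v \<le> u"
        proof (rule ccontr)
          assume "\<not> v \<le> u"
          then have "u \<le> a" using le[of u] m(4) u v by (auto simp: order.strict_iff_order)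
          then have "coord x u e \<le> coord x a e" using e(1) coord_le_iff[of u a x] by blast
          moreover have "coord x u e = coord x m e + 1"
            using chain_coord[of m u e x] m(3) u e(1) ne by auto
          moreover have "coord x v e \<le> coord x m e + 1"
            using chain_coord[of m v e x] m(3) v e(1) by auto
          ultimately show False using e(2) by simp
        qed
      qed
    qed
    then show ?thesis using sum_chain_coord[OF m(1,3) e(1), of w x] w e(1) by simp
  qed
  show "\<forall>v\<in>\<sigma>. w v = 0"
  proof
    fix v assume v: "v \<in> \<sigma>"
    let ?A = "{u \<in> \<sigma>. v < u}"
    have "(\<Sum>u\<in>?A. w u) = 0"
    proof (cases "?A = {}")
      case False
      then obtain a where a: "a \<in> ?A" "\<And>u. u \<in> ?A \<Longrightarrow> u \<le> a \<Longrightarrow> a = u"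
        using finite_has_minimal[of ?A] m(1) by auto
      have "?A = {u \<in> \<sigma>. a \<le> u}"
      proof (rule Collect_cong, rule conj_cong[OF refl])
        fix u assume u: "u \<in> \<sigma>"
        show "v < u \<longleftrightarrow> a \<le> u"
        proof
          assume "v < u"
          then show "a \<le> u" using a(2)[of u] a(1) m(4) u by auto
        next
          assume "a \<le> u"
          then show "v < u" using a(1) by (auto intro: order.strict_trans2)
        qed
      qed
      then show ?thesis using tail[of a] a(1) by simp
    qed (simp only: sum.empty)
    moreover have "{u \<in> \<sigma>. v \<le> u} = insert v ?A" using v by (auto simp: order.strict_iff_order)
    ultimately show "w v = 0" using tail[OF v] m(1) by simp
  qed
qed

text \<open>The point alone determines its carrier: the vertices are the floors of
  \<open>p + t\<close> for \<open>t\<close> in \<open>[0, 1)\<close>. The vertex \<open>v\<close>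
  appears at \<open>t = 1 - W v\<close>, where \<open>W v\<close> is the weight from
  \<open>v\<close> upwards; positivity of the weights separates the vertices whose
  \<open>e\<close>-coordinate has already jumped from the others.\<close>

lemma simplex_interior:
  assumes \<sigma>: "\<sigma> \<in> chain_complex" and w: "\<forall>v\<in>\<sigma>. 0 < w v" "(\<Sum>v\<in>\<sigma>. w v) = 1"
    and p: "\<forall>e\<in>ends. p e = (\<Sum>v\<in>\<sigma>. w v * coord x v e)"
  shows simplex_vertex_is_floor: "v \<in> \<sigma> \<Longrightarrow> \<exists>t. 0 \<le> t \<and> t < 1 \<and> (\<forall>e\<in>ends. coord x v e = of_int \<lfloor>p e + t\<rfloor>)"
    and simplex_floor_is_vertex: "0 \<le> t \<Longrightarrow> t < 1 \<Longrightarrow> \<exists>v\<in>\<sigma>. \<forall>e\<in>ends. coord x v e = of_int \<lfloor>p e + t\<rfloor>"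
proof -
  obtain m where m: "finite \<sigma>" "m \<in> \<sigma>" "\<forall>v\<in>\<sigma>. m \<le> v \<and> v \<le> asc m" "\<forall>u\<in>\<sigma>. \<forall>v\<in>\<sigma>. u \<le> v \<or> v \<le> u"
    using chain_minimum[OF \<sigma>] .
  define W where "W v = (\<Sum>u | u \<in> \<sigma> \<and> v \<le> u. w u)" for v
  \<comment> \<open>For an end \<open>e\<close> this is an upper part of the chain without
    \<open>m\<close>, and its total weight is the fractional part of \<open>p e\<close>.\<close>
  define U where "U e = {v \<in> \<sigma>. coord x v e \<noteq> coord x m e}" for e
  have pe: "p e = coord x m e + (\<Sum>v\<in>U e. w v)" if "e \<in> ends" for e
    using sum_chain_coord[OF m(1,3) that, of w x] p that w(2) by (simp add: U_def)
  have subsum: "(\<Sum>v\<in>A. w v) \<le> (\<Sum>v\<in>C. w v)" if "A \<subseteq> C" "C \<subseteq> \<sigma>" for A C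
    using that w(1) m(1) finite_subset by (intro sum_mono2) (auto intro: less_imp_le)
  have U1: "(\<Sum>v\<in>U e. w v) < 1" for e
  proof -
    have "(\<Sum>v\<in>U e. w v) \<le> (\<Sum>v\<in>\<sigma> - {m}. w v)" by (rule subsum) (auto simp: U_def)
    also have "\<dots> < 1" using sum.remove[OF m(1,2), of w] w m(2) by force
    finally show ?thesis .
  qed
  have U0: "0 \<le> (\<Sum>v\<in>U e. w v)" for e using subsum[of "{}" "U e"] by (auto simp: U_def)
  have up: "{u \<in> \<sigma>. v \<le> u} \<subseteq> U e" if "v \<in> U e" "e \<in> ends" for v e
  proof
    fix u assume u: "u \<in> {u \<in> \<sigma>. v \<le> u}"
    have "coord x m e \<le> coord x v e" "coord x v e \<le> coord x u e"
      using coord_le_iff[of m v x] coord_le_iff[of v u x] u that m(3) by (auto simp: U_def)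
    with that(1) u show "u \<in> U e" by (auto simp: U_def)
  qed
  have WU: "W v \<le> (\<Sum>v\<in>U e. w v)" if "v \<in> U e" "e \<in> ends" for v e
    unfolding W_def by (rule subsum[OF up[OF that]]) (auto simp: U_def)
  have not_up: "v < u" if "v \<in> \<sigma>" "v \<notin> U e" "u \<in> U e" "e \<in> ends" for u v e
  proof -
    have "\<not> u \<le> v" using up[OF that(3,4)] that(1,2) by blast
    then show ?thesis using m(4) that(1,3) by (auto simp: U_def order.strict_iff_order)
  qed
  have coordU: "coord x v e = coord x m e + 1" if "v \<in> U e" "e \<in> ends" for v e
    using chain_coord[of m v e x] m(3) that by (auto simp: U_def)
  have coordnU: "coord x v e = coord x m e" if "v \<in> \<sigma>" "v \<notin> U e" for v e
    using that by (simp add: U_def)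
  have floor: "coord x v e = of_int \<lfloor>p e + t\<rfloor>"
    if v: "v \<in> \<sigma>" and t: "0 \<le> t" "t < 1" and e: "e \<in> ends"
      and in_U: "v \<in> U e \<Longrightarrow> 1 \<le> (\<Sum>v\<in>U e. w v) + t" and not_U: "v \<notin> U e \<Longrightarrow> (\<Sum>v\<in>U e. w v) + t < 1"
    for v t e
  proof -
    obtain k where k: "coord x m e = of_int k" using e by (simp add: coord_def)
    show ?thesis
    proof (cases "v \<in> U e")
      case True
      have "\<lfloor>p e + t\<rfloor> = k + 1"
        using in_U[OF True] U1[of e] t pe[OF e] k by (simp add: floor_eq_iff)
      then show ?thesis using coordU[OF True e] k by simp
    next
      case False
      have "\<lfloor>p e + t\<rfloor> = k"
        using not_U[OF False] U0[of e] t pe[OF e] k by (simp add: floor_eq_iff)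
      then show ?thesis using coordnU[OF v False] k by simp
    qed
  qed
  have W: "0 < W v" "W v \<le> 1" if "v \<in> \<sigma>" for v
  proof -
    have "(\<Sum>u\<in>{v}. w u) \<le> W v" unfolding W_def by (rule subsum) (use that in auto)
    then show "0 < W v" using w(1) that by fastforce
    have "W v \<le> (\<Sum>u\<in>\<sigma>. w u)" unfolding W_def by (rule subsum) auto
    then show "W v \<le> 1" using w(2) by simp
  qed
  show "\<exists>t. 0 \<le> t \<and> t < 1 \<and> (\<forall>e\<in>ends. coord x v e = of_int \<lfloor>p e + t\<rfloor>)" if v: "v \<in> \<sigma>"
  proof (intro exI[of _ "1 - W v"] conjI ballI)
    show t: "0 \<le> 1 - W v" "1 - W v < 1" using W[OF v] by simp_all
    fix e :: "(nat \<Rightarrow> 'a) set" assume e: "e \<in> ends"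
    show "coord x v e = of_int \<lfloor>p e + (1 - W v)\<rfloor>"
    proof (rule floor[OF v t e])
      show "1 \<le> (\<Sum>v\<in>U e. w v) + (1 - W v)" if "v \<in> U e" using WU[OF that e] by simp
      assume nU: "v \<notin> U e"
      have "U e \<subseteq> {u \<in> \<sigma>. v \<le> u} - {v}"
        using not_up[OF v nU _ e] by (auto simp: U_def less_imp_le)
      then have "(\<Sum>v\<in>U e. w v) \<le> (\<Sum>u\<in>{u \<in> \<sigma>. v \<le> u} - {v}. w u)" by (rule subsum) auto
      also have "\<dots> < W v"
        using sum.remove[of "{u \<in> \<sigma>. v \<le> u}" v w] m(1) v w(1) by (simp add: W_def)
      finally show "(\<Sum>v\<in>U e. w v) + (1 - W v) < 1" by simp
    qed
  qed
  show "\<exists>v\<in>\<sigma>. \<forall>e\<in>ends. coord x v e = of_int \<lfloor>p e + t\<rfloor>" if t: "0 \<le> t" "t < 1"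
  proof -
    \<comment> \<open>The required vertex is the greatest one whose threshold \<open>1 - W v\<close>
      is at most \<open>t\<close>; the minimum \<open>m\<close> has threshold 0, so one
      exists.\<close>
    let ?A = "{v \<in> \<sigma>. 1 - W v \<le> t}"
    have "{u \<in> \<sigma>. m \<le> u} = \<sigma>" using m(3) by blast
    then have "W m = 1" using w(2) by (simp add: W_def)
    then have "m \<in> ?A" using m(2) t by simp
    then obtain v where v: "v \<in> ?A" "\<And>u. u \<in> ?A \<Longrightarrow> v \<le> u \<Longrightarrow> v = u"
      using finite_has_maximal[of ?A] m(1) by auto
    have "coord x v e = of_int \<lfloor>p e + t\<rfloor>" if e: "e \<in> ends" for e
    proof (rule floor[OF _ t e])
      show v\<sigma>: "v \<in> \<sigma>" using v(1) by simp
      show "1 \<le> (\<Sum>v\<in>U e. w v) + t" if "v \<in> U e" using WU[OF that e] v(1) by simp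
      assume nU: "v \<notin> U e"
      show "(\<Sum>v\<in>U e. w v) + t < 1"
      proof (cases "U e = {}")
        case False
        have "finite (U e)" using m(1) by (simp add: U_def)
        then obtain a where a: "a \<in> U e" "\<And>u. u \<in> U e \<Longrightarrow> u \<le> a \<Longrightarrow> a = u"
          using finite_has_minimal[of "U e"] False by auto
        have "U e \<subseteq> {u \<in> \<sigma>. a \<le> u}" using a m(4) by (auto simp: U_def)
        then have le: "(\<Sum>v\<in>U e. w v) \<le> W a" unfolding W_def by (rule subsum) auto
        have "v < a" using not_up[OF v\<sigma> nU a(1) e] .
        then have "a \<notin> ?A" using v(2)[of a] by (auto simp: order.strict_iff_order)
        then have "t < 1 - W a" using a(1) by (simp add: U_def)
        with le show ?thesis by simp
      qed (use t in simp)
    qed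
    with v(1) show ?thesis by blast
  qed
qed

lemma simplex_hull_interior:
  assumes \<sigma>: "\<sigma> \<in> chain_complex" and p: "p \<in> simplex_hull ends (coord x) \<sigma>"
  shows "\<exists>\<tau> w. \<tau> \<subseteq> \<sigma> \<and> \<tau> \<in> chain_complex \<and> (\<forall>v\<in>\<tau>. 0 < w v) \<and> (\<Sum>v\<in>\<tau>. w v) = 1 \<and>
    p = (\<lambda>e\<in>ends. \<Sum>v\<in>\<tau>. w v * coord x v e)"
proof -
  obtain w where w: "\<forall>v\<in>\<sigma>. 0 \<le> w v" "(\<Sum>v\<in>\<sigma>. w v) = 1" "p = (\<lambda>e\<in>ends. \<Sum>v\<in>\<sigma>. w v * coord x v e)"
    using p by (auto simp: simplex_hull_def)
  have fin: "finite \<sigma>" using \<sigma> by (simp add: chain_complex_iff)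
  let ?\<tau> = "{v \<in> \<sigma>. 0 < w v}"
  have sum: "(\<Sum>v\<in>\<sigma>. w v * g v) = (\<Sum>v\<in>?\<tau>. w v * g v)" for g
    by (rule sum.mono_neutral_right) (use fin w(1) in \<open>auto simp: order.order_iff_strict\<close>)
  have 1: "(\<Sum>v\<in>?\<tau>. w v) = 1" using sum[of "\<lambda>_. 1"] w(2) by simp
  then have "?\<tau> \<noteq> {}" by force
  then have "?\<tau> \<in> chain_complex" by (intro chain_complex_subset[OF \<sigma>]) auto
  moreover have "p = (\<lambda>e\<in>ends. \<Sum>v\<in>?\<tau>. w v * coord x v e)" using w(3) sum by simp
  ultimately show ?thesis using 1 by (intro exI[of _ ?\<tau>] exI[of _ w]) auto
qed

text \<open>Each vertex of one chain is a floor of \<open>p + t\<close>, each such floor is a vertex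
  of the other, and a lattice point is determined by its coordinates. So a point common to two
  simplices has its carrier in both.\<close>

lemma simplex_interior_subset:
  assumes "\<sigma> \<in> chain_complex" "\<forall>v\<in>\<sigma>. 0 < w v" "(\<Sum>v\<in>\<sigma>. w v) = 1"
    "\<forall>e\<in>ends. p e = (\<Sum>v\<in>\<sigma>. w v * coord x v e)"
    and "\<tau> \<in> chain_complex" "\<forall>v\<in>\<tau>. 0 < u v" "(\<Sum>v\<in>\<tau>. u v) = 1"
    "\<forall>e\<in>ends. p e = (\<Sum>v\<in>\<tau>. u v * coord x v e)"
  shows "\<sigma> \<subseteq> \<tau>"
proof
  fix v assume "v \<in> \<sigma>"
  from simplex_vertex_is_floor[OF assms(1-4) this]
  obtain t where t: "0 \<le> t" "t < 1" "\<forall>e\<in>ends. coord x v e = of_int \<lfloor>p e + t\<rfloor>" by blast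
  from simplex_floor_is_vertex[OF assms(5-8) t(1,2)]
  obtain v' where v': "v' \<in> \<tau>" "\<forall>e\<in>ends. coord x v' e = of_int \<lfloor>p e + t\<rfloor>" by blast
  have "v = v'" using coord_eq_iff[of x v v'] t(3) v'(2) by simp
  with v' show "v \<in> \<tau>" by simp
qed

lemma simplex_hull_Int:
  assumes \<sigma>: "\<sigma> \<in> chain_complex" and \<tau>: "\<tau> \<in> chain_complex"
  shows "simplex_hull ends (coord x) \<sigma> \<inter> simplex_hull ends (coord x) \<tau> =
    simplex_hull ends (coord x) (\<sigma> \<inter> \<tau>)"
proof (rule equalityI)
  have fin: "finite \<sigma>" "finite \<tau>" using \<sigma> \<tau> by (simp_all add: chain_complex_iff)
  show "simplex_hull ends (coord x) (\<sigma> \<inter> \<tau>) \<subseteq>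
      simplex_hull ends (coord x) \<sigma> \<inter> simplex_hull ends (coord x) \<tau>"
    using simplex_hull_mono[OF fin(1), of "\<sigma> \<inter> \<tau>"] simplex_hull_mono[OF fin(2), of "\<sigma> \<inter> \<tau>"] by blast
  show "simplex_hull ends (coord x) \<sigma> \<inter> simplex_hull ends (coord x) \<tau> \<subseteq>
      simplex_hull ends (coord x) (\<sigma> \<inter> \<tau>)"
  proof
    fix p assume p: "p \<in> simplex_hull ends (coord x) \<sigma> \<inter> simplex_hull ends (coord x) \<tau>"
    obtain \<sigma>' w where \<sigma>': "\<sigma>' \<subseteq> \<sigma>" "\<sigma>' \<in> chain_complex" "\<forall>v\<in>\<sigma>'. 0 < w v" "(\<Sum>v\<in>\<sigma>'. w v) = 1"
      "p = (\<lambda>e\<in>ends. \<Sum>v\<in>\<sigma>'. w v * coord x v e)"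
      using simplex_hull_interior[OF \<sigma>] p by blast
    obtain \<tau>' u where \<tau>': "\<tau>' \<subseteq> \<tau>" "\<tau>' \<in> chain_complex" "\<forall>v\<in>\<tau>'. 0 < u v" "(\<Sum>v\<in>\<tau>'. u v) = 1"
      "p = (\<lambda>e\<in>ends. \<Sum>v\<in>\<tau>'. u v * coord x v e)"
      using simplex_hull_interior[OF \<tau>] p by blast
    have "\<forall>e\<in>ends. p e = (\<Sum>v\<in>\<sigma>'. w v * coord x v e)" unfolding \<sigma>'(5) by simp
    moreover have "\<forall>e\<in>ends. p e = (\<Sum>v\<in>\<tau>'. u v * coord x v e)" unfolding \<tau>'(5) by simp
    ultimately have "\<sigma>' \<subseteq> \<tau>'" by (rule simplex_interior_subset[OF \<sigma>'(2-4) _ \<tau>'(2-4)])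
    then have sub: "\<sigma>' \<subseteq> \<sigma> \<inter> \<tau>" using \<sigma>'(1) \<tau>'(1) by blast
    have "\<forall>v\<in>\<sigma>'. 0 \<le> w v" using \<sigma>'(3) by (simp add: less_imp_le)
    then have "p \<in> simplex_hull ends (coord x) \<sigma>'"
      using \<sigma>'(4,5) unfolding simplex_hull_def by blast
    with simplex_hull_mono[OF _ sub] fin(1) show "p \<in> simplex_hull ends (coord x) (\<sigma> \<inter> \<tau>)" by blast
  qed
qed

lemma geometric_realization_tropical:
  "geometric_realization ends (chain_complex :: 'a set set) (tropical x)"
  unfolding geometric_realization_def
proof (intro exI[of _ "coord x"] conjI ballI)
  show "coord x v \<in> ends \<rightarrow>\<^sub>E UNIV" for v by (simp add: coord_def)
  show "tropical x = (\<Union>\<sigma>\<in>chain_complex. simplex_hull ends (coord x) \<sigma>)"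
    using tropical_subset_simplex_hulls simplex_hull_subset_tropical by blast
qed (fact affinely_independent_coord simplex_hull_Int)+

end

theorem theorem4p22:
  fixes x :: "'a::lattice" and n :: nat
  assumes "uniform_semimodular_lattice TYPE('a)"
    and "has_uniform_rank TYPE('a) n"
  shows "let \<omega> = (\<lambda>B. real_of_int (omega n x B));
             T = tropical_linear_space ends (bases_inf n) \<omega>
         in complete_valuated_matroid ends (bases_inf n) n \<omega> \<and>
            (\<exists>\<phi> :: 'a \<Rightarrow> (nat \<Rightarrow> 'a) set \<Rightarrow> real.
               bij_betw \<phi> UNIV (T \<inter> (ends \<rightarrow>\<^sub>E \<int>)) \<and>
               (\<forall>a b. a \<le> b \<longleftrightarrow> (\<forall>e\<in>ends. \<phi> a e \<le> \<phi> b e))) \<and>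
            geometric_realization ends (chain_complex :: 'a set set) T"
proof -
  interpret uniform_lattice "TYPE('a)" n using assms by unfold_locales
  show ?thesis
    unfolding Let_def
    using complete_omega[of x] bij_betw_coord[of x] coord_le_iff geometric_realization_tropical[of x]
    by blast
qed

end
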